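(* Let $H$ be a quasi-triangular bialgebra with comultiplication $\Delta$ and (universal) R-matrix $R$, let $n\ge1$ and $w\in S_n$. For $1\le i<j\le n$ put $\epsilon_{i,j}=\operatorname{sign}(w(j)-w(i))$, let $R^{(1)}=R$, $R^{(-1)}=R_{2,1}^{-1}$ (so $R^{(1)}_{i,j}=R_{i,j}$ and $R^{(-1)}_{i,j}=R_{j,i}^{-1}$), and let $$J_w=J_w(R)=\big(R_{2,n+1}^{(\epsilon_{1,2})}\big)\big(R_{3,n+2}^{(\epsilon_{2,3})}R_{3,n+1}^{(\epsilon_{1,3})}\big)\cdots\big(R_{n,2n-1}^{(\epsilon_{n-1,n})}\cdots R_{n,n+1}^{(\epsilon_{1,n})}\big)\in H^{\widehat\otimes 2n}.$$ Then: (a) $J_w$ is a Drinfeld twist for $(H^{\otimes n},\Delta_{H^{\otimes n}})$; hence $\Delta_w:H^{\otimes n}\to H^{\widehat\otimes 2n}$ defined by $\Delta_w(h)=J_w^{-1}\Delta_{H^{\otimes n}}(h)J_w$, $h\in H^{\otimes n}$, equips $H^{\otimes n}$ with a structure of a (topological) bialgebra $H^{\otimes n,w}$. (b) For every $\boldsymbol d=(d_1,\dots,d_n)\in\{1,-1\}^n$, $$(J_w(R)^{op})^{-1}R_{1,n+1}^{(d_1)}\cdots R_{n,2n}^{(d_n)}\,J_w(R)$$ is an R-matrix for $H^{\otimes n,w}$, where $X\mapsto X^{op}$ is the map on $H^{\widehat\otimes 2n}$ given by $X_1\otimes\cdots\otimes X_{2n}\mapsto X_{n+1}\otimes\cdots\otimes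 X_{2n}\otimes X_1\otimes\cdots\otimes X_n$.
   Context: Algebras are unital associative over a field $\Bbbk$ of characteristic zero. For $X\in H^{\otimes k}$ and distinct positions $i_1,\dots,i_k$, $X_{i_1,\dots,i_k}\in H^{\otimes N}$ has the $s$-th factor of $X$ in position $i_s$ and $1$ elsewhere. $H^{\widehat\otimes m}$ denotes $H^{\otimes m}$ or a suitable completion: an algebra containing $H^{\otimes m}$ such that leg embeddings, permutations of factors, and comultiplication or counit applied to a factor extend to these algebras as algebra homomorphisms, with the usual identities among them (coassociativity, counit axioms, commutation of elements placed in disjoint legs) preserved. Let $(B,\Delta,\varepsilon)$ be a (topological) bialgebra, i.e. $\Delta:B\to B\widehat\otimes B$. An R-matrix for $B$ is an invertible $R\in B\widehat\otimes B$ with $\tau(\Delta(b))=R\Delta(b)R^{-1}$ for all $b\in B$ ($\tau$ the flip), $(\Delta\otimes\mathrm{id})(R)=R_{1,3}R_{2,3}$ and $(\mathrm{id}\otimes\Delta)(R)=R_{1,3}R_{1,2}$; $B$ is quasi-triangular if it has one. A Drinfeld twist for $(B,\Delta)$ is an invertible $J\in B\widehat\otimes B$ such that $\Delta_J(b)=J^{-1}\Delta(b)J$ is a (topological) comultiplication on $B$ (coassociative, with counit $\varepsilon$) and $(\Delta\otimes\mathrm{id})(J)\cdot(J\otimes1)=(\mathrm{id}\otimes\Delta)(J)\cdot(1\otimes J)$. $H^{\otimes n}$ is a bialgebra with its standard comultiplication $\Delta_{H^{\otimes n}}(h^1\otimes\cdots\otimes h^n)=h^1_{(1)}\otimes\cdots\otimes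 h^n_{(1)}\otimes h^1_{(2)}\otimes\cdots\otimes h^n_{(2)}$; $H^{\widehat\otimes 2n}$ is regarded as $H^{\otimes n}\widehat\otimes H^{\otimes n}$ with the first $n$ positions being the first factor.
   Formalization: "Suitable completion" also requires: any relation f(x)u = u g(x), with f, g composed of leg embeddings, permutations, comultiplications and counits, that holds on H^{⊗m} holds on its completion (automatic if dense, Hausdorff and continuous); without this the Yang–Baxter equation can fail. *)

theory Defs
  imports "HOL-Algebra.Algebra" "HOL-Combinatorics.Permutations"
begin

section \<open>Unital associative algebras over a field\<close>

text \<open>
  The locale \<^locale>\<open>algebra\<close> of the library is restricted to commutative algebras; algebras
  here are not assumed to be commutative.
\<close>

locale assoc_algebra = module R M + ring M for R (structure) and M (structure) +
  assumes smult_mult_left: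
      "\<lbrakk>a \<in> carrier R; x \<in> carrier M; y \<in> carrier M\<rbrakk> \<Longrightarrow>
       (a \<odot>\<^bsub>M\<^esub> x) \<otimes>\<^bsub>M\<^esub> y = a \<odot>\<^bsub>M\<^esub> (x \<otimes>\<^bsub>M\<^esub> y)"
    and smult_mult_right:
      "\<lbrakk>a \<in> carrier R; x \<in> carrier M; y \<in> carrier M\<rbrakk> \<Longrightarrow>
       x \<otimes>\<^bsub>M\<^esub> (a \<odot>\<^bsub>M\<^esub> y) = a \<odot>\<^bsub>M\<^esub> (x \<otimes>\<^bsub>M\<^esub> y)"

definition alg_hom :: "'k ring \<Rightarrow> ('k, 'a) module \<Rightarrow> ('k, 'a) module \<Rightarrow> ('a \<Rightarrow> 'a) set" where
  "alg_hom K A B =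
     {f \<in> ring_hom A B. \<forall>a \<in> carrier K. \<forall>x \<in> carrier A. f (a \<odot>\<^bsub>A\<^esub> x) = a \<odot>\<^bsub>B\<^esub> f x}"

definition unital_subalgebra :: "'k ring \<Rightarrow> 'a set \<Rightarrow> ('k, 'a) module \<Rightarrow> bool" where
  "unital_subalgebra K H A \<longleftrightarrow>
     subring H A \<and> (\<forall>a \<in> carrier K. \<forall>x \<in> H. a \<odot>\<^bsub>A\<^esub> x \<in> H)"

definition list_prod :: "('a, 'm) monoid_scheme \<Rightarrow> 'a list \<Rightarrow> 'a" where
  "list_prod A xs = foldr (\<lambda>x y. x \<otimes>\<^bsub>A\<^esub> y) xs \<one>\<^bsub>A\<^esub>"


section \<open>Completed tensor powers\<close>

text \<open>
  The data of an algebra \<open>H\<close> with a family of (completed) tensor powers and structure maps.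
  \<^item> \<open>base\<close> is \<open>H\<close>, realised as a subalgebra of \<open>tpow 1\<close>, and \<open>tpow m\<close> is
    the \<open>m\<close>-th completed tensor power. The completion in degree 1 may be larger than \<open>H\<close>.
    Using one type \<open>'a\<close> for all degrees is no restriction, since the carriers may be chosen
    freely inside \<open>'a\<close>.
  \<^item> \<open>leg N [i\<^sub>1, \<dots>, i\<^sub>k] X\<close> is \<open>X\<close> with its factors in positions \<open>i\<^sub>1, \<dots>, i\<^sub>k\<close> of the \<open>N\<close>-th
    tensor power. Positions are counted from 1. For \<open>k = N\<close> these are the permutations of
    factors: the \<open>s\<close>-th factor moves to position \<open>i\<^sub>s\<close>.
  \<^item> \<open>cop N i\<close> applies the comultiplication to the \<open>i\<close>-th of \<open>N\<close> factors, whose two components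
    then occupy the positions \<open>i\<close> and \<open>i + 1\<close>.
  \<^item> \<open>cou N i\<close> applies the counit to the \<open>i\<close>-th of \<open>N\<close> factors.
\<close>

record ('k, 'a) tensor_system =
  scalars :: "'k ring"
  base :: "'a set"
  tpow :: "nat \<Rightarrow> ('k, 'a) module"
  leg :: "nat \<Rightarrow> nat list \<Rightarrow> 'a \<Rightarrow> 'a"
  cop :: "nat \<Rightarrow> nat \<Rightarrow> 'a \<Rightarrow> 'a"
  cou :: "nat \<Rightarrow> nat \<Rightarrow> 'a \<Rightarrow> 'a"

definition positions :: "nat \<Rightarrow> nat list \<Rightarrow> bool" where
  "positions N ps \<longleftrightarrow> distinct ps \<and> set ps \<subseteq> {1..N}"

definition pure_tensor :: "('k, 'a) tensor_system \<Rightarrow> 'a list \<Rightarrow> 'a" where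
  "pure_tensor S hs =
     list_prod (tpow S (length hs))
       (map (\<lambda>j. leg S (length hs) [j] (hs ! (j - 1))) [1..<length hs + 1])"

text \<open>The uncompleted tensor power, as a subset of \<open>tpow S m\<close>.\<close>

inductive_set tensors :: "('k, 'a) tensor_system \<Rightarrow> nat \<Rightarrow> 'a set"
  for S :: "('k, 'a) tensor_system" and m :: nat where
  pure: "\<lbrakk>length hs = m; set hs \<subseteq> base S\<rbrakk> \<Longrightarrow> pure_tensor S hs \<in> tensors S m"
| add: "\<lbrakk>x \<in> tensors S m; y \<in> tensors S m\<rbrakk> \<Longrightarrow> x \<oplus>\<^bsub>tpow S m\<^esub> y \<in> tensors S m"
| smult: "\<lbrakk>a \<in> carrier (scalars S); x \<in> tensors S m\<rbrakk> \<Longrightarrow> a \<odot>\<^bsub>tpow S m\<^esub> x \<in> tensors S m"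

definition multilinear_form :: "('k, 'a) tensor_system \<Rightarrow> nat \<Rightarrow> ('a list \<Rightarrow> 'k) \<Rightarrow> bool" where
  "multilinear_form S m f \<longleftrightarrow>
     (\<forall>hs. length hs = m \<and> set hs \<subseteq> base S \<longrightarrow>
        f hs \<in> carrier (scalars S) \<and>
        (\<forall>i < m. \<forall>x \<in> base S. \<forall>y \<in> base S.
           f (hs[i := x \<oplus>\<^bsub>tpow S 1\<^esub> y]) = f (hs[i := x]) \<oplus>\<^bsub>scalars S\<^esub> f (hs[i := y])) \<and>
        (\<forall>i < m. \<forall>x \<in> base S. \<forall>a \<in> carrier (scalars S).
           f (hs[i := a \<odot>\<^bsub>tpow S 1\<^esub> x]) = a \<otimes>\<^bsub>scalars S\<^esub> f (hs[i := x])))"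

definition linear_form_on_tensors ::
  "('k, 'a) tensor_system \<Rightarrow> nat \<Rightarrow> ('a \<Rightarrow> 'k) \<Rightarrow> bool" where
  "linear_form_on_tensors S m g \<longleftrightarrow>
     (\<forall>x \<in> tensors S m. g x \<in> carrier (scalars S) \<and>
        (\<forall>y \<in> tensors S m. g (x \<oplus>\<^bsub>tpow S m\<^esub> y) = g x \<oplus>\<^bsub>scalars S\<^esub> g y) \<and>
        (\<forall>a \<in> carrier (scalars S). g (a \<odot>\<^bsub>tpow S m\<^esub> x) = a \<otimes>\<^bsub>scalars S\<^esub> g x))"

text \<open>
  The maps that are composed of leg embeddings, permutations of factors, and comultiplications
  and counits applied to factors.
\<close>

inductive structure_map :: "('k, 'a) tensor_system \<Rightarrow> nat \<Rightarrow> nat \<Rightarrow> ('a \<Rightarrow> 'a) \<Rightarrow> bool"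
  for S :: "('k, 'a) tensor_system" and m :: nat where
  ident: "structure_map S m m (\<lambda>x. x)"
| leg: "\<lbrakk>structure_map S m (length ps) f; positions N ps\<rbrakk> \<Longrightarrow>
        structure_map S m N (\<lambda>x. leg S N ps (f x))"
| cop: "\<lbrakk>structure_map S m N f; 1 \<le> i; i \<le> N\<rbrakk> \<Longrightarrow>
        structure_map S m (N + 1) (\<lambda>x. cop S N i (f x))"
| cou: "\<lbrakk>structure_map S m N f; 1 \<le> i; i \<le> N\<rbrakk> \<Longrightarrow>
        structure_map S m (N - 1) (\<lambda>x. cou S N i (f x))"

text \<open>
  Conventions for the axioms below.
  \<^item> \<open>tensors_free\<close> says that \<open>tpow S m\<close> contains the tensor power of \<open>H\<close>: over a field,
    the canonical map from the tensor power is injective iff every multilinear form on \<open>H\<close>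
    factors through the pure tensors.
  \<^item> \<open>extend\<close> says that identities between the structure maps are preserved by the completion:
    they hold on \<open>tpow S m\<close> as soon as they hold on the tensor power of \<open>H\<close>. With
    \<open>u = \<one>\<close> this yields coassociativity, the counit axioms, the commutation of operations on
    different factors, and the compatibility of \<open>cop\<close> and \<open>cou\<close> with \<open>leg\<close> in all degrees. A general
    \<open>u\<close> is needed in order to apply an identity such as \<open>\<tau>(\<Delta>(b)) R = R \<Delta>(b)\<close> to one factor
    of an element of a completed tensor power. The axiom is void if \<open>tpow S m\<close> is
    the tensor power itself, and it holds whenever the tensor power is dense and all
    maps and the (separate) multiplications are continuous for Hausdorff topologies.
\<close>

locale completed_tensor_powers =
  fixes S :: "('k, 'a) tensor_system"
  assumes field: "field (scalars S)"
    and char_zero: "\<And>n::nat. n > 0 \<Longrightarrow> add_pow (scalars S) n \<one>\<^bsub>scalars S\<^esub> \<noteq> \<zero>\<^bsub>scalars S\<^esub>"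
    and algebras: "assoc_algebra (scalars S) (tpow S m)"
    and base: "unital_subalgebra (scalars S) (base S) (tpow S 1)"
    and leg_hom: "positions N ps \<Longrightarrow>
          leg S N ps \<in> alg_hom (scalars S) (tpow S (length ps)) (tpow S N)"
    and leg_id: "x \<in> carrier (tpow S N) \<Longrightarrow> leg S N [1..<N + 1] x = x"
    and leg_leg: "\<lbrakk>positions N ps; positions M qs; length qs = N;
            x \<in> carrier (tpow S (length ps))\<rbrakk> \<Longrightarrow>
          leg S M qs (leg S N ps x) = leg S M (map (\<lambda>p. qs ! (p - 1)) ps) x"
    and leg_commute: "\<lbrakk>positions N (ps @ qs);
            x \<in> carrier (tpow S (length ps)); y \<in> carrier (tpow S (length qs))\<rbrakk> \<Longrightarrow>
          leg S N ps x \<otimes>\<^bsub>tpow S N\<^esub> leg S N qs y = leg S N qs y \<otimes>\<^bsub>tpow S N\<^esub> leg S N ps x"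
    and tensors_free: "multilinear_form S m f \<Longrightarrow>
          \<exists>g. linear_form_on_tensors S m g \<and>
              (\<forall>hs. length hs = m \<and> set hs \<subseteq> base S \<longrightarrow> g (pure_tensor S hs) = f hs)"

text \<open>
  The comultiplication and counit of \<open>H\<close> are \<open>cop S 1 1\<close> and \<open>cou S 1 1\<close> restricted to \<open>base S\<close>;
  \<open>tensors S 0\<close> is a copy of the field, so \<open>counit_scalar\<close> says that the counit is scalar valued.
\<close>

abbreviation comult :: "('k, 'a) tensor_system \<Rightarrow> 'a \<Rightarrow> 'a" where
  "comult S b \<equiv> cop S 1 1 b"

abbreviation counit :: "('k, 'a) tensor_system \<Rightarrow> 'a \<Rightarrow> 'a" where
  "counit S b \<equiv> cou S 1 1 b"

locale topological_bialgebra = completed_tensor_powers S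
  for S :: "('k, 'a) tensor_system" +
  assumes cop_hom: "\<lbrakk>1 \<le> i; i \<le> N\<rbrakk> \<Longrightarrow>
          cop S N i \<in> alg_hom (scalars S) (tpow S N) (tpow S (N + 1))"
    and cou_hom: "\<lbrakk>1 \<le> i; i \<le> N\<rbrakk> \<Longrightarrow>
          cou S N i \<in> alg_hom (scalars S) (tpow S N) (tpow S (N - 1))"
    and cop_factor: "\<lbrakk>1 \<le> i; i \<le> N; 1 \<le> j; j \<le> N; b \<in> base S\<rbrakk> \<Longrightarrow>
          cop S N i (leg S N [j] b) =
            (if j < i then leg S (N + 1) [j] b
             else if j = i then leg S (N + 1) [i, i + 1] (comult S b)
             else leg S (N + 1) [j + 1] b)"
    and cou_factor: "\<lbrakk>1 \<le> i; i \<le> N; 1 \<le> j; j \<le> N; b \<in> base S\<rbrakk> \<Longrightarrow>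
          cou S N i (leg S N [j] b) =
            (if j < i then leg S (N - 1) [j] b
             else if j = i then leg S (N - 1) [] (counit S b)
             else leg S (N - 1) [j - 1] b)"
    and counit_scalar: "b \<in> base S \<Longrightarrow> counit S b \<in> tensors S 0"
    and coassoc: "b \<in> base S \<Longrightarrow> cop S 2 1 (comult S b) = cop S 2 2 (comult S b)"
    and counit_left: "b \<in> base S \<Longrightarrow> cou S 2 1 (comult S b) = b"
    and counit_right: "b \<in> base S \<Longrightarrow> cou S 2 2 (comult S b) = b"
    and extend: "\<lbrakk>structure_map S m N f; structure_map S m N g; u \<in> carrier (tpow S N);
            \<And>x. x \<in> tensors S m \<Longrightarrow> f x \<otimes>\<^bsub>tpow S N\<^esub> u = u \<otimes>\<^bsub>tpow S N\<^esub> g x;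
            y \<in> carrier (tpow S m)\<rbrakk> \<Longrightarrow>
          f y \<otimes>\<^bsub>tpow S N\<^esub> u = u \<otimes>\<^bsub>tpow S N\<^esub> g y"


section \<open>R-matrices and Drinfeld twists\<close>

definition R_matrix :: "('k, 'a) tensor_system \<Rightarrow> 'a \<Rightarrow> bool" where
  "R_matrix S R \<longleftrightarrow>
     R \<in> Units (tpow S 2) \<and>
     (\<forall>b \<in> base S. leg S 2 [2, 1] (comult S b) =
        R \<otimes>\<^bsub>tpow S 2\<^esub> comult S b \<otimes>\<^bsub>tpow S 2\<^esub> inv\<^bsub>tpow S 2\<^esub> R) \<and>
     cop S 2 1 R = leg S 3 [1, 3] R \<otimes>\<^bsub>tpow S 3\<^esub> leg S 3 [2, 3] R \<and>
     cop S 2 2 R = leg S 3 [1, 3] R \<otimes>\<^bsub>tpow S 3\<^esub> leg S 3 [1, 2] R"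

text \<open>
  Replacing the comultiplication \<open>\<Delta>\<close> by its conjugate \<open>J\<^sup>-\<^sup>1 \<Delta> J\<close>. Applied to the \<open>i\<close>-th of \<open>N\<close>
  factors this is the conjugate of \<open>cop S N i\<close> by \<open>J\<close> in the positions \<open>i, i + 1\<close>.
\<close>

definition twist :: "('k, 'a) tensor_system \<Rightarrow> 'a \<Rightarrow> ('k, 'a) tensor_system" where
  "twist S J = S\<lparr>cop := \<lambda>N i x.
     inv\<^bsub>tpow S (N + 1)\<^esub> (leg S (N + 1) [i, i + 1] J) \<otimes>\<^bsub>tpow S (N + 1)\<^esub>
     cop S N i x \<otimes>\<^bsub>tpow S (N + 1)\<^esub> leg S (N + 1) [i, i + 1] J\<rparr>"

definition drinfeld_twist :: "('k, 'a) tensor_system \<Rightarrow> 'a \<Rightarrow> bool" where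
  "drinfeld_twist S J \<longleftrightarrow>
     J \<in> Units (tpow S 2) \<and>
     topological_bialgebra (twist S J) \<and>
     cop S 2 1 J \<otimes>\<^bsub>tpow S 3\<^esub> leg S 3 [1, 2] J = cop S 2 2 J \<otimes>\<^bsub>tpow S 3\<^esub> leg S 3 [2, 3] J"


section \<open>The standard bialgebra structure on a tensor power\<close>

text \<open>
  The algebra is \<open>tensors S n\<close>, with \<open>m\<close>-th completed tensor power \<open>tpow S (n * m)\<close>; its \<open>i\<close>-th
  factor consists of the positions in \<open>block n i\<close>.

  The comultiplication of the \<open>i\<close>-th of \<open>M\<close> factors comultiplies the \<open>n\<close> positions of its block,
  from right to left so that the positions still to be treated do not move, and then takes
  \<open>h\<^sup>1\<^sub>(\<^sub>1\<^sub>) \<otimes> h\<^sup>1\<^sub>(\<^sub>2\<^sub>) \<otimes> \<dots> \<otimes> h\<^sup>n\<^sub>(\<^sub>1\<^sub>) \<otimes> h\<^sup>n\<^sub>(\<^sub>2\<^sub>)\<close> to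
  \<open>h\<^sup>1\<^sub>(\<^sub>1\<^sub>) \<otimes> \<dots> \<otimes> h\<^sup>n\<^sub>(\<^sub>1\<^sub>) \<otimes> h\<^sup>1\<^sub>(\<^sub>2\<^sub>) \<otimes> \<dots> \<otimes> h\<^sup>n\<^sub>(\<^sub>2\<^sub>)\<close>.
\<close>

definition block :: "nat \<Rightarrow> nat \<Rightarrow> nat list" where
  "block n i = [(i - 1) * n + 1..<i * n + 1]"

definition tensor_power :: "nat \<Rightarrow> ('k, 'a) tensor_system \<Rightarrow> ('k, 'a) tensor_system" where
  "tensor_power n S =
     \<lparr>scalars = scalars S,
      base = tensors S n,
      tpow = (\<lambda>m. tpow S (n * m)),
      leg = (\<lambda>N ps. leg S (n * N) (concat (map (block n) ps))),
      cop = (\<lambda>M i x.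
        leg S (n * (M + 1))
          ([1..<(i - 1) * n + 1]
             @ concat (map (\<lambda>s. [(i - 1) * n + s, i * n + s]) [1..<n + 1])
             @ [(i + 1) * n + 1..<(M + 1) * n + 1])
          (fold (\<lambda>s y. cop S (n * M + (n - s)) ((i - 1) * n + s) y) (rev [1..<n + 1]) x)),
      cou = (\<lambda>M i x.
        fold (\<lambda>s y. cou S (n * M - (n - s)) ((i - 1) * n + s) y) (rev [1..<n + 1]) x)\<rparr>"


section \<open>The elements attached to a permutation\<close>

definition R_sign :: "('k, 'a) tensor_system \<Rightarrow> 'a \<Rightarrow> int \<Rightarrow> 'a" where
  "R_sign S R e = (if e = 1 then R else inv\<^bsub>tpow S 2\<^esub> (leg S 2 [2, 1] R))"

definition J_elem :: "('k, 'a) tensor_system \<Rightarrow> 'a \<Rightarrow> nat \<Rightarrow> (nat \<Rightarrow> nat) \<Rightarrow> 'a" where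
  "J_elem S R n w =
     list_prod (tpow S (2 * n))
       [leg S (2 * n) [j, n + i] (R_sign S R (sgn (int (w j) - int (w i)))).
          j \<leftarrow> [2..<n + 1], i \<leftarrow> rev [1..<j]]"

definition R_diag :: "('k, 'a) tensor_system \<Rightarrow> 'a \<Rightarrow> nat \<Rightarrow> (nat \<Rightarrow> int) \<Rightarrow> 'a" where
  "R_diag S R n d =
     list_prod (tpow S (2 * n)) [leg S (2 * n) [i, n + i] (R_sign S R (d i)). i \<leftarrow> [1..<n + 1]]"

definition op_flip :: "('k, 'a) tensor_system \<Rightarrow> nat \<Rightarrow> 'a \<Rightarrow> 'a" where
  "op_flip S n x = leg S (2 * n) ([n + 1..<2 * n + 1] @ [1..<n + 1]) x"

end

theory Submission
  imports Defs
begin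

text \<open>
  The elements with a single nontrivial factor generate the tensor powers, so by \<open>extend\<close> an equation
  between structure maps, also one of the form \<open>f(x) u = u g(x)\<close>, follows from its validity on these
  elements. This gives the bialgebra structure of \<open>H\<^sup>\<otimes>\<^sup>n\<close> and shows that \<open>Q\<^sub>1\<^sub>2 P\<^sub>1\<^sub>3 P\<^sub>2\<^sub>3 = P\<^sub>2\<^sub>3 P\<^sub>1\<^sub>3 Q\<^sub>1\<^sub>2\<close>
  and \<open>Q\<^sub>2\<^sub>3 P\<^sub>1\<^sub>3 P\<^sub>1\<^sub>2 = P\<^sub>1\<^sub>2 P\<^sub>1\<^sub>3 Q\<^sub>2\<^sub>3\<close> for any two R-matrices \<open>P\<close>, \<open>Q\<close>; both \<open>R\<close> and \<open>R\<^sub>2\<^sub>1\<^sup>-\<^sup>1\<close> are R-matrices.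

  Write \<open>a\<^sub>j\<close>, \<open>b\<^sub>j\<close>, \<open>c\<^sub>j\<close> for the positions of three copies of \<open>H\<^sup>\<otimes>\<^sup>n\<close>. By the comultiplication rules of
  R-matrices, the two sides of the cocycle equation for \<open>J\<^sub>w\<close> are products over \<open>i < j\<close> of the same factors
  in the positions \<open>(a\<^sub>j, b\<^sub>i)\<close>, \<open>(a\<^sub>j, c\<^sub>i)\<close>, \<open>(b\<^sub>j, c\<^sub>i)\<close>. They are rearranged into each other, row by row,
  by the Yang--Baxter equations in the positions \<open>a\<^sub>j, b\<^sub>k, c\<^sub>i\<close> with \<open>i < k < j\<close>. The product of the
  \<open>R\<^sub>i\<^sub>,\<^sub>n\<^sub>+\<^sub>i\<close> (with any signs) is an R-matrix of \<open>H\<^sup>\<otimes>\<^sup>n\<close>, and conjugating an R-matrix \<open>R\<close> by a twist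
  \<open>J\<close> to \<open>J\<^sub>2\<^sub>1\<^sup>-\<^sup>1 R J\<close> gives an R-matrix of the twisted bialgebra.
\<close>

text \<open>The completed powers come without a universal property, and \<open>R\<close> is an
  arbitrary element of one of them, so the only passage from generators to all elements is
  \<open>extend\<close>. Hence even the compatibility of \<open>cop\<close> and \<open>cou\<close>
  with \<open>leg\<close> has to be proved as an identity of structure maps, and every system in the
  argument must itself be shown to satisfy \<open>extend\<close> and \<open>tensors_free\<close>.
  For the tensor power this works because each of its structure maps is also a structure map of
  \<open>S\<close>. For a twist, each structure map is one of \<open>S\<close> followed by
  conjugation by a unit, and the general intertwiner \<open>u\<close> in \<open>extend\<close>
  absorbs these units.

  A twist must also keep the old counit. The counit axioms for the conjugated comultiplication are
  obtained from the normalisation of the twist: both counits send it to 1, because they do so for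
  every R-matrix, by the comultiplication rules and invertibility.\<close>

text \<open>Positions are numerals, so \<open>1\<close> rather than \<open>Suc 0\<close> is the normal form here.\<close>

declare One_nat_def [simp del] One_nat_def [symmetric, simp] upt_Suc [simp del]
  add_2_eq_Suc [simp del] add_2_eq_Suc' [simp del]

lemma atLeastLessThan_plus_one [simp]: "{a..<m + 1} = {a..m::nat}"
  by auto


section \<open>Algebra homomorphisms and products of lists\<close>

lemma alg_homD:
  assumes "f \<in> alg_hom K A B"
  shows alg_hom_closed: "x \<in> carrier A \<Longrightarrow> f x \<in> carrier B"
    and alg_hom_add: "x \<in> carrier A \<Longrightarrow> y \<in> carrier A \<Longrightarrow> f (x \<oplus>\<^bsub>A\<^esub> y) = f x \<oplus>\<^bsub>B\<^esub> f y"
    and alg_hom_mult: "x \<in> carrier A \<Longrightarrow> y \<in> carrier A \<Longrightarrow> f (x \<otimes>\<^bsub>A\<^esub> y) = f x \<otimes>\<^bsub>B\<^esub> f y"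
    and alg_hom_one: "f \<one>\<^bsub>A\<^esub> = \<one>\<^bsub>B\<^esub>"
    and alg_hom_smult: "a \<in> carrier K \<Longrightarrow> x \<in> carrier A \<Longrightarrow> f (a \<odot>\<^bsub>A\<^esub> x) = a \<odot>\<^bsub>B\<^esub> f x"
  using assms unfolding alg_hom_def
  by (auto simp: ring_hom_closed ring_hom_add ring_hom_mult ring_hom_one)

lemma alg_homI:
  assumes "\<And>x. x \<in> carrier A \<Longrightarrow> f x \<in> carrier B"
    and "\<And>x y. x \<in> carrier A \<Longrightarrow> y \<in> carrier A \<Longrightarrow> f (x \<oplus>\<^bsub>A\<^esub> y) = f x \<oplus>\<^bsub>B\<^esub> f y"
    and "\<And>x y. x \<in> carrier A \<Longrightarrow> y \<in> carrier A \<Longrightarrow> f (x \<otimes>\<^bsub>A\<^esub> y) = f x \<otimes>\<^bsub>B\<^esub> f y"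
    and "f \<one>\<^bsub>A\<^esub> = \<one>\<^bsub>B\<^esub>"
    and "\<And>a x. a \<in> carrier K \<Longrightarrow> x \<in> carrier A \<Longrightarrow> f (a \<odot>\<^bsub>A\<^esub> x) = a \<odot>\<^bsub>B\<^esub> f x"
  shows "f \<in> alg_hom K A B"
  using assms unfolding alg_hom_def ring_hom_def by auto

lemma alg_hom_id: "(\<lambda>x. x) \<in> alg_hom K A A"
  by (rule alg_homI) auto

lemma alg_hom_comp:
  assumes "f \<in> alg_hom K A B" "g \<in> alg_hom K B C"
  shows "(\<lambda>x. g (f x)) \<in> alg_hom K A C"
  by (rule alg_homI) (simp_all add: alg_homD[OF assms(1)] alg_homD[OF assms(2)])

lemma alg_hom_Units:
  assumes "f \<in> alg_hom K A B" "x \<in> Units A"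
  shows "f x \<in> Units B"
proof -
  obtain y where y: "y \<in> carrier A" "y \<otimes>\<^bsub>A\<^esub> x = \<one>\<^bsub>A\<^esub>" "x \<otimes>\<^bsub>A\<^esub> y = \<one>\<^bsub>A\<^esub>" and x: "x \<in> carrier A"
    using assms(2) unfolding Units_def by blast
  have "f y \<otimes>\<^bsub>B\<^esub> f x = \<one>\<^bsub>B\<^esub>" "f x \<otimes>\<^bsub>B\<^esub> f y = \<one>\<^bsub>B\<^esub>"
    using x y alg_hom_mult[OF assms(1)] alg_hom_one[OF assms(1)] by metis+
  then show ?thesis
    using x y alg_hom_closed[OF assms(1)] unfolding Units_def by blast
qed

lemma alg_hom_inv:
  assumes "f \<in> alg_hom K A B" "x \<in> Units A" "monoid A" "monoid B"
  shows "f (inv\<^bsub>A\<^esub> x) = inv\<^bsub>B\<^esub> (f x)"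
proof -
  interpret A: monoid A by fact
  interpret B: monoid B by fact
  have "f (inv\<^bsub>A\<^esub> x) \<otimes>\<^bsub>B\<^esub> f x = \<one>\<^bsub>B\<^esub>" "f x \<otimes>\<^bsub>B\<^esub> f (inv\<^bsub>A\<^esub> x) = \<one>\<^bsub>B\<^esub>"
    using assms(2) alg_hom_mult[OF assms(1)] alg_hom_one[OF assms(1)]
    by (metis A.Units_closed A.Units_inv_closed A.Units_l_inv A.Units_r_inv)+
  then show ?thesis
    using assms(2) alg_hom_closed[OF assms(1)] by (metis A.Units_closed A.Units_inv_closed B.inv_char)
qed

lemma list_prod_Nil [simp]: "list_prod A [] = \<one>\<^bsub>A\<^esub>"
  and list_prod_Cons [simp]: "list_prod A (x # xs) = x \<otimes>\<^bsub>A\<^esub> list_prod A xs"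
  by (simp_all add: list_prod_def)

context monoid
begin

lemma list_prod_closed: "set xs \<subseteq> carrier G \<Longrightarrow> list_prod G xs \<in> carrier G"
  by (induction xs) auto

lemma list_prod_append:
  "set xs \<subseteq> carrier G \<Longrightarrow> set ys \<subseteq> carrier G \<Longrightarrow>
   list_prod G (xs @ ys) = list_prod G xs \<otimes> list_prod G ys"
  by (induction xs) (auto simp: m_assoc list_prod_closed)

lemma list_prod_commute:
  assumes "c \<in> carrier G" "set xs \<subseteq> carrier G" "\<And>x. x \<in> set xs \<Longrightarrow> c \<otimes> x = x \<otimes> c"
  shows "c \<otimes> list_prod G xs = list_prod G xs \<otimes> c"
  using assms(2,3)
proof (induction xs)
  case Nil
  then show ?case using assms(1) by simp
next
  case (Cons x xs)
  have cl: "x \<in> carrier G" "list_prod G xs \<in> carrier G"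
    using Cons.prems(1) by (auto simp: list_prod_closed)
  have "c \<otimes> (x \<otimes> list_prod G xs) = (c \<otimes> x) \<otimes> list_prod G xs"
    using cl assms(1) by (simp add: m_assoc)
  also have "\<dots> = x \<otimes> (c \<otimes> list_prod G xs)"
    using cl assms(1) Cons.prems(2)[of x] by (simp add: m_assoc)
  also have "c \<otimes> list_prod G xs = list_prod G xs \<otimes> c"
    using Cons by auto
  finally show ?case using cl assms(1) by (simp add: m_assoc)
qed

end

lemma alg_hom_list_prod:
  assumes "f \<in> alg_hom K A B" "monoid A" "set xs \<subseteq> carrier A"
  shows "f (list_prod A xs) = list_prod B (map f xs)"
  using assms(3)
proof (induction xs)
  case Nil
  then show ?case using alg_hom_one[OF assms(1)] by simp
next
  case (Cons x xs)
  then show ?case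
    using alg_hom_mult[OF assms(1)] monoid.list_prod_closed[OF assms(2)] by auto
qed


section \<open>Tensors\<close>

text \<open>The part of \<open>completed_tensor_powers\<close> that can be verified for
  \<open>tensor_power n S\<close> at once. Freeness of its tensors is proved later, and that proof
  already needs multilinearity of pure tensors and the induction over tensors for the new
  system.\<close>

locale leg_system =
  fixes S :: "('k, 'a) tensor_system"
  assumes field: "field (scalars S)"
    and algebras: "assoc_algebra (scalars S) (tpow S m)"
    and base: "unital_subalgebra (scalars S) (base S) (tpow S 1)"
    and leg_hom: "positions N ps \<Longrightarrow>
          leg S N ps \<in> alg_hom (scalars S) (tpow S (length ps)) (tpow S N)"
    and leg_id: "x \<in> carrier (tpow S N) \<Longrightarrow> leg S N [1..<N + 1] x = x"
    and leg_leg: "\<lbrakk>positions N ps; positions M qs; length qs = N;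
            x \<in> carrier (tpow S (length ps))\<rbrakk> \<Longrightarrow>
          leg S M qs (leg S N ps x) = leg S M (map (\<lambda>p. qs ! (p - 1)) ps) x"
    and leg_commute: "\<lbrakk>positions N (ps @ qs);
            x \<in> carrier (tpow S (length ps)); y \<in> carrier (tpow S (length qs))\<rbrakk> \<Longrightarrow>
          leg S N ps x \<otimes>\<^bsub>tpow S N\<^esub> leg S N qs y = leg S N qs y \<otimes>\<^bsub>tpow S N\<^esub> leg S N ps x"
begin

sublocale A: assoc_algebra "scalars S" "tpow S N" for N
  by (rule algebras)

sublocale K: field "scalars S"
  by (rule field)

text \<open>The degree is a variable \<open>k\<close> with \<open>length ps = k\<close>, so that the
  rules also match when it is written as a numeral or as a product such as
  \<open>n * 2\<close>.\<close>

lemma leg_closed [simp]: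
    "\<lbrakk>positions N ps; length ps = k; x \<in> carrier (tpow S k)\<rbrakk> \<Longrightarrow> leg S N ps x \<in> carrier (tpow S N)"
  and leg_add: "\<lbrakk>positions N ps; length ps = k; x \<in> carrier (tpow S k); y \<in> carrier (tpow S k)\<rbrakk> \<Longrightarrow>
    leg S N ps (x \<oplus>\<^bsub>tpow S k\<^esub> y) = leg S N ps x \<oplus>\<^bsub>tpow S N\<^esub> leg S N ps y"
  and leg_mult: "\<lbrakk>positions N ps; length ps = k; x \<in> carrier (tpow S k); y \<in> carrier (tpow S k)\<rbrakk> \<Longrightarrow>
    leg S N ps (x \<otimes>\<^bsub>tpow S k\<^esub> y) = leg S N ps x \<otimes>\<^bsub>tpow S N\<^esub> leg S N ps y"
  and leg_one: "\<lbrakk>positions N ps; length ps = k\<rbrakk> \<Longrightarrow> leg S N ps \<one>\<^bsub>tpow S k\<^esub> = \<one>\<^bsub>tpow S N\<^esub>"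
  and leg_smult: "\<lbrakk>positions N ps; length ps = k; a \<in> carrier (scalars S); x \<in> carrier (tpow S k)\<rbrakk> \<Longrightarrow>
    leg S N ps (a \<odot>\<^bsub>tpow S k\<^esub> x) = a \<odot>\<^bsub>tpow S N\<^esub> leg S N ps x"
  and leg_Units: "\<lbrakk>positions N ps; length ps = k; x \<in> Units (tpow S k)\<rbrakk> \<Longrightarrow>
    leg S N ps x \<in> Units (tpow S N)"
  and leg_inv: "\<lbrakk>positions N ps; length ps = k; x \<in> Units (tpow S k)\<rbrakk> \<Longrightarrow>
    leg S N ps (inv\<^bsub>tpow S k\<^esub> x) = inv\<^bsub>tpow S N\<^esub> leg S N ps x"
  by (auto simp: alg_hom_closed[OF leg_hom] alg_hom_add[OF leg_hom] alg_hom_mult[OF leg_hom]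
      alg_hom_one[OF leg_hom] alg_hom_smult[OF leg_hom] alg_hom_Units[OF leg_hom]
      alg_hom_inv[OF leg_hom _ A.monoid_axioms A.monoid_axioms])

lemma base_carrier: "b \<in> base S \<Longrightarrow> b \<in> carrier (tpow S 1)"
  and base_one: "\<one>\<^bsub>tpow S 1\<^esub> \<in> base S"
  and base_mult: "b \<in> base S \<Longrightarrow> c \<in> base S \<Longrightarrow> b \<otimes>\<^bsub>tpow S 1\<^esub> c \<in> base S"
proof -
  have s: "subring (base S) (tpow S 1)"
    using base by (simp add: unital_subalgebra_def)
  show "b \<in> base S \<Longrightarrow> b \<in> carrier (tpow S 1)"
    using subringE(1)[OF s] by (rule subsetD)
  show "\<one>\<^bsub>tpow S 1\<^esub> \<in> base S"
    by (rule subringE(3)[OF s])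
  show "b \<in> base S \<Longrightarrow> c \<in> base S \<Longrightarrow> b \<otimes>\<^bsub>tpow S 1\<^esub> c \<in> base S"
    by (rule subringE(6)[OF s])
qed

lemma positions_singleton [simp]: "positions N [k] \<longleftrightarrow> 1 \<le> k \<and> k \<le> N"
  by (auto simp: positions_def)

lemma leg_factor_closed [simp]:
  "\<lbrakk>1 \<le> k; k \<le> N; b \<in> carrier (tpow S 1)\<rbrakk> \<Longrightarrow> leg S N [k] b \<in> carrier (tpow S N)"
  "\<lbrakk>1 \<le> k; k \<le> N; b \<in> base S\<rbrakk> \<Longrightarrow> leg S N [k] b \<in> carrier (tpow S N)"
  by (auto intro!: leg_closed base_carrier)

lemma leg_factor_commute:
  "\<lbrakk>1 \<le> k; k \<le> N; 1 \<le> l; l \<le> N; k \<noteq> l; x \<in> carrier (tpow S 1); y \<in> carrier (tpow S 1)\<rbrakk> \<Longrightarrow>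
   leg S N [k] x \<otimes>\<^bsub>tpow S N\<^esub> leg S N [l] y = leg S N [l] y \<otimes>\<^bsub>tpow S N\<^esub> leg S N [k] x"
  using leg_commute[of N "[k]" "[l]" x y] by (simp add: positions_def)

lemma leg_leg_factor:
  "\<lbrakk>1 \<le> k; k \<le> length ps; positions N ps; x \<in> carrier (tpow S 1)\<rbrakk> \<Longrightarrow>
   leg S N ps (leg S (length ps) [k] x) = leg S N [ps ! (k - 1)] x"
  using leg_leg[of "length ps" "[k]" N ps x] by simp

lemma pure_tensor_closed:
  assumes "set hs \<subseteq> carrier (tpow S 1)"
  shows "pure_tensor S hs \<in> carrier (tpow S (length hs))"
  unfolding pure_tensor_def using assms by (intro A.list_prod_closed) (auto simp: subset_iff)

text \<open>Isolates one slot of a pure tensor. The form \<open>p x q\<close> gives linearity in the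
  slot, and the commutation with \<open>p\<close>, which has factors in earlier positions only, lets
  a new factor reach the slot from the left.\<close>

lemma pure_tensor_update:
  assumes "set hs \<subseteq> carrier (tpow S 1)" "length hs = m" "k < m"
  obtains p q where "p \<in> carrier (tpow S m)" "q \<in> carrier (tpow S m)"
    "\<And>x. x \<in> carrier (tpow S 1) \<Longrightarrow>
       pure_tensor S (hs[k := x]) = p \<otimes>\<^bsub>tpow S m\<^esub> leg S m [k + 1] x \<otimes>\<^bsub>tpow S m\<^esub> q"
    "\<And>x. x \<in> carrier (tpow S 1) \<Longrightarrow>
       leg S m [k + 1] x \<otimes>\<^bsub>tpow S m\<^esub> p = p \<otimes>\<^bsub>tpow S m\<^esub> leg S m [k + 1] x"
proof -
  let ?l = "\<lambda>j. leg S m [j] (hs ! (j - 1))"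
  let ?p = "list_prod (tpow S m) (map ?l [1..<k + 1])"
  let ?q = "list_prod (tpow S m) (map ?l [Suc (k + 1)..<m + 1])"
  have hs: "hs ! j \<in> carrier (tpow S 1)" if "j < m" for j
    using assms that by auto
  have pc: "set (map ?l [1..<k + 1]) \<subseteq> carrier (tpow S m)" and qc: "set (map ?l [Suc (k + 1)..<m + 1]) \<subseteq> carrier (tpow S m)"
    using assms(3) hs by auto
  show thesis
  proof
    show p: "?p \<in> carrier (tpow S m)" and q: "?q \<in> carrier (tpow S m)"
      using pc qc by (simp_all only: A.list_prod_closed)
    fix x assume x: "x \<in> carrier (tpow S 1)"
    have sp: "[1..<m + 1] = [1..<k + 1] @ [k + 1] @ [Suc (k + 1)..<m + 1]"
    proof -
      have e: "m + 1 = k + 1 + (m - k)"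
        using assms(3) by simp
      have "[1..<m + 1] = [1..<k + 1] @ [k + 1..<m + 1]"
        using upt_add_eq_append[of 1 "k + 1" "m - k"] assms(3) unfolding e by simp
      moreover have "[k + 1..<m + 1] = [k + 1] @ [Suc (k + 1)..<m + 1]"
        using assms(3) by (subst upt_conv_Cons) simp_all
      ultimately show ?thesis by metis
    qed
    let ?l' = "\<lambda>j. leg S m [j] (hs[k := x] ! (j - 1))"
    have e1: "map ?l' [1..<k + 1] = map ?l [1..<k + 1]" and e2: "map ?l' [Suc (k + 1)..<m + 1] = map ?l [Suc (k + 1)..<m + 1]"
      using assms by (auto simp: nth_list_update)
    have e3: "?l' (k + 1) = leg S m [k + 1] x" using assms by simp
    have "pure_tensor S (hs[k := x]) = list_prod (tpow S m) (map ?l' [1..<m + 1])"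
      using assms(2) by (simp add: pure_tensor_def)
    also have "map ?l' [1..<m + 1] = map ?l [1..<k + 1] @ [leg S m [k + 1] x] @ map ?l [Suc (k + 1)..<m + 1]"
      unfolding sp map_append e1 e2 using e3 by simp
    also have "list_prod (tpow S m) \<dots> = ?p \<otimes>\<^bsub>tpow S m\<^esub> (leg S m [k + 1] x \<otimes>\<^bsub>tpow S m\<^esub> ?q)"
      using pc qc x assms(3) by (subst A.list_prod_append) auto
    also have "\<dots> = ?p \<otimes>\<^bsub>tpow S m\<^esub> leg S m [k + 1] x \<otimes>\<^bsub>tpow S m\<^esub> ?q"
      using p q x assms(3) by (intro A.m_assoc[symmetric]) auto
    finally show "pure_tensor S (hs[k := x]) = ?p \<otimes>\<^bsub>tpow S m\<^esub> leg S m [k + 1] x \<otimes>\<^bsub>tpow S m\<^esub> ?q" .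
    show "leg S m [k + 1] x \<otimes>\<^bsub>tpow S m\<^esub> ?p = ?p \<otimes>\<^bsub>tpow S m\<^esub> leg S m [k + 1] x"
    proof (rule A.list_prod_commute)
      fix y assume "y \<in> set (map ?l [1..<k + 1])"
      then obtain j where j: "y = ?l j" "1 \<le> j" "j \<le> k" by auto
      show "leg S m [k + 1] x \<otimes>\<^bsub>tpow S m\<^esub> y = y \<otimes>\<^bsub>tpow S m\<^esub> leg S m [k + 1] x"
        unfolding j(1) using j assms(3) x hs by (intro leg_factor_commute) auto
    qed (use x assms(3) pc in auto)
  qed
qed

lemma pure_tensor_one: "pure_tensor S (replicate m \<one>\<^bsub>tpow S 1\<^esub>) = \<one>\<^bsub>tpow S m\<^esub>"
proof -
  have "list_prod (tpow S m) (map (\<lambda>j. leg S m [j] (replicate m \<one>\<^bsub>tpow S 1\<^esub> ! (j - 1))) js) = \<one>\<^bsub>tpow S m\<^esub>"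
    if "set js \<subseteq> {1..m}" for js
    using that by (induction js) (auto simp: leg_one)
  from this[of "[1..<m + 1]"] show ?thesis by (auto simp: pure_tensor_def)
qed

lemma tensors_closed: "x \<in> tensors S m \<Longrightarrow> x \<in> carrier (tpow S m)"
  by (induction rule: tensors.induct) (auto intro: pure_tensor_closed base_carrier)

lemma one_in_tensors: "\<one>\<^bsub>tpow S m\<^esub> \<in> tensors S m"
  using tensors.pure[of "replicate m \<one>\<^bsub>tpow S 1\<^esub>" m S] base_one by (simp add: pure_tensor_one set_replicate_conv_if)

text \<open>The new factor passes all earlier positions and is multiplied into the
  \<open>k\<close>-th entry, so a pure tensor stays pure; sums and scalar multiples follow by
  distributivity.\<close>

lemma leg_factor_mult_tensors:
  assumes "y \<in> tensors S m" "1 \<le> k" "k \<le> m" "b \<in> base S"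
  shows "leg S m [k] b \<otimes>\<^bsub>tpow S m\<^esub> y \<in> tensors S m"
  using assms(1)
proof (induction rule: tensors.induct)
  case (pure hs)
  define i where "i = k - 1"
  have i: "i < m" "k = i + 1" using assms by (auto simp: i_def)
  have hs: "set hs \<subseteq> carrier (tpow S 1)" "hs ! i \<in> base S"
    using pure base_carrier i by auto
  obtain p q where pq: "p \<in> carrier (tpow S m)" "q \<in> carrier (tpow S m)"
    "\<And>x. x \<in> carrier (tpow S 1) \<Longrightarrow>
       pure_tensor S (hs[i := x]) = p \<otimes>\<^bsub>tpow S m\<^esub> leg S m [i + 1] x \<otimes>\<^bsub>tpow S m\<^esub> q"
    "\<And>x. x \<in> carrier (tpow S 1) \<Longrightarrow>
       leg S m [i + 1] x \<otimes>\<^bsub>tpow S m\<^esub> p = p \<otimes>\<^bsub>tpow S m\<^esub> leg S m [i + 1] x"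
    by (rule pure_tensor_update[OF hs(1) pure(1) i(1)]) (rule that)
  let ?h = "hs ! i"
  have c: "b \<in> carrier (tpow S 1)" "?h \<in> carrier (tpow S 1)"
    using assms(4) hs(2) base_carrier by auto
  have l: "leg S m [k] b \<in> carrier (tpow S m)" "leg S m [k] ?h \<in> carrier (tpow S m)"
    using assms c by auto
  have "leg S m [k] b \<otimes>\<^bsub>tpow S m\<^esub> pure_tensor S hs
      = leg S m [k] b \<otimes>\<^bsub>tpow S m\<^esub> (p \<otimes>\<^bsub>tpow S m\<^esub> leg S m [k] ?h \<otimes>\<^bsub>tpow S m\<^esub> q)"
    using pq(3)[OF c(2)] i by simp
  also have "\<dots> = (leg S m [k] b \<otimes>\<^bsub>tpow S m\<^esub> p) \<otimes>\<^bsub>tpow S m\<^esub> leg S m [k] ?h \<otimes>\<^bsub>tpow S m\<^esub> q"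
    using l pq(1,2) by (simp add: A.m_assoc)
  also have "\<dots> = p \<otimes>\<^bsub>tpow S m\<^esub> (leg S m [k] b \<otimes>\<^bsub>tpow S m\<^esub> leg S m [k] ?h) \<otimes>\<^bsub>tpow S m\<^esub> q"
    using l pq(1,2) pq(4)[OF c(1)] i(2) by (simp add: A.m_assoc)
  also have "\<dots> = pure_tensor S (hs[i := b \<otimes>\<^bsub>tpow S 1\<^esub> ?h])"
    using pq(3)[of "b \<otimes>\<^bsub>tpow S 1\<^esub> ?h"] c i assms by (simp add: leg_mult)
  also have "\<dots> \<in> tensors S m"
    using pure base_mult[OF assms(4) hs(2)] set_update_subset_insert[of hs i "b \<otimes>\<^bsub>tpow S 1\<^esub> ?h"]
    by (intro tensors.pure) auto
  finally show ?case .
next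
  case (add x y)
  then show ?case
    using assms by (subst A.r_distr) (auto intro: tensors_closed tensors.add)
next
  case (smult a x)
  then show ?case
    using assms by (subst A.smult_mult_right) (auto intro: tensors_closed tensors.smult)
qed

lemma leg_factor_in_tensors:
  "\<lbrakk>1 \<le> k; k \<le> m; b \<in> base S\<rbrakk> \<Longrightarrow> leg S m [k] b \<in> tensors S m"
  using leg_factor_mult_tensors[OF one_in_tensors] by simp

lemma tensors_mult:
  assumes "x \<in> tensors S m" "y \<in> tensors S m"
  shows "x \<otimes>\<^bsub>tpow S m\<^esub> y \<in> tensors S m"
  using assms(1)
proof (induction rule: tensors.induct)
  case (pure hs)
  \<comment> \<open>Generalised from all positions to an arbitrary list \<open>js\<close>, so that
    the induction can peel off one factor at a time.\<close>
  have "list_prod (tpow S m) (map (\<lambda>j. leg S m [j] (hs ! (j - 1))) js) \<otimes>\<^bsub>tpow S m\<^esub> y \<in> tensors S m"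
    if "set js \<subseteq> {1..m}" for js
    using that
  proof (induction js)
    case Nil
    then show ?case using assms(2) tensors_closed by simp
  next
    case (Cons j js)
    have j: "1 \<le> j" "j \<le> m" and h: "hs ! (j - 1) \<in> base S"
      using Cons.prems pure by auto
    have js: "set (map (\<lambda>j. leg S m [j] (hs ! (j - 1))) js) \<subseteq> carrier (tpow S m)"
    proof
      fix z assume "z \<in> set (map (\<lambda>j. leg S m [j] (hs ! (j - 1))) js)"
      then obtain i where i: "z = leg S m [i] (hs ! (i - 1))" "1 \<le> i" "i \<le> m"
        using Cons.prems by auto
      have "hs ! (i - 1) \<in> base S" using pure i by auto
      then show "z \<in> carrier (tpow S m)" using i by simp
    qed
    show ?case
      using Cons.IH Cons.prems leg_factor_mult_tensors[OF _ j h] A.list_prod_closed[OF js] j h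
        tensors_closed[OF assms(2)]
      by (simp add: A.m_assoc)
  qed
  from this[of "[1..<m + 1]"] show ?case using pure by (auto simp: pure_tensor_def)
next
  case (add x x')
  then show ?case
    using assms(2) by (subst A.l_distr) (auto intro: tensors_closed tensors.add)
next
  case (smult a x)
  then show ?case
    using assms(2) by (subst A.smult_mult_left) (auto intro: tensors_closed tensors.smult)
qed

lemma unital_subalgebra_tensors: "unital_subalgebra (scalars S) (tensors S m) (tpow S m)"
  unfolding unital_subalgebra_def
proof (intro conjI ballI)
  show "subring (tensors S m) (tpow S m)"
  proof (rule A.subringI)
    fix x assume x: "x \<in> tensors S m"
    \<comment> \<open>The rules for \<open>tensors\<close> contain no negation; it is scalar
      multiplication by minus one.\<close>
    have "\<ominus>\<^bsub>tpow S m\<^esub> x = (\<ominus>\<^bsub>scalars S\<^esub> \<one>\<^bsub>scalars S\<^esub>) \<odot>\<^bsub>tpow S m\<^esub> x"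
      using A.smult_l_minus[of "\<one>\<^bsub>scalars S\<^esub>" x m] tensors_closed[OF x] by simp
    then show "\<ominus>\<^bsub>tpow S m\<^esub> x \<in> tensors S m"
      using x by (simp add: tensors.smult)
  qed (auto intro: tensors_closed one_in_tensors tensors_mult tensors.add)
qed (auto intro: tensors.smult)

text \<open>The induction over \<open>tensors\<close> with pure tensors split into their factors.
  Membership in \<open>tensors\<close> is kept among the hypotheses, since homomorphism rules apply
  only inside the carrier.\<close>

lemma tensors_factor_induct [consumes 1, case_names one factor mult add smult]:
  assumes "x \<in> tensors S m"
    and one: "P \<one>\<^bsub>tpow S m\<^esub>"
    and factor: "\<And>k b. \<lbrakk>1 \<le> k; k \<le> m; b \<in> base S\<rbrakk> \<Longrightarrow> P (leg S m [k] b)"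
    and mult: "\<And>x y. \<lbrakk>x \<in> tensors S m; y \<in> tensors S m; P x; P y\<rbrakk> \<Longrightarrow> P (x \<otimes>\<^bsub>tpow S m\<^esub> y)"
    and add: "\<And>x y. \<lbrakk>x \<in> tensors S m; y \<in> tensors S m; P x; P y\<rbrakk> \<Longrightarrow> P (x \<oplus>\<^bsub>tpow S m\<^esub> y)"
    and smult: "\<And>a x. \<lbrakk>a \<in> carrier (scalars S); x \<in> tensors S m; P x\<rbrakk> \<Longrightarrow> P (a \<odot>\<^bsub>tpow S m\<^esub> x)"
  shows "P x"
  using assms(1)
proof (induction rule: tensors.induct)
  case (pure hs)
  have "P (list_prod (tpow S m) (map (\<lambda>j. leg S m [j] (hs ! (j - 1))) js)) \<and>
      list_prod (tpow S m) (map (\<lambda>j. leg S m [j] (hs ! (j - 1))) js) \<in> tensors S m"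
    if "set js \<subseteq> {1..m}" for js
    using that
  proof (induction js)
    case Nil
    then show ?case by (simp add: one one_in_tensors)
  next
    case (Cons j js)
    have "1 \<le> j" "j \<le> m" "hs ! (j - 1) \<in> base S"
      using Cons.prems pure by auto
    then show ?case
      using Cons by (auto intro!: mult factor tensors_mult leg_factor_in_tensors)
  qed
  from this[of "[1..<m + 1]"] show ?case using pure by (auto simp: pure_tensor_def)
qed (auto intro: add smult)

lemma alg_hom_tensors:
  assumes f: "f \<in> alg_hom (scalars S) (tpow S m) (tpow S N)" and "x \<in> tensors S m"
    and "\<And>k b. \<lbrakk>1 \<le> k; k \<le> m; b \<in> base S\<rbrakk> \<Longrightarrow> f (leg S m [k] b) \<in> tensors S N"
  shows "f x \<in> tensors S N"
  using assms(2)
  by (induction rule: tensors_factor_induct)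
    (auto simp: alg_homD[OF f] tensors_closed
      intro: assms(3) one_in_tensors tensors_mult tensors.add tensors.smult)

lemma leg_tensors:
  assumes "positions N ps" "x \<in> tensors S (length ps)"
  shows "leg S N ps x \<in> tensors S N"
proof (rule alg_hom_tensors[OF leg_hom[OF assms(1)] assms(2)])
  fix k b assume k: "1 \<le> k" "k \<le> length ps" "b \<in> base S"
  then have "ps ! (k - 1) \<in> set ps" by simp
  then have "1 \<le> ps ! (k - 1)" "ps ! (k - 1) \<le> N" using assms(1) by (auto simp: positions_def)
  then show "leg S N ps (leg S (length ps) [k] b) \<in> tensors S N"
    using k assms(1) leg_factor_in_tensors by (simp add: leg_leg_factor base_carrier)
qed

text \<open>The elements that satisfy the relation form a subalgebra: in a product, \<open>u\<close>
  is carried past one factor after the other. Nothing is cancelled, so \<open>u\<close> may be any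
  element.\<close>

lemma intertwine_on_tensors:
  assumes f: "f \<in> alg_hom (scalars S) (tpow S m) (tpow S N)"
    and g: "g \<in> alg_hom (scalars S) (tpow S m) (tpow S N)"
    and u: "u \<in> carrier (tpow S N)"
    and fac: "\<And>k b. \<lbrakk>1 \<le> k; k \<le> m; b \<in> base S\<rbrakk> \<Longrightarrow>
      f (leg S m [k] b) \<otimes>\<^bsub>tpow S N\<^esub> u = u \<otimes>\<^bsub>tpow S N\<^esub> g (leg S m [k] b)"
    and "x \<in> tensors S m"
  shows "f x \<otimes>\<^bsub>tpow S N\<^esub> u = u \<otimes>\<^bsub>tpow S N\<^esub> g x"
  using assms(5)
proof (induction rule: tensors_factor_induct)
  case one
  then show ?case using u by (simp add: alg_hom_one[OF f] alg_hom_one[OF g])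
next
  case (factor k b)
  then show ?case by (rule fac)
next
  case (mult x y)
  have c: "f x \<in> carrier (tpow S N)" "f y \<in> carrier (tpow S N)"
    "g x \<in> carrier (tpow S N)" "g y \<in> carrier (tpow S N)"
    using mult(1,2) tensors_closed alg_hom_closed[OF f] alg_hom_closed[OF g] by auto
  have "f x \<otimes>\<^bsub>tpow S N\<^esub> f y \<otimes>\<^bsub>tpow S N\<^esub> u = f x \<otimes>\<^bsub>tpow S N\<^esub> u \<otimes>\<^bsub>tpow S N\<^esub> g y"
    using c u mult(4) by (simp add: A.m_assoc)
  also have "\<dots> = u \<otimes>\<^bsub>tpow S N\<^esub> (g x \<otimes>\<^bsub>tpow S N\<^esub> g y)"
    using c u mult(3) by (simp add: A.m_assoc)
  finally show ?case
    using mult(1,2) tensors_closed by (simp add: alg_hom_mult[OF f] alg_hom_mult[OF g])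
next
  case (add x y)
  then show ?case
    using u tensors_closed
    by (simp add: alg_hom_add[OF f] alg_hom_add[OF g] alg_hom_closed[OF f] alg_hom_closed[OF g]
        A.l_distr A.r_distr)
next
  case (smult a x)
  then show ?case
    using u tensors_closed
    by (simp add: alg_hom_smult[OF f] alg_hom_smult[OF g] alg_hom_closed[OF f] alg_hom_closed[OF g]
        A.smult_mult_left A.smult_mult_right)
qed

end

sublocale completed_tensor_powers \<subseteq> leg_system
  by (rule leg_system.intro) (fact field algebras base leg_hom leg_id leg_leg leg_commute)+



section \<open>Structure maps\<close>

lemma nth_Cons_one [simp]: "(x # xs) ! 1 = xs ! 0"
  by (simp only: One_nat_def nth_Cons_Suc)

text \<open>The new number of a position \<open>p \<noteq> i\<close> once position \<open>i\<close>
  has been replaced by the pair \<open>i, i + 1\<close>. It is injective everywhere, whereas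
  \<open>shift_down\<close> identifies \<open>i\<close> with \<open>i - 1\<close>.\<close>

definition shift_up :: "nat \<Rightarrow> nat \<Rightarrow> nat" where
  "shift_up i p = (if p < i then p else p + 1)"

definition shift_down :: "nat \<Rightarrow> nat \<Rightarrow> nat" where
  "shift_down i p = (if p < i then p else p - 1)"

lemma inj_on_shift_up: "inj_on (shift_up i) ps"
  by (auto simp: inj_on_def shift_up_def split: if_splits)

lemma positions_shift_up_split:
  assumes "positions N ps" "r < length ps" "ps ! r = i"
  shows "positions (N + 1) (map (shift_up i) (take r ps) @ [i, i + 1] @ map (shift_up i) (drop (r + 1) ps))"
proof -
  have ps: "ps = take r ps @ [i] @ drop (r + 1) ps"
    using id_take_nth_drop[OF assms(2)] assms(3) by (simp add: Suc_eq_plus1)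
  have d: "distinct (take r ps @ [i] @ drop (r + 1) ps)" and s: "set (take r ps @ [i] @ drop (r + 1) ps) \<subseteq> {1..N}"
    using assms(1) ps by (simp_all only: positions_def)
  show ?thesis
    using d s inj_on_shift_up unfolding positions_def by (auto simp: distinct_map shift_up_def split: if_splits)
qed

lemma positions_shift_up:
  assumes "positions N ps"
  shows "positions (N + 1) (map (shift_up i) ps)"
  using assms inj_on_shift_up unfolding positions_def by (auto simp: distinct_map shift_up_def)

lemma positions_shift_down:
  assumes "positions N ps" "i \<notin> set ps" "1 \<le> i" "i \<le> N"
  shows "positions (N - 1) (map (shift_down i) ps)"
proof -
  have "inj_on (shift_down i) (set ps)"
  proof (rule inj_onI)
    fix p q assume pq: "p \<in> set ps" "q \<in> set ps" "shift_down i p = shift_down i q"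
    then have "1 \<le> p" "1 \<le> q" "p \<noteq> i" "q \<noteq> i" using assms by (auto simp: positions_def)
    then show "p = q" using pq(3) by (auto simp: shift_down_def split: if_splits)
  qed
  moreover have "shift_down i p \<in> {1..N - 1}" if "p \<in> set ps" for p
  proof -
    have "1 \<le> p" "p \<le> N" "p \<noteq> i" using assms that by (auto simp: positions_def)
    then show ?thesis using assms(3,4) by (auto simp: shift_down_def)
  qed
  ultimately show ?thesis
    using assms(1) unfolding positions_def by (auto simp: distinct_map simp del: atLeastAtMost_iff)
qed

context topological_bialgebra
begin

lemma structure_map_hom:
  "structure_map S m N f \<Longrightarrow> f \<in> alg_hom (scalars S) (tpow S m) (tpow S N)"
proof (induction rule: structure_map.induct)
  case ident
  show ?case by (rule alg_hom_id)
next
  case (leg ps f N)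
  show ?case by (rule alg_hom_comp[OF leg(3) leg_hom[OF leg(2)]])
next
  case (cop N f i)
  show ?case by (rule alg_hom_comp[OF cop(4) cop_hom[OF cop(2,3)]])
next
  case (cou N f i)
  show ?case by (rule alg_hom_comp[OF cou(4) cou_hom[OF cou(2,3)]])
qed

lemma structure_map_comp:
  assumes "structure_map S m N f" "structure_map S N P g"
  shows "structure_map S m P (\<lambda>x. g (f x))"
  using assms(2)
  by (induction rule: structure_map.induct) (auto intro: assms(1) structure_map.intros)

lemma structure_map_leg: "positions N ps \<Longrightarrow> length ps = k \<Longrightarrow> structure_map S k N (\<lambda>x. leg S N ps x)"
  using structure_map.leg[OF structure_map.ident] by blast

lemma structure_map_cop: "1 \<le> i \<Longrightarrow> i \<le> N \<Longrightarrow> structure_map S N (N + 1) (\<lambda>x. cop S N i x)"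
  by (rule structure_map.cop[OF structure_map.ident])

lemma structure_map_cou: "1 \<le> i \<Longrightarrow> i \<le> N \<Longrightarrow> structure_map S N (N - 1) (\<lambda>x. cou S N i x)"
  by (rule structure_map.cou[OF structure_map.ident])

text \<open>
  Together with \<open>extend\<close>: an intertwining relation between structure maps need only be checked on the
  elements with a single nontrivial factor.
\<close>

lemma structure_map_intertwine:
  assumes "structure_map S m N f" "structure_map S m N g" "u \<in> carrier (tpow S N)"
    and "\<And>k b. \<lbrakk>1 \<le> k; k \<le> m; b \<in> base S\<rbrakk> \<Longrightarrow>
      f (leg S m [k] b) \<otimes>\<^bsub>tpow S N\<^esub> u = u \<otimes>\<^bsub>tpow S N\<^esub> g (leg S m [k] b)"
    and "x \<in> carrier (tpow S m)"
  shows "f x \<otimes>\<^bsub>tpow S N\<^esub> u = u \<otimes>\<^bsub>tpow S N\<^esub> g x"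
  by (rule extend[OF assms(1-3) _ assms(5)])
    (rule intertwine_on_tensors[OF structure_map_hom[OF assms(1)] structure_map_hom[OF assms(2)] assms(3,4)])

text \<open>Intertwining by the unit element is equality. All compatibilities between structure maps
  on completed tensor powers are obtained in this way.\<close>

lemma structure_map_eqI:
  assumes f: "structure_map S m N f" and g: "structure_map S m N g"
    and eq: "\<And>k b. \<lbrakk>1 \<le> k; k \<le> m; b \<in> base S\<rbrakk> \<Longrightarrow> f (leg S m [k] b) = g (leg S m [k] b)"
    and x: "x \<in> carrier (tpow S m)"
  shows "f x = g x"
proof -
  have c: "f y \<in> carrier (tpow S N)" "g y \<in> carrier (tpow S N)" if "y \<in> carrier (tpow S m)" for y
    using that alg_hom_closed[OF structure_map_hom[OF f]] alg_hom_closed[OF structure_map_hom[OF g]]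
    by auto
  have "f x \<otimes>\<^bsub>tpow S N\<^esub> \<one>\<^bsub>tpow S N\<^esub> = \<one>\<^bsub>tpow S N\<^esub> \<otimes>\<^bsub>tpow S N\<^esub> g x"
  proof (rule structure_map_intertwine[OF f g _ _ x])
    fix k b assume k: "1 \<le> k" "k \<le> m" "b \<in> base S"
    then show "f (leg S m [k] b) \<otimes>\<^bsub>tpow S N\<^esub> \<one>\<^bsub>tpow S N\<^esub> =
        \<one>\<^bsub>tpow S N\<^esub> \<otimes>\<^bsub>tpow S N\<^esub> g (leg S m [k] b)"
      using eq[OF k] c by simp
  qed simp
  then show ?thesis using c[OF x] by simp
qed

lemma comult_closed: "b \<in> carrier (tpow S 1) \<Longrightarrow> comult S b \<in> carrier (tpow S 2)"
  using alg_hom_closed[OF cop_hom[of 1 1]] by simp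

lemma counit_closed: "b \<in> carrier (tpow S 1) \<Longrightarrow> counit S b \<in> carrier (tpow S 0)"
  using alg_hom_closed[OF cou_hom[of 1 1]] by simp

lemma cop_closed: "1 \<le> i \<Longrightarrow> i \<le> N \<Longrightarrow> x \<in> carrier (tpow S N) \<Longrightarrow> cop S N i x \<in> carrier (tpow S (N + 1))"
  by (rule alg_hom_closed[OF cop_hom])

lemma cou_closed: "1 \<le> i \<Longrightarrow> i \<le> N \<Longrightarrow> x \<in> carrier (tpow S N) \<Longrightarrow> cou S N i x \<in> carrier (tpow S (N - 1))"
  by (rule alg_hom_closed[OF cou_hom])

text \<open>The axiom \<open>cop_factor\<close> covers only a single factor from
  \<open>base S\<close>. Here the element is arbitrary in its completed power, and only its legs
  have to avoid \<open>i\<close>.\<close>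

lemma cop_leg_notin:
  assumes ps: "positions N ps" and i: "1 \<le> i" "i \<le> N" "i \<notin> set ps"
    and x: "x \<in> carrier (tpow S (length ps))"
  shows "cop S N i (leg S N ps x) = leg S (N + 1) (map (shift_up i) ps) x"
proof (rule structure_map_eqI[OF _ _ _ x])
  show "structure_map S (length ps) (N + 1) (\<lambda>x. cop S N i (leg S N ps x))"
    using structure_map_comp[OF structure_map_leg[OF ps refl] structure_map_cop[OF i(1,2)]] .
  show "structure_map S (length ps) (N + 1) (\<lambda>x. leg S (N + 1) (map (shift_up i) ps) x)"
    by (rule structure_map_leg[OF positions_shift_up[OF ps]]) simp
  fix k b assume k: "1 \<le> k" "k \<le> length ps" "b \<in> base S"
  then have "ps ! (k - 1) \<in> set ps" by simp
  then have p: "1 \<le> ps ! (k - 1)" "ps ! (k - 1) \<le> N" "ps ! (k - 1) \<noteq> i"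
    using ps i by (auto simp: positions_def)
  have "cop S N i (leg S N ps (leg S (length ps) [k] b)) = leg S (N + 1) [shift_up i (ps ! (k - 1))] b"
    using k p i by (simp add: leg_leg_factor[OF _ _ ps] base_carrier cop_factor shift_up_def)
  also have "\<dots> = leg S (N + 1) (map (shift_up i) ps) (leg S (length ps) [k] b)"
    using leg_leg_factor[OF _ _ positions_shift_up[OF ps], of k i b] k by (simp add: base_carrier)
  finally show "cop S N i (leg S N ps (leg S (length ps) [k] b)) = leg S (N + 1) (map (shift_up i) ps) (leg S (length ps) [k] b)" .
qed

text \<open>Comultiplication at position \<open>i\<close> may be done before embedding, provided
  that the target position is split as well. List indices count from 0 and factors from 1, so the
  entry with index \<open>r\<close> belongs to factor \<open>r + 1\<close>.\<close>

lemma cop_leg_at: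
  assumes ps: "positions N ps" and r: "r < length ps" "ps ! r = i"
    and x: "x \<in> carrier (tpow S (length ps))"
  shows "cop S N i (leg S N ps x) =
    leg S (N + 1) (map (shift_up i) (take r ps) @ [i, i + 1] @ map (shift_up i) (drop (r + 1) ps))
      (cop S (length ps) (r + 1) x)"
proof (rule structure_map_eqI[OF _ _ _ x])
  let ?L = "map (shift_up i) (take r ps) @ [i, i + 1] @ map (shift_up i) (drop (r + 1) ps)"
  have i: "1 \<le> i" "i \<le> N"
    using ps r nth_mem[OF r(1)] by (auto simp: positions_def)
  have L: "positions (N + 1) ?L" "length ?L = length ps + 1"
    using positions_shift_up_split[OF ps r] r by simp_all
  show "structure_map S (length ps) (N + 1) (\<lambda>x. cop S N i (leg S N ps x))"
    using structure_map_comp[OF structure_map_leg[OF ps refl] structure_map_cop[OF i(1,2)]] .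
  show "structure_map S (length ps) (N + 1) (\<lambda>x. leg S (N + 1) ?L (cop S (length ps) (r + 1) x))"
    by (rule structure_map_comp[OF structure_map_cop structure_map_leg[OF L]]) (use r in auto)
  fix k b assume k: "1 \<le> k" "k \<le> length ps" "b \<in> base S"
  define j where "j = k - 1"
  have j: "k = j + 1" "j < length ps" using k by (auto simp: j_def)
  then have "ps ! j \<in> set ps" by simp
  then have p: "1 \<le> ps ! j" "ps ! j \<le> N"
    using ps by (auto simp: positions_def)
  have eq: "ps ! j = i \<longleftrightarrow> j = r"
    using nth_eq_iff_index_eq[of ps j r] ps j r by (auto simp: positions_def)
  have bc: "b \<in> carrier (tpow S 1)" using k(3) by (rule base_carrier)
  have l: "leg S N ps (leg S (length ps) [k] b) = leg S N [ps ! j] b"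
    using k by (simp add: leg_leg_factor[OF _ _ ps] bc j_def)
  have lL: "leg S (N + 1) ?L (leg S (length ps + 1) [q + 1] b) = leg S (N + 1) [?L ! q] b" if "q < length ps + 1" for q
    using leg_leg_factor[OF _ _ L(1), of "q + 1" b] that unfolding L(2) by (simp add: bc)
  consider "j < r" | "j = r" | "j > r" by linarith
  then show "cop S N i (leg S N ps (leg S (length ps) [k] b)) = leg S (N + 1) ?L (cop S (length ps) (r + 1) (leg S (length ps) [k] b))"
  proof cases
    case 1
    then have "cop S (length ps) (r + 1) (leg S (length ps) [k] b) = leg S (length ps + 1) [j + 1] b"
      using k j r by (simp add: cop_factor)
    moreover have "?L ! j = shift_up i (ps ! j)" using 1 r by (simp add: nth_append)
    ultimately show ?thesis
      using lL[of j] 1 r p i eq k j unfolding l by (simp add: cop_factor shift_up_def)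
  next
    case 2
    then have "cop S (length ps) (r + 1) (leg S (length ps) [k] b) = leg S (length ps + 1) [r + 1, r + 1 + 1] (comult S b)"
      using k j r by (simp add: cop_factor)
    moreover have "leg S (N + 1) ?L (leg S (length ps + 1) [r + 1, r + 1 + 1] (comult S b)) = leg S (N + 1) [?L ! r, ?L ! (r + 1)] (comult S b)"
      using leg_leg[OF _ L, of "[r + 1, r + 1 + 1]" "comult S b"] r comult_closed[OF bc]
      by (simp add: positions_def)
    moreover have "?L ! r = i" "?L ! (r + 1) = i + 1" using r by (simp_all add: nth_append)
    ultimately show ?thesis
      using p i eq k j 2 unfolding l by (simp add: cop_factor)
  next
    case 3
    then have "cop S (length ps) (r + 1) (leg S (length ps) [k] b) = leg S (length ps + 1) [(j + 1) + 1] b"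
      using k j r by (simp add: cop_factor)
    moreover have "?L ! (j + 1) = shift_up i (ps ! j)"
    proof -
      have "?L ! (j + 1) = map (shift_up i) (drop (r + 1) ps) ! (j - (r + 1))"
        using 3 r j by (simp add: nth_append Suc_diff_Suc nth_Cons')
      also have "\<dots> = shift_up i (ps ! j)" using 3 j by simp
      finally show ?thesis .
    qed
    ultimately show ?thesis
      using lL[of "j + 1"] 3 r p i eq k j unfolding l by (simp add: cop_factor shift_up_def)
  qed
qed

lemma cou_leg_notin:
  assumes ps: "positions N ps" and i: "1 \<le> i" "i \<le> N" "i \<notin> set ps"
    and x: "x \<in> carrier (tpow S (length ps))"
  shows "cou S N i (leg S N ps x) = leg S (N - 1) (map (shift_down i) ps) x"
proof (rule structure_map_eqI[OF _ _ _ x])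
  have ps': "positions (N - 1) (map (shift_down i) ps)"
    by (rule positions_shift_down) fact+
  show "structure_map S (length ps) (N - 1) (\<lambda>x. cou S N i (leg S N ps x))"
    using structure_map_comp[OF structure_map_leg[OF ps refl] structure_map_cou[OF i(1,2)]] .
  show "structure_map S (length ps) (N - 1) (\<lambda>x. leg S (N - 1) (map (shift_down i) ps) x)"
    by (rule structure_map_leg[OF ps']) simp
  fix k b assume k: "1 \<le> k" "k \<le> length ps" "b \<in> base S"
  then have "ps ! (k - 1) \<in> set ps" by simp
  then have p: "1 \<le> ps ! (k - 1)" "ps ! (k - 1) \<le> N" "ps ! (k - 1) \<noteq> i"
    using ps i by (auto simp: positions_def)
  have "cou S N i (leg S N ps (leg S (length ps) [k] b)) = leg S (N - 1) [shift_down i (ps ! (k - 1))] b"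
    using k p i by (simp add: leg_leg_factor[OF _ _ ps] base_carrier cou_factor shift_down_def)
  also have "\<dots> = leg S (N - 1) (map (shift_down i) ps) (leg S (length ps) [k] b)"
    using leg_leg_factor[OF _ _ ps', of k b] k by (simp add: base_carrier)
  finally show "cou S N i (leg S N ps (leg S (length ps) [k] b)) = leg S (N - 1) (map (shift_down i) ps) (leg S (length ps) [k] b)" .
qed

text \<open>The counterpart of \<open>cop_leg_at\<close> for the counit: the target position
  disappears instead of being split.\<close>

lemma cou_leg_at:
  assumes ps: "positions N ps" and r: "r < length ps" "ps ! r = i"
    and x: "x \<in> carrier (tpow S (length ps))"
  shows "cou S N i (leg S N ps x) =
    leg S (N - 1) (map (shift_down i) (take r ps @ drop (r + 1) ps)) (cou S (length ps) (r + 1) x)"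
proof (rule structure_map_eqI[OF _ _ _ x])
  let ?L = "map (shift_down i) (take r ps @ drop (r + 1) ps)"
  have i: "1 \<le> i" "i \<le> N"
    using ps r nth_mem[OF r(1)] by (auto simp: positions_def)
  have "ps = take r ps @ [i] @ drop (r + 1) ps"
    using id_take_nth_drop[OF r(1)] r(2) by (simp add: Suc_eq_plus1)
  then have "distinct (take r ps @ [i] @ drop (r + 1) ps)" "set (take r ps @ [i] @ drop (r + 1) ps) \<subseteq> {1..N}"
    using ps by (simp_all only: positions_def)
  then have "positions N (take r ps @ drop (r + 1) ps)" "i \<notin> set (take r ps @ drop (r + 1) ps)"
    by (auto simp: positions_def)
  then have "positions (N - 1) ?L"
    using i by (rule positions_shift_down)
  moreover have "length ?L = length ps - 1"
    using r by simp
  ultimately have L: "positions (N - 1) ?L" "length ?L = length ps - 1" .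
  show "structure_map S (length ps) (N - 1) (\<lambda>x. cou S N i (leg S N ps x))"
    using structure_map_comp[OF structure_map_leg[OF ps refl] structure_map_cou[OF i(1,2)]] .
  show "structure_map S (length ps) (N - 1) (\<lambda>x. leg S (N - 1) ?L (cou S (length ps) (r + 1) x))"
    by (rule structure_map_comp[OF structure_map_cou structure_map_leg[OF L]]) (use r in auto)
  fix k b assume k: "1 \<le> k" "k \<le> length ps" "b \<in> base S"
  define j where "j = k - 1"
  have j: "k = j + 1" "j < length ps" using k by (auto simp: j_def)
  then have "ps ! j \<in> set ps" by simp
  then have p: "1 \<le> ps ! j" "ps ! j \<le> N"
    using ps by (auto simp: positions_def)
  have eq: "ps ! j = i \<longleftrightarrow> j = r"
    using nth_eq_iff_index_eq[of ps j r] ps j r by (auto simp: positions_def)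
  have bc: "b \<in> carrier (tpow S 1)" using k(3) by (rule base_carrier)
  have l: "leg S N ps (leg S (length ps) [k] b) = leg S N [ps ! j] b"
    using k by (simp add: leg_leg_factor[OF _ _ ps] bc j_def)
  have lL: "leg S (N - 1) ?L (leg S (length ps - 1) [q + 1] b) = leg S (N - 1) [?L ! q] b" if "q < length ps - 1" for q
    using leg_leg_factor[OF _ _ L(1), of "q + 1" b] that unfolding L(2) by (simp add: bc)
  consider "j < r" | "j = r" | "j > r" by linarith
  then show "cou S N i (leg S N ps (leg S (length ps) [k] b)) = leg S (N - 1) ?L (cou S (length ps) (r + 1) (leg S (length ps) [k] b))"
  proof cases
    case 1
    then have "cou S (length ps) (r + 1) (leg S (length ps) [k] b) = leg S (length ps - 1) [j + 1] b"
      using k j r by (simp add: cou_factor)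
    moreover have "?L ! j = shift_down i (ps ! j)" using 1 r by (simp add: nth_append)
    ultimately show ?thesis
      using lL[of j] 1 r p i eq k j unfolding l by (simp add: cou_factor shift_down_def)
  next
    case 2
    then have "cou S (length ps) (r + 1) (leg S (length ps) [k] b) = leg S (length ps - 1) [] (counit S b)"
      using k j r by (simp add: cou_factor)
    \<comment> \<open>A scalar occupies no position, so its embedding does not depend on the list
      \<open>?L\<close>.\<close>
    moreover have "leg S (N - 1) ?L (leg S (length ps - 1) [] (counit S b)) = leg S (N - 1) [] (counit S b)"
      using leg_leg[OF _ L, of "[]" "counit S b"] counit_closed[OF bc]
      by (simp add: positions_def)
    ultimately show ?thesis
      using p i eq k j 2 unfolding l by (simp add: cou_factor)
  next
    case 3
    then have "cou S (length ps) (r + 1) (leg S (length ps) [k] b) = leg S (length ps - 1) [(j - 1) + 1] b"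
      using k j r by (simp add: cou_factor)
    moreover have "?L ! (j - 1) = shift_down i (ps ! j)"
    proof -
      have "\<not> j - 1 < r" "r + 1 + (j - 1 - r) = j"
        using 3 by linarith+
      then show ?thesis using r j by (simp add: nth_append)
    qed
    ultimately show ?thesis
      using lL[of "j - 1"] 3 r p i eq k j unfolding l by (simp add: cou_factor shift_down_def)
  qed
qed

end



section \<open>R-matrices\<close>

context monoid
begin

lemma conj_eq_iff:
  assumes "p \<in> Units G" "x \<in> carrier G" "y \<in> carrier G"
  shows "x = p \<otimes> y \<otimes> inv p \<longleftrightarrow> x \<otimes> p = p \<otimes> y"
proof
  assume "x = p \<otimes> y \<otimes> inv p"
  then show "x \<otimes> p = p \<otimes> y" using assms by (simp add: m_assoc Units_closed)
next
  assume "x \<otimes> p = p \<otimes> y"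
  then have "p \<otimes> y \<otimes> inv p = x \<otimes> p \<otimes> inv p" by simp
  then show "x = p \<otimes> y \<otimes> inv p" using assms by (simp add: m_assoc Units_closed)
qed

lemma inv_intertwine:
  assumes "f \<in> Units G" "x \<in> carrier G" "y \<in> carrier G" "y \<otimes> f = f \<otimes> x"
  shows "x \<otimes> inv f = inv f \<otimes> y"
proof -
  have "inv f \<otimes> y = inv f \<otimes> (y \<otimes> f) \<otimes> inv f"
    using assms(1-3) by (simp add: m_assoc Units_closed)
  also have "\<dots> = x \<otimes> inv f"
    unfolding assms(4) using assms(1-3) by (simp add: m_assoc[symmetric] Units_closed)
  finally show ?thesis by simp
qed

lemma Units_inv_mult:
  assumes "x \<in> Units G" "y \<in> Units G"
  shows "inv (x \<otimes> y) = inv y \<otimes> inv x"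
proof (rule inv_char[symmetric, THEN sym])
  have "x \<otimes> y \<otimes> (inv y \<otimes> inv x) = x \<otimes> (y \<otimes> inv y) \<otimes> inv x"
    using assms by (simp add: m_assoc Units_closed del: Units_r_inv Units_l_inv)
  then show "x \<otimes> y \<otimes> (inv y \<otimes> inv x) = \<one>" using assms by (simp add: Units_closed)
  have "inv y \<otimes> inv x \<otimes> (x \<otimes> y) = inv y \<otimes> (inv x \<otimes> x) \<otimes> y"
    using assms by (simp add: m_assoc Units_closed del: Units_r_inv Units_l_inv)
  then show "inv y \<otimes> inv x \<otimes> (x \<otimes> y) = \<one>" using assms by (simp add: Units_closed)
qed (use assms in \<open>auto simp: Units_closed\<close>)

lemma Units_cancel_left:
  assumes "x \<in> Units G" "y \<in> carrier G"
  shows "inv x \<otimes> (x \<otimes> y) = y" "x \<otimes> (inv x \<otimes> y) = y"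
  using assms by (simp_all add: m_assoc[symmetric] Units_closed)

lemma conj_conj:
  assumes "a \<in> Units G" "b \<in> Units G" "x \<in> carrier G"
  shows "inv b \<otimes> (inv a \<otimes> x \<otimes> a) \<otimes> b = inv (a \<otimes> b) \<otimes> x \<otimes> (a \<otimes> b)"
  using assms by (simp add: Units_inv_mult m_assoc Units_closed)

text \<open>Moves the conjugating units of two maps into the intertwining element. This is the
  algebra behind the validity of \<open>extend\<close> after twisting.\<close>

lemma conj_intertwine_iff:
  assumes "a \<in> Units G" "b \<in> Units G" "x \<in> carrier G" "y \<in> carrier G" "u \<in> carrier G"
  shows "inv a \<otimes> x \<otimes> a \<otimes> u = u \<otimes> (inv b \<otimes> y \<otimes> b) \<longleftrightarrow> x \<otimes> (a \<otimes> u \<otimes> inv b) = a \<otimes> u \<otimes> inv b \<otimes> y"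
proof
  assume *: "inv a \<otimes> x \<otimes> a \<otimes> u = u \<otimes> (inv b \<otimes> y \<otimes> b)"
  have "x \<otimes> (a \<otimes> u \<otimes> inv b) = a \<otimes> (inv a \<otimes> x \<otimes> a \<otimes> u) \<otimes> inv b"
    using assms by (simp add: m_assoc Units_closed Units_cancel_left)
  also have "\<dots> = a \<otimes> u \<otimes> inv b \<otimes> y"
    unfolding * using assms by (simp add: m_assoc Units_closed)
  finally show "x \<otimes> (a \<otimes> u \<otimes> inv b) = a \<otimes> u \<otimes> inv b \<otimes> y" .
next
  assume *: "x \<otimes> (a \<otimes> u \<otimes> inv b) = a \<otimes> u \<otimes> inv b \<otimes> y"
  have "inv a \<otimes> x \<otimes> a \<otimes> u = inv a \<otimes> (x \<otimes> (a \<otimes> u \<otimes> inv b)) \<otimes> b"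
    using assms by (simp add: m_assoc Units_closed)
  also have "\<dots> = u \<otimes> (inv b \<otimes> y \<otimes> b)"
    unfolding * using assms by (simp add: m_assoc Units_closed Units_cancel_left)
  finally show "inv a \<otimes> x \<otimes> a \<otimes> u = u \<otimes> (inv b \<otimes> y \<otimes> b)" .
qed

end

lemma take_drop_Cons_one [simp]: "take 1 (x # xs) = [x]" "drop 1 (x # xs) = xs"
  by (simp_all only: One_nat_def take_Suc_Cons drop_Suc_Cons take_0 drop_0)

section \<open>Yang-Baxter relations, flipped inverses and counits of R-matrices\<close>

context topological_bialgebra
begin

abbreviation mult2 (infixl "\<otimes>\<^sub>2" 70) where "x \<otimes>\<^sub>2 y \<equiv> x \<otimes>\<^bsub>tpow S 2\<^esub> y"
abbreviation mult3 (infixl "\<otimes>\<^sub>3" 70) where "x \<otimes>\<^sub>3 y \<equiv> x \<otimes>\<^bsub>tpow S 3\<^esub> y"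

lemma leg_12 [simp]: "x \<in> carrier (tpow S 2) \<Longrightarrow> leg S 2 [1, 2] x = x"
  using leg_id[of x 2] by (simp add: upt_conv_Cons)

lemma leg_1 [simp]: "x \<in> carrier (tpow S 1) \<Longrightarrow> leg S 1 [1] x = x"
  using leg_id[of x 1] by (simp add: upt_conv_Cons)

lemma leg_21_21: "x \<in> carrier (tpow S 2) \<Longrightarrow> leg S 2 [2, 1] (leg S 2 [2, 1] x) = x"
  using leg_leg[of 2 "[2, 1]" 2 "[2, 1]" x] by (simp add: positions_def)

lemma leg3_leg2:
  assumes "positions 3 [p, q]" "positions 2 [i, j]" "x \<in> carrier (tpow S 2)"
  shows "leg S 3 [p, q] (leg S 2 [i, j] x) = leg S 3 [[p, q] ! (i - 1), [p, q] ! (j - 1)] x"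
  using leg_leg[OF assms(2,1)] assms(3) by simp

lemma leg3_leg3:
  assumes "positions 3 [p, q, r]" "positions 3 ps" "x \<in> carrier (tpow S (length ps))"
  shows "leg S 3 [p, q, r] (leg S 3 ps x) = leg S 3 (map (\<lambda>i. [p, q, r] ! (i - 1)) ps) x"
  using leg_leg[OF assms(2,1) _ assms(3)] by simp

lemma cop2_closed:
  assumes "x \<in> carrier (tpow S 2)"
  shows "cop S 2 1 x \<in> carrier (tpow S 3)" "cop S 2 2 x \<in> carrier (tpow S 3)"
  using cop_closed[OF _ _ assms, of 1] cop_closed[OF _ _ assms, of 2] by simp_all

lemma cop2_hom: "cop S 2 1 \<in> alg_hom (scalars S) (tpow S 2) (tpow S 3)"
    "cop S 2 2 \<in> alg_hom (scalars S) (tpow S 2) (tpow S 3)"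
  using cop_hom[of 1 2] cop_hom[of 2 2] by simp_all

text \<open>Comultiplying a factor of the flipped element is comultiplying the other factor of the
  original one, up to a cyclic permutation of the three components.\<close>

lemma cop_21:
  assumes "x \<in> carrier (tpow S 2)"
  shows "cop S 2 1 (leg S 2 [2, 1] x) = leg S 3 [3, 1, 2] (cop S 2 2 x)"
    and "cop S 2 2 (leg S 2 [2, 1] x) = leg S 3 [2, 3, 1] (cop S 2 1 x)"
  using cop_leg_at[of 2 "[2, 1]" 1 1 x] cop_leg_at[of 2 "[2, 1]" 0 2 x] assms
  by (simp_all add: positions_def shift_up_def)

lemma
  assumes "R_matrix S P"
  shows R_matrix_Units: "P \<in> Units (tpow S 2)"
    and R_matrix_closed: "P \<in> carrier (tpow S 2)"
    and R_matrix_comult: "b \<in> base S \<Longrightarrow> leg S 2 [2, 1] (comult S b) \<otimes>\<^sub>2 P = P \<otimes>\<^sub>2 comult S b"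
    and R_matrix_cop1: "cop S 2 1 P = leg S 3 [1, 3] P \<otimes>\<^sub>3 leg S 3 [2, 3] P"
    and R_matrix_cop2: "cop S 2 2 P = leg S 3 [1, 3] P \<otimes>\<^sub>3 leg S 3 [1, 2] P"
proof -
  show P: "P \<in> Units (tpow S 2)"
    and "cop S 2 1 P = leg S 3 [1, 3] P \<otimes>\<^sub>3 leg S 3 [2, 3] P"
    and "cop S 2 2 P = leg S 3 [1, 3] P \<otimes>\<^sub>3 leg S 3 [1, 2] P"
    using assms by (simp_all add: R_matrix_def)
  then show "P \<in> carrier (tpow S 2)" by (simp add: A.Units_closed)
  assume b: "b \<in> base S"
  have c: "comult S b \<in> carrier (tpow S 2)" "leg S 2 [2, 1] (comult S b) \<in> carrier (tpow S 2)"
    using comult_closed[OF base_carrier[OF b]] by (auto simp: positions_def)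
  show "leg S 2 [2, 1] (comult S b) \<otimes>\<^sub>2 P = P \<otimes>\<^sub>2 comult S b"
    using assms b A.conj_eq_iff[OF P c(2,1)] by (simp add: R_matrix_def)
qed

lemma R_matrixI:
  assumes P: "P \<in> Units (tpow S 2)"
    and "\<And>b. b \<in> base S \<Longrightarrow> leg S 2 [2, 1] (comult S b) \<otimes>\<^sub>2 P = P \<otimes>\<^sub>2 comult S b"
    and "cop S 2 1 P = leg S 3 [1, 3] P \<otimes>\<^sub>3 leg S 3 [2, 3] P"
    and "cop S 2 2 P = leg S 3 [1, 3] P \<otimes>\<^sub>3 leg S 3 [1, 2] P"
  shows "R_matrix S P"
proof -
  have c: "comult S b \<in> carrier (tpow S 2)" "leg S 2 [2, 1] (comult S b) \<in> carrier (tpow S 2)" if "b \<in> base S" for b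
    using comult_closed[OF base_carrier[OF that]] by (auto simp: positions_def)
  then show ?thesis
    unfolding R_matrix_def using assms A.conj_eq_iff[OF P] by auto
qed

text \<open>The defining relation of \<open>P\<close> concerns single elements of
  \<open>base S\<close>; here it acts on one factor of an element of the completed square. On the
  comultiplied factor it is the defining relation, on the other factor both sides commute for lack
  of a common position, and \<open>extend\<close> with \<open>u\<close> equal to \<open>P\<close> in
  two legs does the rest.\<close>

lemma R_matrix_intertwine:
  assumes P: "R_matrix S P" and x: "x \<in> carrier (tpow S 2)"
  shows "leg S 3 [2, 1, 3] (cop S 2 1 x) \<otimes>\<^sub>3 leg S 3 [1, 2] P = leg S 3 [1, 2] P \<otimes>\<^sub>3 cop S 2 1 x"
    and "leg S 3 [1, 3, 2] (cop S 2 2 x) \<otimes>\<^sub>3 leg S 3 [2, 3] P = leg S 3 [2, 3] P \<otimes>\<^sub>3 cop S 2 2 x"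
proof -
  note Pc = R_matrix_closed[OF P]
  have sm: "structure_map S 2 3 (\<lambda>x. cop S 2 1 x)" "structure_map S 2 3 (\<lambda>x. cop S 2 2 x)"
    using structure_map_cop[of 1 2] structure_map_cop[of 2 2] by simp_all
  have sl: "structure_map S 3 3 (\<lambda>x. leg S 3 [2, 1, 3] x)" "structure_map S 3 3 (\<lambda>x. leg S 3 [1, 3, 2] x)"
    by (rule structure_map_leg; simp add: positions_def)+
  have c: "comult S b \<in> carrier (tpow S 2)" "leg S 2 [2, 1] (comult S b) \<in> carrier (tpow S 2)" if "b \<in> base S" for b
    using comult_closed[OF base_carrier[OF that]] by (auto simp: positions_def)
  have k12: "k = 1 \<or> k = 2" if "1 \<le> k" "k \<le> 2" for k :: nat
    using that by linarith
  show "leg S 3 [2, 1, 3] (cop S 2 1 x) \<otimes>\<^sub>3 leg S 3 [1, 2] P = leg S 3 [1, 2] P \<otimes>\<^sub>3 cop S 2 1 x"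
  proof (rule structure_map_intertwine[OF structure_map_comp[OF sm(1) sl(1)] sm(1) _ _ x])
    show "leg S 3 [1, 2] P \<in> carrier (tpow S 3)" using Pc by (simp add: positions_def)
    fix k :: nat and b assume k: "1 \<le> k" "k \<le> 2" and b: "b \<in> base S"
    note bc = base_carrier[OF b]
    from k12[OF k] show "leg S 3 [2, 1, 3] (cop S 2 1 (leg S 2 [k] b)) \<otimes>\<^sub>3 leg S 3 [1, 2] P =
        leg S 3 [1, 2] P \<otimes>\<^sub>3 cop S 2 1 (leg S 2 [k] b)"
    proof
      assume k: "k = 1"
      have "leg S 3 [1, 2] (leg S 2 [2, 1] (comult S b) \<otimes>\<^sub>2 P) = leg S 3 [1, 2] (P \<otimes>\<^sub>2 comult S b)"
        by (simp only: R_matrix_comult[OF P b])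
      then show ?thesis
        using k b c[OF b] Pc
        by (simp add: cop_factor leg3_leg3 leg3_leg2 leg_mult positions_def)
    next
      assume k: "k = 2"
      then show ?thesis
        using b bc Pc leg_commute[of 3 "[3]" "[1, 2]" b P]
        by (simp add: cop_factor leg3_leg3 positions_def)
    qed
  qed
  show "leg S 3 [1, 3, 2] (cop S 2 2 x) \<otimes>\<^sub>3 leg S 3 [2, 3] P = leg S 3 [2, 3] P \<otimes>\<^sub>3 cop S 2 2 x"
  proof (rule structure_map_intertwine[OF structure_map_comp[OF sm(2) sl(2)] sm(2) _ _ x])
    show "leg S 3 [2, 3] P \<in> carrier (tpow S 3)" using Pc by (simp add: positions_def)
    fix k :: nat and b assume k: "1 \<le> k" "k \<le> 2" and b: "b \<in> base S"
    note bc = base_carrier[OF b]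
    from k12[OF k] show "leg S 3 [1, 3, 2] (cop S 2 2 (leg S 2 [k] b)) \<otimes>\<^sub>3 leg S 3 [2, 3] P =
        leg S 3 [2, 3] P \<otimes>\<^sub>3 cop S 2 2 (leg S 2 [k] b)"
    proof
      assume k: "k = 2"
      have "leg S 3 [2, 3] (leg S 2 [2, 1] (comult S b) \<otimes>\<^sub>2 P) = leg S 3 [2, 3] (P \<otimes>\<^sub>2 comult S b)"
        by (simp only: R_matrix_comult[OF P b])
      then show ?thesis
        using k b c[OF b] Pc
        by (simp add: cop_factor leg3_leg3 leg3_leg2 leg_mult positions_def)
    next
      assume k: "k = 1"
      then show ?thesis
        using b bc Pc leg_commute[of 3 "[1]" "[2, 3]" b P]
        by (simp add: cop_factor leg3_leg3 positions_def)
    qed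
  qed
qed

text \<open>
  The Yang--Baxter equation for two R-matrices, in both forms where the middle factor comes from the
  same R-matrix as one of its neighbours.
\<close>

lemma R_matrix_Yang_Baxter:
  assumes P: "R_matrix S P" and Q: "R_matrix S Q"
  shows "leg S 3 [1, 2] Q \<otimes>\<^sub>3 (leg S 3 [1, 3] P \<otimes>\<^sub>3 leg S 3 [2, 3] P) =
      leg S 3 [2, 3] P \<otimes>\<^sub>3 leg S 3 [1, 3] P \<otimes>\<^sub>3 leg S 3 [1, 2] Q"
    and "leg S 3 [2, 3] Q \<otimes>\<^sub>3 (leg S 3 [1, 3] P \<otimes>\<^sub>3 leg S 3 [1, 2] P) =
      leg S 3 [1, 2] P \<otimes>\<^sub>3 leg S 3 [1, 3] P \<otimes>\<^sub>3 leg S 3 [2, 3] Q"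
  \<comment> \<open>\<open>Q\<close> intertwines the coproduct of the element \<open>P\<close> with
    its opposite, and the comultiplication rules for \<open>P\<close> expand both sides.\<close>
  using R_matrix_intertwine[OF Q R_matrix_closed[OF P]] R_matrix_closed[OF P]
  by (simp_all add: R_matrix_cop1[OF P] R_matrix_cop2[OF P] leg_mult leg3_leg3 positions_def)

text \<open>The flip exchanges the two comultiplication rules and leaves their factors in the wrong
  order; inversion reverses the order and restores the rules.\<close>

lemma R_matrix_inv_flip:
  assumes P: "R_matrix S P"
  shows "R_matrix S (inv\<^bsub>tpow S 2\<^esub> (leg S 2 [2, 1] P))"
proof -
  note Pc = R_matrix_closed[OF P] and Pu = R_matrix_Units[OF P]
  let ?F = "leg S 2 [2, 1] P"
  have F: "?F \<in> Units (tpow S 2)" by (rule leg_Units[OF _ _ Pu]) (simp_all add: positions_def)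
  have lF: "leg S 3 [i, j] (inv\<^bsub>tpow S 2\<^esub> ?F) = inv\<^bsub>tpow S 3\<^esub> leg S 3 [j, i] P" if "positions 3 [i, j]" for i j
    using leg_inv[OF that _ F] leg3_leg2[OF that, of 2 1 P] Pc by (simp add: positions_def)
  have U: "leg S 3 [i, j] P \<in> Units (tpow S 3)" if "positions 3 [i, j]" for i j
    using leg_Units[OF that _ Pu] by simp
  show ?thesis
  proof (rule R_matrixI)
    show "inv\<^bsub>tpow S 2\<^esub> ?F \<in> Units (tpow S 2)" using F by (rule A.Units_inv_Units)
    fix b assume b: "b \<in> base S"
    have c: "comult S b \<in> carrier (tpow S 2)" "leg S 2 [2, 1] (comult S b) \<in> carrier (tpow S 2)"
      using comult_closed[OF base_carrier[OF b]] by (auto simp: positions_def)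
    have "leg S 2 [2, 1] (leg S 2 [2, 1] (comult S b) \<otimes>\<^sub>2 P) = leg S 2 [2, 1] (P \<otimes>\<^sub>2 comult S b)"
      by (simp only: R_matrix_comult[OF P b])
    then have "comult S b \<otimes>\<^sub>2 ?F = ?F \<otimes>\<^sub>2 leg S 2 [2, 1] (comult S b)"
      using c Pc by (simp add: leg_mult leg_21_21 positions_def)
    then show "leg S 2 [2, 1] (comult S b) \<otimes>\<^sub>2 inv\<^bsub>tpow S 2\<^esub> ?F = inv\<^bsub>tpow S 2\<^esub> ?F \<otimes>\<^sub>2 comult S b"
      by (rule A.inv_intertwine[OF F c(2,1)])
  next
    have "cop S 2 1 ?F = leg S 3 [3, 2] P \<otimes>\<^sub>3 leg S 3 [3, 1] P"
      using Pc by (simp add: cop_21 R_matrix_cop2[OF P] leg_mult leg3_leg3 positions_def)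
    then show "cop S 2 1 (inv\<^bsub>tpow S 2\<^esub> ?F) = leg S 3 [1, 3] (inv\<^bsub>tpow S 2\<^esub> ?F) \<otimes>\<^sub>3 leg S 3 [2, 3] (inv\<^bsub>tpow S 2\<^esub> ?F)"
      using U by (simp add: alg_hom_inv[OF cop2_hom(1) F A.monoid_axioms A.monoid_axioms]
          lF A.Units_inv_mult positions_def)
    have "cop S 2 2 ?F = leg S 3 [2, 1] P \<otimes>\<^sub>3 leg S 3 [3, 1] P"
      using Pc by (simp add: cop_21 R_matrix_cop1[OF P] leg_mult leg3_leg3 positions_def)
    then show "cop S 2 2 (inv\<^bsub>tpow S 2\<^esub> ?F) = leg S 3 [1, 3] (inv\<^bsub>tpow S 2\<^esub> ?F) \<otimes>\<^sub>3 leg S 3 [1, 2] (inv\<^bsub>tpow S 2\<^esub> ?F)"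
      using U by (simp add: alg_hom_inv[OF cop2_hom(2) F A.monoid_axioms A.monoid_axioms]
          lF A.Units_inv_mult positions_def)
  qed
qed

lemma R_matrix_R_sign: "R_matrix S R \<Longrightarrow> R_matrix S (R_sign S R e)"
  by (simp add: R_sign_def R_matrix_inv_flip)

text \<open>Applying the counit to the first component of the coproduct reproduces \<open>P\<close>,
  while the comultiplication rule gives \<open>P\<close> multiplied by its own counit;
  \<open>P\<close> is invertible, so the extra factor is 1. The other side is symmetric. This
  normalisation makes the twists below compatible with the counit.\<close>

lemma R_matrix_counit:
  assumes P: "R_matrix S P"
  shows "cou S 2 1 P = \<one>\<^bsub>tpow S 1\<^esub>" and "cou S 2 2 P = \<one>\<^bsub>tpow S 1\<^esub>"
proof -
  note Pc = R_matrix_closed[OF P] and Pu = R_matrix_Units[OF P]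
  have sm: "structure_map S 2 3 (\<lambda>x. cop S 2 1 x)" "structure_map S 2 3 (\<lambda>x. cop S 2 2 x)"
    using structure_map_cop[of 1 2] structure_map_cop[of 2 2] by simp_all
  have sc: "structure_map S 3 2 (\<lambda>x. cou S 3 1 x)" "structure_map S 3 2 (\<lambda>x. cou S 3 3 x)"
    using structure_map_cou[of 1 3] structure_map_cou[of 3 3] by simp_all
  have ch: "cou S 3 1 \<in> alg_hom (scalars S) (tpow S 3) (tpow S 2)" "cou S 3 3 \<in> alg_hom (scalars S) (tpow S 3) (tpow S 2)"
    using cou_hom[of 1 3] cou_hom[of 3 3] by simp_all
  have c1: "cou S 2 i P \<in> carrier (tpow S 1)" if "i = 1 \<or> i = 2" for i
    using cou_closed[of i 2 P] that Pc by auto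
  have k12: "k = 1 \<or> k = 2" if "1 \<le> k" "k \<le> 2" for k :: nat
    using that by linarith
  have one: "y = \<one>\<^bsub>tpow S 2\<^esub>" if "P = y \<otimes>\<^sub>2 P \<or> P = P \<otimes>\<^sub>2 y" "y \<in> carrier (tpow S 2)" for y
  proof -
    have "P \<otimes>\<^sub>2 inv\<^bsub>tpow S 2\<^esub> P = y \<otimes>\<^sub>2 P \<otimes>\<^sub>2 inv\<^bsub>tpow S 2\<^esub> P \<or> inv\<^bsub>tpow S 2\<^esub> P \<otimes>\<^sub>2 P = inv\<^bsub>tpow S 2\<^esub> P \<otimes>\<^sub>2 (P \<otimes>\<^sub>2 y)"
      using that(1) by auto
    then show ?thesis using that(2) Pu Pc by (auto simp: A.m_assoc A.Units_cancel_left)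
  qed
  have "cou S 3 1 (cop S 2 1 P) = P"
  proof (rule structure_map_eqI[OF structure_map_comp[OF sm(1) sc(1)] structure_map.ident _ Pc])
    fix k :: nat and b assume k: "1 \<le> k" "k \<le> 2" and b: "b \<in> base S"
    from k12[OF k] show "cou S 3 1 (cop S 2 1 (leg S 2 [k] b)) = leg S 2 [k] b"
      using b comult_closed[OF base_carrier[OF b]] cou_leg_at[of 3 "[1, 2]" 0 1 "comult S b"]
      by (auto simp: cop_factor cou_factor counit_left shift_down_def positions_def)
  qed
  moreover have "cou S 3 1 (cop S 2 1 P) = leg S 2 [2] (cou S 2 1 P) \<otimes>\<^sub>2 P \<or> cou S 3 1 (cop S 2 1 P) = P \<otimes>\<^sub>2 leg S 2 [2] (cou S 2 1 P)"
    using Pc cou_leg_at[of 3 "[1, 3]" 0 1 P] cou_leg_notin[of 3 "[2, 3]" 1 P]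
    by (simp add: R_matrix_cop1[OF P] alg_hom_mult[OF ch(1)] shift_down_def positions_def)
  ultimately have "leg S 2 [2] (cou S 2 1 P) = \<one>\<^bsub>tpow S 2\<^esub>"
    using c1[of 1] by (intro one) auto
  \<comment> \<open>Position 1 carries nothing, so the counit there undoes the embedding into
    position 2.\<close>
  then have "cou S 2 1 (leg S 2 [2] (cou S 2 1 P)) = cou S 2 1 \<one>\<^bsub>tpow S 2\<^esub>" by simp
  then show "cou S 2 1 P = \<one>\<^bsub>tpow S 1\<^esub>"
    using cou_leg_notin[of 2 "[2]" 1 "cou S 2 1 P"] c1[of 1] alg_hom_one[OF cou_hom[of 1 2]]
    by (simp add: shift_down_def)
  have "cou S 3 3 (cop S 2 2 P) = P"
  proof (rule structure_map_eqI[OF structure_map_comp[OF sm(2) sc(2)] structure_map.ident _ Pc])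
    fix k :: nat and b assume k: "1 \<le> k" "k \<le> 2" and b: "b \<in> base S"
    from k12[OF k] show "cou S 3 3 (cop S 2 2 (leg S 2 [k] b)) = leg S 2 [k] b"
      using b comult_closed[OF base_carrier[OF b]] cou_leg_at[of 3 "[2, 3]" 1 3 "comult S b"]
      by (auto simp: cop_factor cou_factor counit_right shift_down_def positions_def)
  qed
  moreover have "cou S 3 3 (cop S 2 2 P) = leg S 2 [1] (cou S 2 2 P) \<otimes>\<^sub>2 P \<or> cou S 3 3 (cop S 2 2 P) = P \<otimes>\<^sub>2 leg S 2 [1] (cou S 2 2 P)"
    using Pc cou_leg_at[of 3 "[1, 3]" 1 3 P] cou_leg_notin[of 3 "[1, 2]" 3 P]
    by (simp add: R_matrix_cop2[OF P] alg_hom_mult[OF ch(2)] shift_down_def positions_def)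
  ultimately have "leg S 2 [1] (cou S 2 2 P) = \<one>\<^bsub>tpow S 2\<^esub>"
    using c1[of 2] by (intro one) auto
  then have "cou S 2 2 (leg S 2 [1] (cou S 2 2 P)) = cou S 2 2 \<one>\<^bsub>tpow S 2\<^esub>" by simp
  then show "cou S 2 2 P = \<one>\<^bsub>tpow S 1\<^esub>"
    using cou_leg_notin[of 2 "[1]" 2 "cou S 2 2 P"] c1[of 2] alg_hom_one[OF cou_hom[of 2 2]]
    by (simp add: shift_down_def)
qed

end



section \<open>Twisting\<close>

lemma twist_simps [simp]:
  "scalars (twist S J) = scalars S" "base (twist S J) = base S" "tpow (twist S J) = tpow S"
  "leg (twist S J) = leg S" "cou (twist S J) = cou S"
  by (simp_all add: twist_def)

lemma pure_tensor_twist [simp]: "pure_tensor (twist S J) hs = pure_tensor S hs"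
  by (simp add: pure_tensor_def)

lemma tensors_twist [simp]: "tensors (twist S J) m = tensors S m"
proof (intro equalityI subsetI)
  show "x \<in> tensors S m" if "x \<in> tensors (twist S J) m" for x
    using that
  proof (induction rule: tensors.induct)
    case (pure hs)
    then show ?case using tensors.pure[of hs m S] by simp
  next
    case (add x y)
    then show ?case using tensors.add[of x S m y] by simp
  next
    case (smult a x)
    then show ?case using tensors.smult[of a S x m] by simp
  qed
  show "x \<in> tensors (twist S J) m" if "x \<in> tensors S m" for x
    using that
  proof (induction rule: tensors.induct)
    case (pure hs)
    then show ?case using tensors.pure[of hs m "twist S J"] by simp
  next
    case (add x y)
    then show ?case using tensors.add[of x "twist S J" m y] by simp
  next
    case (smult a x)
    then show ?case using tensors.smult[of a "twist S J" x m] by simp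
  qed
qed

context monoid
begin

text \<open>
  The computation of \<open>(\<Delta>\<^sub>J \<otimes> id)\<close> and \<open>(id \<otimes> \<Delta>\<^sub>J)\<close> on \<open>J\<^sub>2\<^sub>1\<^sup>-\<^sup>1 R J\<close>: assumptions 1, 2 and 5 are
  permuted cocycle equations, 3 and 4 say that \<open>R\<close> in two positions intertwines the comultiplication
  with its opposite. The \<open>j\<close>'s and \<open>k\<close>'s are \<open>J\<close> and the \<open>r\<close>'s are \<open>R\<close> in two of three positions.
\<close>

lemma twisted_R_matrix_aux:
  assumes U: "a \<in> Units G" "c \<in> Units G" "j1 \<in> Units G" "j2 \<in> Units G" "j3 \<in> Units G"
    and C: "k1 \<in> carrier G" "k2 \<in> carrier G" "r1 \<in> carrier G" "r2 \<in> carrier G"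
      "d \<in> carrier G" "e \<in> carrier G" "x \<in> carrier G" "y \<in> carrier G"
    and 1: "a \<otimes> j1 = c \<otimes> j2"
    and 2: "d \<otimes> k1 = e \<otimes> j3"
    and 3: "e \<otimes> r2 = r2 \<otimes> y"
    and 4: "a \<otimes> r1 = r1 \<otimes> d"
    and 5: "x \<otimes> j2 = y \<otimes> k2"
  shows "inv j2 \<otimes> (inv c \<otimes> (r1 \<otimes> r2) \<otimes> x) \<otimes> j2 =
    (inv j1 \<otimes> r1 \<otimes> k1) \<otimes> (inv j3 \<otimes> r2 \<otimes> k2)"
proof -
  note C' = C U[THEN Units_closed]
  have e: "e = d \<otimes> k1 \<otimes> inv j3"
    using 2 U C by (simp add: m_assoc Units_closed)
  have "inv j2 \<otimes> (inv c \<otimes> (r1 \<otimes> r2) \<otimes> x) \<otimes> j2 = inv (c \<otimes> j2) \<otimes> r1 \<otimes> r2 \<otimes> (x \<otimes> j2)"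
    using U C' by (simp add: m_assoc Units_inv_mult)
  also have "\<dots> = inv (a \<otimes> j1) \<otimes> r1 \<otimes> (r2 \<otimes> y) \<otimes> k2"
    using U C' by (simp add: m_assoc 1[symmetric] 5)
  also have "\<dots> = inv (a \<otimes> j1) \<otimes> (r1 \<otimes> d) \<otimes> k1 \<otimes> inv j3 \<otimes> r2 \<otimes> k2"
    using U C' unfolding 3[symmetric] e by (simp add: m_assoc)
  also have "\<dots> = (inv j1 \<otimes> r1 \<otimes> k1) \<otimes> (inv j3 \<otimes> r2 \<otimes> k2)"
    using U C' unfolding 4[symmetric] by (simp add: m_assoc Units_inv_mult Units_cancel_left)
  finally show ?thesis .
qed

end

lemma alg_hom_conj:
  assumes h: "h \<in> alg_hom K A B" and "u \<in> Units A" "y \<in> carrier A" and AB: "monoid A" "monoid B"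
  shows "h (inv\<^bsub>A\<^esub> u \<otimes>\<^bsub>A\<^esub> y \<otimes>\<^bsub>A\<^esub> u) = inv\<^bsub>B\<^esub> (h u) \<otimes>\<^bsub>B\<^esub> h y \<otimes>\<^bsub>B\<^esub> h u"
proof -
  interpret A: monoid A by (rule AB)
  show ?thesis
    using assms by (simp add: alg_hom_mult[OF h] alg_hom_inv[OF h] A.Units_closed)
qed

lemma (in leg_system) alg_hom_conj_by:
  assumes f: "f \<in> alg_hom (scalars S) (tpow S m) (tpow S N)" and u: "u \<in> Units (tpow S N)"
  shows "(\<lambda>x. inv\<^bsub>tpow S N\<^esub> u \<otimes>\<^bsub>tpow S N\<^esub> f x \<otimes>\<^bsub>tpow S N\<^esub> u) \<in> alg_hom (scalars S) (tpow S m) (tpow S N)"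
proof (rule alg_homI)
  note c = alg_hom_closed[OF f] A.Units_closed[OF u] A.Units_inv_closed[OF u]
  fix x y assume x: "x \<in> carrier (tpow S m)" and y: "y \<in> carrier (tpow S m)"
  show "inv\<^bsub>tpow S N\<^esub> u \<otimes>\<^bsub>tpow S N\<^esub> f (x \<oplus>\<^bsub>tpow S m\<^esub> y) \<otimes>\<^bsub>tpow S N\<^esub> u =
      inv\<^bsub>tpow S N\<^esub> u \<otimes>\<^bsub>tpow S N\<^esub> f x \<otimes>\<^bsub>tpow S N\<^esub> u \<oplus>\<^bsub>tpow S N\<^esub>
      inv\<^bsub>tpow S N\<^esub> u \<otimes>\<^bsub>tpow S N\<^esub> f y \<otimes>\<^bsub>tpow S N\<^esub> u"
    using x y c by (simp add: alg_hom_add[OF f] A.l_distr A.r_distr)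
  show "inv\<^bsub>tpow S N\<^esub> u \<otimes>\<^bsub>tpow S N\<^esub> f (x \<otimes>\<^bsub>tpow S m\<^esub> y) \<otimes>\<^bsub>tpow S N\<^esub> u =
      (inv\<^bsub>tpow S N\<^esub> u \<otimes>\<^bsub>tpow S N\<^esub> f x \<otimes>\<^bsub>tpow S N\<^esub> u) \<otimes>\<^bsub>tpow S N\<^esub>
      (inv\<^bsub>tpow S N\<^esub> u \<otimes>\<^bsub>tpow S N\<^esub> f y \<otimes>\<^bsub>tpow S N\<^esub> u)"
    using x y c u by (simp add: alg_hom_mult[OF f] A.m_assoc A.Units_cancel_left)
next
  note c = alg_hom_closed[OF f] A.Units_closed[OF u] A.Units_inv_closed[OF u]
  show "inv\<^bsub>tpow S N\<^esub> u \<otimes>\<^bsub>tpow S N\<^esub> f x \<otimes>\<^bsub>tpow S N\<^esub> u \<in> carrier (tpow S N)"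
    if "x \<in> carrier (tpow S m)" for x using that c by simp
  show "inv\<^bsub>tpow S N\<^esub> u \<otimes>\<^bsub>tpow S N\<^esub> f \<one>\<^bsub>tpow S m\<^esub> \<otimes>\<^bsub>tpow S N\<^esub> u = \<one>\<^bsub>tpow S N\<^esub>"
    using u c by (simp add: alg_hom_one[OF f])
  show "inv\<^bsub>tpow S N\<^esub> u \<otimes>\<^bsub>tpow S N\<^esub> f (a \<odot>\<^bsub>tpow S m\<^esub> x) \<otimes>\<^bsub>tpow S N\<^esub> u =
      a \<odot>\<^bsub>tpow S N\<^esub> (inv\<^bsub>tpow S N\<^esub> u \<otimes>\<^bsub>tpow S N\<^esub> f x \<otimes>\<^bsub>tpow S N\<^esub> u)"
    if "a \<in> carrier (scalars S)" "x \<in> carrier (tpow S m)" for a x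
    using that c by (simp add: alg_hom_smult[OF f] A.smult_mult_left A.smult_mult_right)
qed

context topological_bialgebra
begin

text \<open>All structure maps are algebra homomorphisms, so conjugations that occur along a
  composition can be pushed to its end. A conjugation by \<open>u\<close> followed by the twisted
  comultiplication becomes conjugation by the coproduct of \<open>u\<close> times \<open>J\<close>
  in the new pair of positions.\<close>

lemma structure_map_twist:
  assumes J: "J \<in> Units (tpow S 2)" and "structure_map (twist S J) m N f"
  shows "\<exists>g u. structure_map S m N g \<and> u \<in> Units (tpow S N) \<and>
    (\<forall>x \<in> carrier (tpow S m). f x = inv\<^bsub>tpow S N\<^esub> u \<otimes>\<^bsub>tpow S N\<^esub> g x \<otimes>\<^bsub>tpow S N\<^esub> u)"
  using assms(2)
proof (induction rule: structure_map.induct)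
  case ident
  show ?case
    by (intro exI[of _ "\<lambda>x. x"] exI[of _ "\<one>\<^bsub>tpow S m\<^esub>"]) (auto intro: structure_map.ident)
next
  case (leg ps f N)
  then obtain g u where g: "structure_map S m (length ps) g" "u \<in> Units (tpow S (length ps))"
    and f: "\<And>x. x \<in> carrier (tpow S m) \<Longrightarrow>
      f x = inv\<^bsub>tpow S (length ps)\<^esub> u \<otimes>\<^bsub>tpow S (length ps)\<^esub> g x \<otimes>\<^bsub>tpow S (length ps)\<^esub> u"
    by blast
  show ?case
    using alg_hom_conj[OF leg_hom[OF leg(2)] g(2) _ A.monoid_axioms A.monoid_axioms] f
      leg_Units[OF leg(2) refl g(2)] alg_hom_closed[OF structure_map_hom[OF g(1)]]
    by (intro exI[of _ "\<lambda>x. leg S N ps (g x)"] exI[of _ "leg S N ps u"])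
      (auto intro: structure_map.leg[OF g(1) leg(2)])
next
  case (cop N f i)
  then obtain g u where g: "structure_map S m N g" "u \<in> Units (tpow S N)"
    and f: "\<And>x. x \<in> carrier (tpow S m) \<Longrightarrow> f x = inv\<^bsub>tpow S N\<^esub> u \<otimes>\<^bsub>tpow S N\<^esub> g x \<otimes>\<^bsub>tpow S N\<^esub> u"
    by blast
  let ?J = "leg S (N + 1) [i, i + 1] J"
  have J': "?J \<in> Units (tpow S (N + 1))"
    by (rule leg_Units[OF _ _ J]) (use cop(2,3) in \<open>auto simp: positions_def\<close>)
  note h = cop_hom[OF cop(2,3)]
  have u': "cop S N i u \<in> Units (tpow S (N + 1))" by (rule alg_hom_Units[OF h g(2)])
  have "cop (twist S J) N i (f x) = inv\<^bsub>tpow S (N + 1)\<^esub> (cop S N i u \<otimes>\<^bsub>tpow S (N + 1)\<^esub> ?J)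
      \<otimes>\<^bsub>tpow S (N + 1)\<^esub> cop S N i (g x) \<otimes>\<^bsub>tpow S (N + 1)\<^esub> (cop S N i u \<otimes>\<^bsub>tpow S (N + 1)\<^esub> ?J)"
    if x: "x \<in> carrier (tpow S m)" for x
  proof -
    have gx: "g x \<in> carrier (tpow S N)" using alg_hom_closed[OF structure_map_hom[OF g(1)] x] .
    show ?thesis
      using alg_hom_conj[OF h g(2) gx A.monoid_axioms A.monoid_axioms]
        A.conj_conj[OF u' J' alg_hom_closed[OF h gx]]
      by (simp add: twist_def f[OF x])
  qed
  then show ?case
    using u' J' by (intro exI[of _ "\<lambda>x. cop S N i (g x)"] exI[of _ "cop S N i u \<otimes>\<^bsub>tpow S (N + 1)\<^esub> ?J"])
      (auto intro: structure_map.cop[OF g(1) cop(2,3)])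
next
  case (cou N f i)
  then obtain g u where g: "structure_map S m N g" "u \<in> Units (tpow S N)"
    and f: "\<And>x. x \<in> carrier (tpow S m) \<Longrightarrow> f x = inv\<^bsub>tpow S N\<^esub> u \<otimes>\<^bsub>tpow S N\<^esub> g x \<otimes>\<^bsub>tpow S N\<^esub> u"
    by blast
  note h = cou_hom[OF cou(2,3)]
  show ?case
    using alg_hom_conj[OF h g(2) _ A.monoid_axioms A.monoid_axioms] f
      alg_hom_Units[OF h g(2)] alg_hom_closed[OF structure_map_hom[OF g(1)]]
    by (intro exI[of _ "\<lambda>x. cou S N i (g x)"] exI[of _ "cou S N i u"])
      (auto intro: structure_map.cou[OF g(1) cou(2,3)])
qed

lemma completed_tensor_powers_twist: "completed_tensor_powers (twist S J)"
proof (rule completed_tensor_powers.intro, unfold twist_simps multilinear_form_def linear_form_on_tensors_def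
    tensors_twist pure_tensor_twist)
  show "\<exists>g. (\<forall>x \<in> tensors S m. g x \<in> carrier (scalars S) \<and>
        (\<forall>y \<in> tensors S m. g (x \<oplus>\<^bsub>tpow S m\<^esub> y) = g x \<oplus>\<^bsub>scalars S\<^esub> g y) \<and>
        (\<forall>a \<in> carrier (scalars S). g (a \<odot>\<^bsub>tpow S m\<^esub> x) = a \<otimes>\<^bsub>scalars S\<^esub> g x)) \<and>
      (\<forall>hs. length hs = m \<and> set hs \<subseteq> base S \<longrightarrow> g (pure_tensor S hs) = f hs)"
    if "\<forall>hs. length hs = m \<and> set hs \<subseteq> base S \<longrightarrow>
        f hs \<in> carrier (scalars S) \<and>
        (\<forall>i < m. \<forall>x \<in> base S. \<forall>y \<in> base S.
           f (hs[i := x \<oplus>\<^bsub>tpow S 1\<^esub> y]) = f (hs[i := x]) \<oplus>\<^bsub>scalars S\<^esub> f (hs[i := y])) \<and>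
        (\<forall>i < m. \<forall>x \<in> base S. \<forall>a \<in> carrier (scalars S).
           f (hs[i := a \<odot>\<^bsub>tpow S 1\<^esub> x]) = a \<otimes>\<^bsub>scalars S\<^esub> f (hs[i := x]))" for m f
    using tensors_free[of m f] that unfolding multilinear_form_def linear_form_on_tensors_def by blast
qed (fact field char_zero algebras base leg_hom leg_id leg_leg leg_commute)+

lemma comult_twist:
  assumes "J \<in> carrier (tpow S 2)"
  shows "comult (twist S J) b = inv\<^bsub>tpow S 2\<^esub> J \<otimes>\<^sub>2 comult S b \<otimes>\<^sub>2 J"
  using assms by (simp add: twist_def)

text \<open>The cocycle equation yields coassociativity, the normalisation of \<open>J\<close>
  yields the counit axioms, and \<open>structure_map_twist\<close> transports
  \<open>extend\<close>.\<close>

lemma topological_bialgebra_twist: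
  assumes J: "J \<in> Units (tpow S 2)"
    and coc: "cop S 2 1 J \<otimes>\<^sub>3 leg S 3 [1, 2] J = cop S 2 2 J \<otimes>\<^sub>3 leg S 3 [2, 3] J"
    and eps: "cou S 2 1 J = \<one>\<^bsub>tpow S 1\<^esub>" "cou S 2 2 J = \<one>\<^bsub>tpow S 1\<^esub>"
  shows "topological_bialgebra (twist S J)"
proof -
  have Jc: "J \<in> carrier (tpow S 2)" using J by (rule A.Units_closed)
  have J': "leg S (N + 1) [i, i + 1] J \<in> Units (tpow S (N + 1))" if "1 \<le> i" "i \<le> N" for N i
    by (rule leg_Units[OF _ _ J]) (use that in \<open>auto simp: positions_def\<close>)
  have J3: "leg S 3 [1, 2] J \<in> Units (tpow S 3)" "leg S 3 [2, 3] J \<in> Units (tpow S 3)"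
    using J'[of 1 2] J'[of 2 2] by simp_all
  have cJ: "cop S 2 1 J \<in> Units (tpow S 3)" "cop S 2 2 J \<in> Units (tpow S 3)"
    using alg_hom_Units[OF cop2_hom(1) J] alg_hom_Units[OF cop2_hom(2) J] by simp_all
  have cc: "comult S b \<in> carrier (tpow S 2)" if "b \<in> base S" for b
    using comult_closed[OF base_carrier[OF that]] .
  \<comment> \<open>A factor outside the pair \<open>i, i + 1\<close> commutes with \<open>J\<close>
    in that pair, so conjugation leaves it unchanged.\<close>
  have fix_leg: "inv\<^bsub>tpow S (N + 1)\<^esub> leg S (N + 1) [i, i + 1] J \<otimes>\<^bsub>tpow S (N + 1)\<^esub> leg S (N + 1) [j] b
      \<otimes>\<^bsub>tpow S (N + 1)\<^esub> leg S (N + 1) [i, i + 1] J = leg S (N + 1) [j] b"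
    if "1 \<le> i" "i \<le> N" "b \<in> base S" "1 \<le> j" "j \<le> N + 1" "j \<noteq> i" "j \<noteq> i + 1" for N i j b
  proof -
    have "leg S (N + 1) [j] b \<otimes>\<^bsub>tpow S (N + 1)\<^esub> leg S (N + 1) [i, i + 1] J =
        leg S (N + 1) [i, i + 1] J \<otimes>\<^bsub>tpow S (N + 1)\<^esub> leg S (N + 1) [j] b"
      using that Jc base_carrier leg_commute[of "N + 1" "[j]" "[i, i + 1]" b J] by (simp add: positions_def)
    then show ?thesis
      using J'[OF that(1,2)] that by (simp add: A.m_assoc A.Units_closed A.Units_cancel_left)
  qed
  show ?thesis
  proof (rule topological_bialgebra.intro[OF completed_tensor_powers_twist topological_bialgebra_axioms.intro],
      unfold twist_simps tensors_twist comult_twist[OF Jc])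
    fix i N :: nat assume i: "1 \<le> i" "i \<le> N"
    show "cop (twist S J) N i \<in> alg_hom (scalars S) (tpow S N) (tpow S (N + 1))"
      using alg_hom_conj_by[OF cop_hom[OF i] J'[OF i]] by (simp add: twist_def)
    show "cou S N i \<in> alg_hom (scalars S) (tpow S N) (tpow S (N - 1))"
      by (rule cou_hom[OF i])
    fix j b assume j: "1 \<le> j" "j \<le> N" and b: "b \<in> base S"
    show "cou S N i (leg S N [j] b) =
        (if j < i then leg S (N - 1) [j] b
         else if j = i then leg S (N - 1) [] (counit S b)
         else leg S (N - 1) [j - 1] b)"
      by (rule cou_factor[OF i j b])
    show "cop (twist S J) N i (leg S N [j] b) =
        (if j < i then leg S (N + 1) [j] b
         else if j = i then leg S (N + 1) [i, i + 1] (inv\<^bsub>tpow S 2\<^esub> J \<otimes>\<^sub>2 comult S b \<otimes>\<^sub>2 J)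
         else leg S (N + 1) [j + 1] b)"
    proof -
      have "leg S (N + 1) [i, i + 1] (inv\<^bsub>tpow S 2\<^esub> J \<otimes>\<^sub>2 comult S b \<otimes>\<^sub>2 J) =
          inv\<^bsub>tpow S (N + 1)\<^esub> leg S (N + 1) [i, i + 1] J \<otimes>\<^bsub>tpow S (N + 1)\<^esub> leg S (N + 1) [i, i + 1] (comult S b)
          \<otimes>\<^bsub>tpow S (N + 1)\<^esub> leg S (N + 1) [i, i + 1] J"
        using i J Jc cc[OF b] by (simp add: leg_mult leg_inv positions_def)
      then show ?thesis
        using i j b fix_leg[OF i b, of j] fix_leg[OF i b, of "j + 1"]
        by (auto simp: twist_def cop_factor)
    qed
  next
    fix b assume b: "b \<in> base S"
    show "counit S b \<in> tensors S 0" by (rule counit_scalar[OF b])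
    have t: "cop (twist S J) 2 1 x = inv\<^bsub>tpow S 3\<^esub> leg S 3 [1, 2] J \<otimes>\<^sub>3 cop S 2 1 x \<otimes>\<^sub>3 leg S 3 [1, 2] J"
      "cop (twist S J) 2 2 x = inv\<^bsub>tpow S 3\<^esub> leg S 3 [2, 3] J \<otimes>\<^sub>3 cop S 2 2 x \<otimes>\<^sub>3 leg S 3 [2, 3] J" for x
      by (simp_all add: twist_def)
    \<comment> \<open>Each side is an iterated coproduct of \<open>b\<close> conjugated by one side
      of the cocycle equation.\<close>
    show "cop (twist S J) 2 1 (inv\<^bsub>tpow S 2\<^esub> J \<otimes>\<^sub>2 comult S b \<otimes>\<^sub>2 J) =
        cop (twist S J) 2 2 (inv\<^bsub>tpow S 2\<^esub> J \<otimes>\<^sub>2 comult S b \<otimes>\<^sub>2 J)"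
      unfolding t alg_hom_conj[OF cop2_hom(1) J cc[OF b] A.monoid_axioms A.monoid_axioms]
        alg_hom_conj[OF cop2_hom(2) J cc[OF b] A.monoid_axioms A.monoid_axioms]
        A.conj_conj[OF cJ(1) J3(1) cop2_closed(1)[OF cc[OF b]]] A.conj_conj[OF cJ(2) J3(2) cop2_closed(2)[OF cc[OF b]]]
      by (simp only: coc coassoc[OF b])
    have ch: "cou S 2 1 \<in> alg_hom (scalars S) (tpow S 2) (tpow S 1)" "cou S 2 2 \<in> alg_hom (scalars S) (tpow S 2) (tpow S 1)"
      using cou_hom[of 1 2] cou_hom[of 2 2] by simp_all
    show "cou S 2 1 (inv\<^bsub>tpow S 2\<^esub> J \<otimes>\<^sub>2 comult S b \<otimes>\<^sub>2 J) = b"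
      "cou S 2 2 (inv\<^bsub>tpow S 2\<^esub> J \<otimes>\<^sub>2 comult S b \<otimes>\<^sub>2 J) = b"
      using b base_carrier[OF b]
      by (simp_all add: alg_hom_conj[OF ch(1) J cc[OF b] A.monoid_axioms A.monoid_axioms]
        alg_hom_conj[OF ch(2) J cc[OF b] A.monoid_axioms A.monoid_axioms] eps counit_left counit_right)
  next
    fix m N f g u y
    assume f: "structure_map (twist S J) m N f" and g: "structure_map (twist S J) m N g"
      and u: "u \<in> carrier (tpow S N)" and y: "y \<in> carrier (tpow S m)"
      and eq: "\<And>x. x \<in> tensors S m \<Longrightarrow> f x \<otimes>\<^bsub>tpow S N\<^esub> u = u \<otimes>\<^bsub>tpow S N\<^esub> g x"
    obtain f' a where f': "structure_map S m N f'" "a \<in> Units (tpow S N)"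
      "\<And>x. x \<in> carrier (tpow S m) \<Longrightarrow> f x = inv\<^bsub>tpow S N\<^esub> a \<otimes>\<^bsub>tpow S N\<^esub> f' x \<otimes>\<^bsub>tpow S N\<^esub> a"
      using structure_map_twist[OF J f] by blast
    obtain g' c where g': "structure_map S m N g'" "c \<in> Units (tpow S N)"
      "\<And>x. x \<in> carrier (tpow S m) \<Longrightarrow> g x = inv\<^bsub>tpow S N\<^esub> c \<otimes>\<^bsub>tpow S N\<^esub> g' x \<otimes>\<^bsub>tpow S N\<^esub> c"
      using structure_map_twist[OF J g] by blast
    \<comment> \<open>This element intertwines \<open>f'\<close> and \<open>g'\<close> exactly when
      \<open>u\<close> intertwines \<open>f\<close> and \<open>g\<close>.\<close>
    let ?v = "a \<otimes>\<^bsub>tpow S N\<^esub> u \<otimes>\<^bsub>tpow S N\<^esub> inv\<^bsub>tpow S N\<^esub> c"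
    have iff: "f x \<otimes>\<^bsub>tpow S N\<^esub> u = u \<otimes>\<^bsub>tpow S N\<^esub> g x \<longleftrightarrow> f' x \<otimes>\<^bsub>tpow S N\<^esub> ?v = ?v \<otimes>\<^bsub>tpow S N\<^esub> g' x"
      if "x \<in> carrier (tpow S m)" for x
      unfolding f'(3)[OF that] g'(3)[OF that]
      using that u alg_hom_closed[OF structure_map_hom[OF f'(1)]] alg_hom_closed[OF structure_map_hom[OF g'(1)]]
      by (intro A.conj_intertwine_iff[OF f'(2) g'(2)]) auto
    have "f' y \<otimes>\<^bsub>tpow S N\<^esub> ?v = ?v \<otimes>\<^bsub>tpow S N\<^esub> g' y"
    proof (rule extend[OF f'(1) g'(1) _ _ y])
      show "?v \<in> carrier (tpow S N)" using u f'(2) g'(2) by (simp add: A.Units_closed)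
      show "f' x \<otimes>\<^bsub>tpow S N\<^esub> ?v = ?v \<otimes>\<^bsub>tpow S N\<^esub> g' x" if "x \<in> tensors S m" for x
        using iff[OF tensors_closed[OF that]] eq[OF that] by simp
    qed
    then show "f y \<otimes>\<^bsub>tpow S N\<^esub> u = u \<otimes>\<^bsub>tpow S N\<^esub> g y"
      using iff[OF y] by simp
  qed
qed

text \<open>Both comultiplication rules are instances of \<open>twisted_R_matrix_aux\<close>; in the
  second one the two sides of the cocycle equation exchange their roles.\<close>

lemma R_matrix_twist:
  assumes J: "J \<in> Units (tpow S 2)"
    and coc: "cop S 2 1 J \<otimes>\<^sub>3 leg S 3 [1, 2] J = cop S 2 2 J \<otimes>\<^sub>3 leg S 3 [2, 3] J"
    and eps: "cou S 2 1 J = \<one>\<^bsub>tpow S 1\<^esub>" "cou S 2 2 J = \<one>\<^bsub>tpow S 1\<^esub>"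
    and R: "R_matrix S R"
  shows "R_matrix (twist S J) (inv\<^bsub>tpow S 2\<^esub> (leg S 2 [2, 1] J) \<otimes>\<^sub>2 R \<otimes>\<^sub>2 J)"
proof -
  have Jc: "J \<in> carrier (tpow S 2)" using J by (rule A.Units_closed)
  note Rc = R_matrix_closed[OF R] and Ru = R_matrix_Units[OF R]
  let ?F = "leg S 2 [2, 1] J"
  let ?R = "inv\<^bsub>tpow S 2\<^esub> ?F \<otimes>\<^sub>2 R \<otimes>\<^sub>2 J"
  let ?J = "\<lambda>i j. leg S 3 [i, j] J" and ?Q = "\<lambda>i j. leg S 3 [i, j] R"
  let ?a = "\<lambda>i j k. leg S 3 [i, j, k] (cop S 2 1 J)" and ?c = "\<lambda>i j k. leg S 3 [i, j, k] (cop S 2 2 J)"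
  interpret T: topological_bialgebra "twist S J"
    by (rule topological_bialgebra_twist[OF J coc eps])
  have F: "?F \<in> Units (tpow S 2)" by (rule leg_Units[OF _ _ J]) (simp_all add: positions_def)
  have Fc: "?F \<in> carrier (tpow S 2)" using F by (rule A.Units_closed)
  have Ru': "?R \<in> Units (tpow S 2)" using J F Ru by simp
  have cJ: "cop S 2 1 J \<in> carrier (tpow S 3)" "cop S 2 2 J \<in> carrier (tpow S 3)"
    using cop2_closed Jc by simp_all
  have cU: "cop S 2 1 J \<in> Units (tpow S 3)" "cop S 2 2 J \<in> Units (tpow S 3)"
    using alg_hom_Units[OF cop2_hom(1) J] alg_hom_Units[OF cop2_hom(2) J] by simp_all
  have JU: "?J i j \<in> Units (tpow S 3)" and RU: "?Q i j \<in> Units (tpow S 3)" if "positions 3 [i, j]" for i j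
    using leg_Units[OF that _ J] leg_Units[OF that _ Ru] by simp_all
  note JC = A.Units_closed[OF JU] and RC = A.Units_closed[OF RU]
  have aU: "?a i j k \<in> Units (tpow S 3)" and cU': "?c i j k \<in> Units (tpow S 3)" if "positions 3 [i, j, k]" for i j k
    using leg_Units[OF that _ cU(1)] leg_Units[OF that _ cU(2)] by simp_all
  have lR: "leg S 3 [i, j] ?R = inv\<^bsub>tpow S 3\<^esub> (?J j i) \<otimes>\<^sub>3 ?Q i j \<otimes>\<^sub>3 ?J i j" if p: "positions 3 [i, j]" for i j
    using leg_mult[OF p] leg_inv[OF p _ F] leg3_leg2[OF p, of 2 1 J] Jc Rc F J
    by (simp add: positions_def A.Units_inv_closed)
  \<comment> \<open>The cocycle equation with its three factors moved to the positions
    \<open>i, j, k\<close>.\<close>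
  have perm: "?a i j k \<otimes>\<^sub>3 ?J i j = ?c i j k \<otimes>\<^sub>3 ?J j k" if p: "positions 3 [i, j, k]" for i j k
  proof -
    have "leg S 3 [i, j, k] (cop S 2 1 J \<otimes>\<^sub>3 ?J 1 2) = leg S 3 [i, j, k] (cop S 2 2 J \<otimes>\<^sub>3 ?J 2 3)"
      by (simp only: coc)
    then show ?thesis
      using leg_mult[OF p] cJ JC leg3_leg3[OF p, of "[1, 2]" J] leg3_leg3[OF p, of "[2, 3]" J] Jc
      by (simp add: positions_def)
  qed
  have int1: "?a j i k \<otimes>\<^sub>3 ?Q i j = ?Q i j \<otimes>\<^sub>3 ?a i j k" if p: "positions 3 [i, j, k]" for i j k
  proof -
    have "leg S 3 [i, j, k] (?a 2 1 3 \<otimes>\<^sub>3 ?Q 1 2) = leg S 3 [i, j, k] (?Q 1 2 \<otimes>\<^sub>3 cop S 2 1 J)"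
      by (simp only: R_matrix_intertwine[OF R Jc])
    then show ?thesis
      using leg_mult[OF p] cJ RC leg3_leg3[OF p, of "[1, 2]" R] leg3_leg3[OF p, of "[2, 1, 3]" "cop S 2 1 J"] Rc
      by (simp add: positions_def)
  qed
  have int2: "?c i k j \<otimes>\<^sub>3 ?Q j k = ?Q j k \<otimes>\<^sub>3 ?c i j k" if p: "positions 3 [i, j, k]" for i j k
  proof -
    have "leg S 3 [i, j, k] (?c 1 3 2 \<otimes>\<^sub>3 ?Q 2 3) = leg S 3 [i, j, k] (?Q 2 3 \<otimes>\<^sub>3 cop S 2 2 J)"
      by (simp only: R_matrix_intertwine[OF R Jc])
    then show ?thesis
      using leg_mult[OF p] cJ RC leg3_leg3[OF p, of "[2, 3]" R] leg3_leg3[OF p, of "[1, 3, 2]" "cop S 2 2 J"] Rc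
      by (simp add: positions_def)
  qed
  have id123: "leg S 3 [1, 2, 3] x = x" if "x \<in> carrier (tpow S 3)" for x
    using leg_id[OF that] by (simp add: upt_conv_Cons)
  have copR: "cop S 2 1 ?R = inv\<^bsub>tpow S 3\<^esub> (?c 3 1 2) \<otimes>\<^sub>3 (?Q 1 3 \<otimes>\<^sub>3 ?Q 2 3) \<otimes>\<^sub>3 cop S 2 1 J"
    "cop S 2 2 ?R = inv\<^bsub>tpow S 3\<^esub> (?a 2 3 1) \<otimes>\<^sub>3 (?Q 1 3 \<otimes>\<^sub>3 ?Q 1 2) \<otimes>\<^sub>3 cop S 2 2 J"
    using F Fc Jc Rc
    by (simp_all add: alg_hom_mult[OF cop2_hom(1)] alg_hom_mult[OF cop2_hom(2)]
        alg_hom_inv[OF cop2_hom(1) F A.monoid_axioms A.monoid_axioms]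
        alg_hom_inv[OF cop2_hom(2) F A.monoid_axioms A.monoid_axioms]
        cop_21 R_matrix_cop1[OF R] R_matrix_cop2[OF R])
  show ?thesis
  proof (rule T.R_matrixI; unfold twist_simps comult_twist[OF Jc])
    show "?R \<in> Units (tpow S 2)" by (rule Ru')
    fix b assume b: "b \<in> base S"
    have c: "comult S b \<in> carrier (tpow S 2)" "leg S 2 [2, 1] (comult S b) \<in> carrier (tpow S 2)"
      using comult_closed[OF base_carrier[OF b]] by (auto simp: positions_def)
    let ?X = "leg S 2 [2, 1] (comult S b)"
    have "leg S 2 [2, 1] (inv\<^bsub>tpow S 2\<^esub> J \<otimes>\<^sub>2 comult S b \<otimes>\<^sub>2 J) \<otimes>\<^sub>2 ?R =
        inv\<^bsub>tpow S 2\<^esub> ?F \<otimes>\<^sub>2 ?X \<otimes>\<^sub>2 ?F \<otimes>\<^sub>2 ?R"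
      using c Jc J by (simp add: leg_mult leg_inv positions_def)
    also have "\<dots> = inv\<^bsub>tpow S 2\<^esub> ?F \<otimes>\<^sub>2 (?X \<otimes>\<^sub>2 R) \<otimes>\<^sub>2 J"
      using c F Fc Rc Jc by (simp add: A.m_assoc A.Units_cancel_left)
    also have "\<dots> = inv\<^bsub>tpow S 2\<^esub> ?F \<otimes>\<^sub>2 (R \<otimes>\<^sub>2 comult S b) \<otimes>\<^sub>2 J"
      by (simp only: R_matrix_comult[OF R b])
    also have "\<dots> = ?R \<otimes>\<^sub>2 (inv\<^bsub>tpow S 2\<^esub> J \<otimes>\<^sub>2 comult S b \<otimes>\<^sub>2 J)"
      using c F Fc Rc Jc J by (simp add: A.m_assoc A.Units_cancel_left)
    finally show "leg S 2 [2, 1] (inv\<^bsub>tpow S 2\<^esub> J \<otimes>\<^sub>2 comult S b \<otimes>\<^sub>2 J) \<otimes>\<^sub>2 ?R =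
        ?R \<otimes>\<^sub>2 (inv\<^bsub>tpow S 2\<^esub> J \<otimes>\<^sub>2 comult S b \<otimes>\<^sub>2 J)" .
  next
    have "cop (twist S J) 2 1 ?R = inv\<^bsub>tpow S 3\<^esub> (?J 1 2) \<otimes>\<^sub>3 cop S 2 1 ?R \<otimes>\<^sub>3 ?J 1 2"
      by (simp add: twist_def)
    also have "\<dots> = (inv\<^bsub>tpow S 3\<^esub> (?J 3 1) \<otimes>\<^sub>3 ?Q 1 3 \<otimes>\<^sub>3 ?J 1 3) \<otimes>\<^sub>3 (inv\<^bsub>tpow S 3\<^esub> (?J 3 2) \<otimes>\<^sub>3 ?Q 2 3 \<otimes>\<^sub>3 ?J 2 3)"
      unfolding copR
    proof (rule A.twisted_R_matrix_aux)
      show "?a 3 1 2 \<otimes>\<^sub>3 ?J 3 1 = ?c 3 1 2 \<otimes>\<^sub>3 ?J 1 2" by (rule perm) (simp add: positions_def)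
      show "?a 1 3 2 \<otimes>\<^sub>3 ?J 1 3 = ?c 1 3 2 \<otimes>\<^sub>3 ?J 3 2" by (rule perm) (simp add: positions_def)
      show "?c 1 3 2 \<otimes>\<^sub>3 ?Q 2 3 = ?Q 2 3 \<otimes>\<^sub>3 cop S 2 2 J" by (rule R_matrix_intertwine[OF R Jc])
      show "?a 3 1 2 \<otimes>\<^sub>3 ?Q 1 3 = ?Q 1 3 \<otimes>\<^sub>3 ?a 1 3 2" by (rule int1) (simp add: positions_def)
    qed (use aU cU' JU JC RC cJ coc in \<open>auto simp: positions_def\<close>)
    also have "\<dots> = leg S 3 [1, 3] ?R \<otimes>\<^sub>3 leg S 3 [2, 3] ?R"
      by (simp add: lR positions_def)
    finally show "cop (twist S J) 2 1 ?R = leg S 3 [1, 3] ?R \<otimes>\<^sub>3 leg S 3 [2, 3] ?R" .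
    have "cop (twist S J) 2 2 ?R = inv\<^bsub>tpow S 3\<^esub> (?J 2 3) \<otimes>\<^sub>3 cop S 2 2 ?R \<otimes>\<^sub>3 ?J 2 3"
      by (simp add: twist_def)
    also have "\<dots> = (inv\<^bsub>tpow S 3\<^esub> (?J 3 1) \<otimes>\<^sub>3 ?Q 1 3 \<otimes>\<^sub>3 ?J 1 3) \<otimes>\<^sub>3 (inv\<^bsub>tpow S 3\<^esub> (?J 2 1) \<otimes>\<^sub>3 ?Q 1 2 \<otimes>\<^sub>3 ?J 1 2)"
      unfolding copR
    proof (rule A.twisted_R_matrix_aux)
      show "?c 2 3 1 \<otimes>\<^sub>3 ?J 3 1 = ?a 2 3 1 \<otimes>\<^sub>3 ?J 2 3" by (rule perm[symmetric]) (simp add: positions_def)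
      show "?c 2 1 3 \<otimes>\<^sub>3 ?J 1 3 = ?a 2 1 3 \<otimes>\<^sub>3 ?J 2 1" by (rule perm[symmetric]) (simp add: positions_def)
      show "?a 2 1 3 \<otimes>\<^sub>3 ?Q 1 2 = ?Q 1 2 \<otimes>\<^sub>3 cop S 2 1 J" by (rule R_matrix_intertwine[OF R Jc])
      show "?c 2 3 1 \<otimes>\<^sub>3 ?Q 1 3 = ?Q 1 3 \<otimes>\<^sub>3 ?c 2 1 3" by (rule int2) (simp add: positions_def)
    qed (use aU cU' JU JC RC cJ coc in \<open>auto simp: positions_def\<close>)
    also have "\<dots> = leg S 3 [1, 3] ?R \<otimes>\<^sub>3 leg S 3 [1, 2] ?R"
      by (simp add: lR positions_def)
    finally show "cop (twist S J) 2 2 ?R = leg S 3 [1, 3] ?R \<otimes>\<^sub>3 leg S 3 [1, 2] ?R" .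
  qed
qed

end



section \<open>Tensor powers of a bialgebra\<close>

lemma (in monoid) list_prod_concat:
  "(\<And>xs. xs \<in> set xss \<Longrightarrow> set xs \<subseteq> carrier G) \<Longrightarrow>
   list_prod G (concat xss) = list_prod G (map (list_prod G) xss)"
proof (induction xss)
  case (Cons xs xss)
  have "set (concat xss) \<subseteq> carrier G" using Cons.prems by auto
  then show ?case using Cons by (simp add: list_prod_append)
qed simp

context leg_system
begin

lemma pure_tensor_add:
  assumes "set hs \<subseteq> carrier (tpow S 1)" "k < length hs" "x \<in> carrier (tpow S 1)" "y \<in> carrier (tpow S 1)"
  shows "pure_tensor S (hs[k := x \<oplus>\<^bsub>tpow S 1\<^esub> y]) =
    pure_tensor S (hs[k := x]) \<oplus>\<^bsub>tpow S (length hs)\<^esub> pure_tensor S (hs[k := y])"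
proof -
  obtain p q where "p \<in> carrier (tpow S (length hs))" "q \<in> carrier (tpow S (length hs))"
    "\<And>x. x \<in> carrier (tpow S 1) \<Longrightarrow> pure_tensor S (hs[k := x]) =
      p \<otimes>\<^bsub>tpow S (length hs)\<^esub> leg S (length hs) [k + 1] x \<otimes>\<^bsub>tpow S (length hs)\<^esub> q"
    by (rule pure_tensor_update[OF assms(1) refl assms(2)]) (rule that)
  then show ?thesis using assms by (simp add: leg_add A.l_distr A.r_distr)
qed

lemma pure_tensor_smult:
  assumes "set hs \<subseteq> carrier (tpow S 1)" "k < length hs" "a \<in> carrier (scalars S)" "x \<in> carrier (tpow S 1)"
  shows "pure_tensor S (hs[k := a \<odot>\<^bsub>tpow S 1\<^esub> x]) = a \<odot>\<^bsub>tpow S (length hs)\<^esub> pure_tensor S (hs[k := x])"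
proof -
  obtain p q where "p \<in> carrier (tpow S (length hs))" "q \<in> carrier (tpow S (length hs))"
    "\<And>x. x \<in> carrier (tpow S 1) \<Longrightarrow> pure_tensor S (hs[k := x]) =
      p \<otimes>\<^bsub>tpow S (length hs)\<^esub> leg S (length hs) [k + 1] x \<otimes>\<^bsub>tpow S (length hs)\<^esub> q"
    by (rule pure_tensor_update[OF assms(1) refl assms(2)]) (rule that)
  then show ?thesis
    using assms by (simp add: leg_smult A.smult_mult_left A.smult_mult_right)
qed

end

section \<open>Blocks of consecutive positions\<close>

lemma tensor_power_simps [simp]:
  "scalars (tensor_power n S) = scalars S" "base (tensor_power n S) = tensors S n"
  "tpow (tensor_power n S) m = tpow S (n * m)"
  "leg (tensor_power n S) N ps = leg S (n * N) (concat (map (block n) ps))"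
  by (simp_all add: tensor_power_def)

lemma length_block [simp]: "1 \<le> i \<Longrightarrow> length (block n i) = n"
  by (cases i) (simp_all add: block_def)

lemma nth_block [simp]: "1 \<le> i \<Longrightarrow> s < n \<Longrightarrow> block n i ! s = (i - 1) * n + s + 1"
  by (cases i) (simp_all add: block_def)

lemma set_block: "1 \<le> i \<Longrightarrow> set (block n i) = {(i - 1) * n + 1..i * n}"
  by (simp add: block_def)

lemma distinct_block [simp]: "distinct (block n i)"
  by (simp add: block_def)

lemma length_concat_uniform: "(\<And>xs. xs \<in> set xss \<Longrightarrow> length xs = n) \<Longrightarrow> length (concat xss) = n * length xss"
  by (induction xss) (auto simp: algebra_simps)

lemma nth_concat_uniform:
  "(\<And>xs. xs \<in> set xss \<Longrightarrow> length xs = n) \<Longrightarrow> r < length xss \<Longrightarrow> s < n \<Longrightarrow> concat xss ! (r * n + s) = xss ! r ! s"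
proof (induction xss arbitrary: r)
  case (Cons xs xss)
  then show ?case by (cases r) (auto simp: nth_append)
qed simp

lemma take_drop_concat_uniform:
  assumes "\<And>xs. xs \<in> set xss \<Longrightarrow> length xs = n" "r < length xss"
  shows "take n (drop (r * n) (concat xss)) = xss ! r"
proof (rule nth_equalityI)
  have l: "length (concat xss) = n * length xss" by (rule length_concat_uniform[OF assms(1)])
  have "r * n + n = (r + 1) * n" by (simp only: add_mult_distrib mult_1)
  also have "\<dots> \<le> length xss * n" using assms(2) by (intro mult_le_mono1) simp
  also have "\<dots> = length (concat xss)" unfolding l by (rule mult.commute)
  finally have rn: "r * n + n \<le> length (concat xss)" .
  moreover have "length (xss ! r) = n" using assms by simp
  ultimately show len: "length (take n (drop (r * n) (concat xss))) = length (xss ! r)" by simp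
  fix s assume "s < length (take n (drop (r * n) (concat xss)))"
  then have "s < n" by simp
  moreover have "r * n \<le> length (concat xss)" using rn by simp
  ultimately show "take n (drop (r * n) (concat xss)) ! s = xss ! r ! s"
    using nth_concat_uniform[OF assms] by simp
qed

lemma concat_blocks_upt: "concat (map (block n) [1..<m + 1]) = [1..<n * m + 1]"
proof (induction m)
  case (Suc m)
  have "[1..<Suc m + 1] = [1..<m + 1] @ [m + 1]" by (simp add: upt_Suc)
  then have "concat (map (block n) [1..<Suc m + 1]) = concat (map (block n) [1..<m + 1]) @ block n (m + 1)"
    by simp
  also have "\<dots> = [1..<n * m + 1] @ [n * m + 1..<(n * m + 1) + n]"
    unfolding Suc by (simp add: block_def algebra_simps)
  also have "\<dots> = [1..<(n * m + 1) + n]" by (rule upt_add_eq_append[symmetric]) simp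
  finally show ?case by (simp add: algebra_simps)
qed (simp add: block_def)

text \<open>Positions count from 1, so division with remainder is applied to
  \<open>k - 1\<close>.\<close>

lemma block_indexE:
  fixes k n N :: nat
  assumes "1 \<le> k" "k \<le> n * N"
  obtains i s where "1 \<le> i" "i \<le> N" "1 \<le> s" "s \<le> n" "k = (i - 1) * n + s" "(k - 1) div n = i - 1"
proof
  have n: "n > 0" using assms by (cases n) auto
  let ?q = "(k - 1) div n" and ?r = "(k - 1) mod n"
  have "?q < N" using assms n by (intro less_mult_imp_div_less) (simp add: mult.commute)
  then show "1 \<le> ?q + 1" "?q + 1 \<le> N" by simp_all
  show "1 \<le> ?r + 1" by simp
  have "?r < n" using n by simp
  then show "?r + 1 \<le> n" by simp
  have "k - 1 = ?q * n + ?r" by simp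
  then show "k = (?q + 1 - 1) * n + (?r + 1)" using assms(1) by (simp del: div_mult_mod_eq)
  show "?q = ?q + 1 - 1" by simp
qed

locale bialgebra_power = topological_bialgebra S for S :: "('k, 'a) tensor_system" +
  fixes n :: nat
  assumes n_pos: "n \<ge> 1"
begin

abbreviation T :: "('k, 'a) tensor_system" where "T \<equiv> tensor_power n S"

lemma positions_ge_1: "positions N ps \<Longrightarrow> p \<in> set ps \<Longrightarrow> 1 \<le> p \<and> p \<le> N"
  by (auto simp: positions_def)

lemma length_blocks [simp]:
  "positions N ps \<Longrightarrow> length (concat (map (block n) ps)) = n * length ps"
  using length_concat_uniform[of "map (block n) ps" n] positions_ge_1 by fastforce

lemma nth_blocks:
  assumes "positions N ps" "r < length ps" "s < n"
  shows "concat (map (block n) ps) ! (r * n + s) = (ps ! r - 1) * n + s + 1"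
proof -
  have "length (block n p) = n" if "p \<in> set ps" for p
    using positions_ge_1[OF assms(1) that] by simp
  then have "concat (map (block n) ps) ! (r * n + s) = map (block n) ps ! r ! s"
    using assms by (intro nth_concat_uniform) auto
  then show ?thesis using assms positions_ge_1[OF assms(1), of "ps ! r"] by simp
qed

lemma block_index_le:
  assumes "1 \<le> i" "i \<le> N" "1 \<le> s" "s \<le> n"
  shows "1 \<le> (i - 1) * n + s" "(i - 1) * n + s \<le> n * N" "(i - 1) * n + s \<le> i * n"
proof -
  have "(i - 1) * n + n = i * n" using assms(1) by (cases i) auto
  moreover have "i * n \<le> n * N"
    unfolding mult.commute[of n] using assms(2) by (rule mult_le_mono1)
  ultimately show "1 \<le> (i - 1) * n + s" "(i - 1) * n + s \<le> n * N" "(i - 1) * n + s \<le> i * n"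
    using assms(3,4) by linarith+
qed

lemma positions_blocks:
  assumes "positions N ps"
  shows "positions (n * N) (concat (map (block n) ps))"
  unfolding positions_def
proof
  have ne: "block n p \<noteq> []" if "p \<in> set ps" for p
    using positions_ge_1[OF assms that] n_pos length_block[of p n] by force
  have disj: "set (block n p) \<inter> set (block n q) = {}" if "p \<in> set ps" "q \<in> set ps" "p \<noteq> q" for p q
  proof -
    have pq: "1 \<le> p" "1 \<le> q" using that assms positions_ge_1 by auto
    have "p \<le> q - 1 \<or> q \<le> p - 1" using that(3) by linarith
    then have le: "p * n \<le> (q - 1) * n \<or> q * n \<le> (p - 1) * n" by (meson mult_le_mono1)
    have False if "k \<in> set (block n p)" "k \<in> set (block n q)" for k
    proof -
      have "(p - 1) * n + 1 \<le> k" "k \<le> p * n" "(q - 1) * n + 1 \<le> k" "k \<le> q * n"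
        using that unfolding set_block[OF pq(1)] set_block[OF pq(2)] by auto
      then show False using le by linarith
    qed
    then show ?thesis by blast
  qed
  have "inj_on (block n) (set ps)"
  proof (rule inj_onI)
    fix p q assume "p \<in> set ps" "q \<in> set ps" "block n p = block n q"
    then show "p = q" using disj[of p q] ne[of p] by auto
  qed
  then show "distinct (concat (map (block n) ps))"
    using assms disj by (intro distinct_concat) (auto simp: positions_def distinct_map)
  show "set (concat (map (block n) ps)) \<subseteq> {1..n * N}"
  proof
    fix k assume "k \<in> set (concat (map (block n) ps))"
    then obtain p where p: "p \<in> set ps" "k \<in> set (block n p)" by auto
    have p1: "1 \<le> p" "p \<le> N" using positions_ge_1[OF assms p(1)] by auto
    then have "p * n \<le> n * N" unfolding mult.commute[of n] by (intro mult_le_mono1)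
    moreover have "1 \<le> k" "k \<le> p * n" using p(2) unfolding set_block[OF p1(1)] by auto
    ultimately have "1 \<le> k" "k \<le> n * N" by linarith+
    then show "k \<in> {1..n * N}" by simp
  qed
qed

text \<open>Replacing positions by blocks respects composition of position lists; this turns
  \<open>leg_leg\<close> for \<open>S\<close> into \<open>leg_leg\<close> for the tensor
  power.\<close>

lemma blocks_compose:
  assumes "positions N ps" "positions M qs" "length qs = N"
  shows "map (\<lambda>p. concat (map (block n) qs) ! (p - 1)) (concat (map (block n) ps)) =
    concat (map (block n) (map (\<lambda>p. qs ! (p - 1)) ps))"
proof -
  have "map (\<lambda>p. concat (map (block n) qs) ! (p - 1)) (block n p) = block n (qs ! (p - 1))"
    if "p \<in> set ps" for p
  proof (rule nth_equalityI)
    have p: "1 \<le> p" "p \<le> N" using positions_ge_1[OF assms(1) that] by auto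
    have q: "1 \<le> qs ! (p - 1)" using positions_ge_1[OF assms(2), of "qs ! (p - 1)"] p assms(3) by simp
    show "length (map (\<lambda>p. concat (map (block n) qs) ! (p - 1)) (block n p)) = length (block n (qs ! (p - 1)))"
      using p q by simp
    fix s assume "s < length (map (\<lambda>p. concat (map (block n) qs) ! (p - 1)) (block n p))"
    then have s: "s < n" using p by simp
    have "map (\<lambda>p. concat (map (block n) qs) ! (p - 1)) (block n p) ! s = concat (map (block n) qs) ! ((p - 1) * n + s)"
      using p s by simp
    also have "\<dots> = (qs ! (p - 1) - 1) * n + s + 1"
      by (rule nth_blocks[OF assms(2) _ s]) (use p assms(3) in auto)
    also have "\<dots> = block n (qs ! (p - 1)) ! s"
      using q s by simp
    finally show "map (\<lambda>p. concat (map (block n) qs) ! (p - 1)) (block n p) ! s = block n (qs ! (p - 1)) ! s" .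
  qed
  then show ?thesis by (simp add: map_concat cong: map_cong)
qed

lemma leg_system_power: "leg_system T"
proof (rule leg_system.intro; unfold tensor_power_simps)
  show "field (scalars S)" by (rule field)
  show "assoc_algebra (scalars S) (tpow S (n * m))" for m by (rule algebras)
  show "unital_subalgebra (scalars S) (tensors S n) (tpow S (n * 1))"
    using unital_subalgebra_tensors[of n] by simp
  show "leg S (n * N) (concat (map (block n) ps)) \<in> alg_hom (scalars S) (tpow S (n * length ps)) (tpow S (n * N))"
    if "positions N ps" for N ps
    using leg_hom[OF positions_blocks[OF that]] that by simp
  show "leg S (n * N) (concat (map (block n) [1..<N + 1])) x = x" if "x \<in> carrier (tpow S (n * N))" for x N
    unfolding concat_blocks_upt by (rule leg_id[OF that])
  show "leg S (n * M) (concat (map (block n) qs)) (leg S (n * N) (concat (map (block n) ps)) x) =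
      leg S (n * M) (concat (map (block n) (map (\<lambda>p. qs ! (p - 1)) ps))) x"
    if "positions N ps" "positions M qs" "length qs = N" "x \<in> carrier (tpow S (n * length ps))" for N M ps qs x
    unfolding blocks_compose[OF that(1-3), symmetric]
    by (rule leg_leg) (use that positions_blocks in auto)
  show "leg S (n * N) (concat (map (block n) ps)) x \<otimes>\<^bsub>tpow S (n * N)\<^esub> leg S (n * N) (concat (map (block n) qs)) y =
      leg S (n * N) (concat (map (block n) qs)) y \<otimes>\<^bsub>tpow S (n * N)\<^esub> leg S (n * N) (concat (map (block n) ps)) x"
    if "positions N (ps @ qs)" "x \<in> carrier (tpow S (n * length ps))" "y \<in> carrier (tpow S (n * length qs))" for N ps qs x y
  proof -
    have "positions N ps" "positions N qs" using that(1) by (auto simp: positions_def)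
    then show ?thesis using positions_blocks[OF that(1)] that(2,3) by (intro leg_commute) simp_all
  qed
qed

end



section \<open>Tensors over a tensor power and their freeness\<close>

context bialgebra_power
begin

sublocale P: leg_system T
  by (rule leg_system_power)

lemma leg_block_factor:
  assumes "1 \<le> i" "i \<le> N" "1 \<le> s" "s \<le> n" "b \<in> carrier (tpow S 1)"
  shows "leg S (n * N) (block n i) (leg S n [s] b) = leg S (n * N) [(i - 1) * n + s] b"
proof -
  have "positions (n * N) (block n i)" using positions_blocks[of N "[i]"] assms by simp
  then show ?thesis using leg_leg_factor[of s "block n i" "n * N" b] assms by simp
qed

text \<open>Each side contains the generators of the other: a block embedding of a tensor is a
  tensor, and a factor in position \<open>k\<close> is a factor in some place of one block. The
  equality makes \<open>extend\<close> and \<open>tensors_free\<close> for the two systems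
  statements about the same elements.\<close>

lemma tensors_power: "tensors T m = tensors S (n * m)"
proof (intro equalityI subsetI)
  show "x \<in> tensors S (n * m)" if "x \<in> tensors T m" for x
    using that
  proof (induction rule: P.tensors_factor_induct)
    case (factor k b)
    then show ?case
      using positions_blocks[of m "[k]"] by (auto intro!: leg_tensors)
  qed (auto intro: one_in_tensors tensors_mult tensors.add tensors.smult)
  show "x \<in> tensors T m" if "x \<in> tensors S (n * m)" for x
    using that
  proof (induction rule: tensors_factor_induct)
    case one
    show ?case using P.one_in_tensors[of m] by simp
  next
    case (factor k b)
    obtain i s where k: "1 \<le> i" "i \<le> m" "1 \<le> s" "s \<le> n" "k = (i - 1) * n + s"
      using factor(1,2) by (rule block_indexE) (rule that)
    have "leg T m [i] (leg S n [s] b) \<in> tensors T m"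
      using k factor(3) leg_factor_in_tensors by (intro P.leg_factor_in_tensors) auto
    then show ?case using leg_block_factor[OF k(1-4)] factor(3) k(5) by (simp add: base_carrier)
  next
    case (mult x y)
    then show ?case using P.tensors_mult[of x m y] by simp
  next
    case (add x y)
    then show ?case using tensors.add[of x T m y] by simp
  next
    case (smult a x)
    then show ?case using tensors.smult[of a T x m] by simp
  qed
qed

lemma pure_tensor_concat:
  assumes "length hss = m" "\<And>hs. hs \<in> set hss \<Longrightarrow> length hs = n \<and> set hs \<subseteq> base S"
  shows "pure_tensor T (map (pure_tensor S) hss) = pure_tensor S (concat hss)"
proof -
  let ?hs = "concat hss"
  let ?l = "\<lambda>k. leg S (n * m) [k] (?hs ! (k - 1))"
  have len: "length ?hs = n * m" using length_concat_uniform[of hss n] assms by auto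
  have hb: "?hs ! k \<in> carrier (tpow S 1)" if "k < n * m" for k
  proof -
    have "?hs ! k \<in> set ?hs" using that len by (intro nth_mem) simp
    then obtain hs where "hs \<in> set hss" "?hs ! k \<in> set hs" by auto
    then show ?thesis using assms(2)[of hs] by (intro base_carrier) auto
  qed
  have blk: "leg S (n * m) (block n j) (pure_tensor S (hss ! (j - 1))) = list_prod (tpow S (n * m)) (map ?l (block n j))"
    if j: "1 \<le> j" "j \<le> m" for j
  proof -
    let ?h = "hss ! (j - 1)"
    have h: "length ?h = n" "set ?h \<subseteq> base S" using assms j by auto
    have pb: "positions (n * m) (block n j)" using positions_blocks[of m "[j]"] j by simp
    have hc: "?h ! s \<in> carrier (tpow S 1)" if "s < n" for s
    proof -
      have "?h ! s \<in> set ?h" using h that by simp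
      then show ?thesis using h(2) by (intro base_carrier) auto
    qed
    have c: "set (map (\<lambda>s. leg S n [s] (?h ! (s - 1))) [1..<n + 1]) \<subseteq> carrier (tpow S n)"
      using hc by auto
    have "leg S (n * m) (block n j) (pure_tensor S ?h) =
        list_prod (tpow S (n * m)) (map (\<lambda>s. leg S (n * m) (block n j) (leg S n [s] (?h ! (s - 1)))) [1..<n + 1])"
      using alg_hom_list_prod[OF leg_hom[OF pb], of "map (\<lambda>s. leg S n [s] (?h ! (s - 1))) [1..<n + 1]"] c j h A.monoid_axioms
      by (simp add: pure_tensor_def comp_def)
    also have "map (\<lambda>s. leg S (n * m) (block n j) (leg S n [s] (?h ! (s - 1)))) [1..<n + 1] = map ?l (block n j)"
    proof (rule nth_equalityI)
      show "length (map (\<lambda>s. leg S (n * m) (block n j) (leg S n [s] (?h ! (s - 1)))) [1..<n + 1]) = length (map ?l (block n j))"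
        using j by simp
      fix s assume "s < length (map (\<lambda>s. leg S (n * m) (block n j) (leg S n [s] (?h ! (s - 1)))) [1..<n + 1])"
      then have s: "s < n" by simp
      have "?hs ! ((j - 1) * n + s) = ?h ! s"
        by (rule nth_concat_uniform) (use assms j s in auto)
      then show "map (\<lambda>s. leg S (n * m) (block n j) (leg S n [s] (?h ! (s - 1)))) [1..<n + 1] ! s = map ?l (block n j) ! s"
        using s j leg_block_factor[of j m "s + 1" "?h ! s"] hc by (simp add: add.commute[of 1 s] add.assoc)
    qed
    finally show ?thesis .
  qed
  have "pure_tensor T (map (pure_tensor S) hss) =
      list_prod (tpow S (n * m)) (map (\<lambda>j. leg S (n * m) (block n j) (map (pure_tensor S) hss ! (j - 1))) [1..<m + 1])"
    using assms(1) by (simp add: pure_tensor_def[of T])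
  also have "map (\<lambda>j. leg S (n * m) (block n j) (map (pure_tensor S) hss ! (j - 1))) [1..<m + 1] =
      map (list_prod (tpow S (n * m))) (map (map ?l) (map (block n) [1..<m + 1]))"
    using blk assms(1) by auto
  also have "list_prod (tpow S (n * m)) \<dots> = list_prod (tpow S (n * m)) (concat (map (map ?l) (map (block n) [1..<m + 1])))"
  proof (rule A.list_prod_concat[symmetric])
    fix xs assume "xs \<in> set (map (map ?l) (map (block n) [1..<m + 1]))"
    then obtain j where j: "1 \<le> j" "j \<le> m" "xs = map ?l (block n j)" by auto
    show "set xs \<subseteq> carrier (tpow S (n * m))"
    proof
      fix z assume "z \<in> set xs"
      then obtain k where k: "z = ?l k" "k \<in> set (block n j)" using j by auto
      then have "k \<in> {1..n * m}"
        using positions_blocks[of m "[j]"] j by (auto simp: positions_def)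
      then show "z \<in> carrier (tpow S (n * m))" using k(1) hb[of "k - 1"] by auto
    qed
  qed
  also have "concat (map (map ?l) (map (block n) [1..<m + 1])) = map ?l [1..<n * m + 1]"
    unfolding concat_blocks_upt[symmetric] by (simp only: map_concat)
  finally show ?thesis unfolding pure_tensor_def[of S ?hs] len .
qed

lemma take_drop_update:
  assumes "length hs = n * m" "i < n * m" "r < m"
  shows "take n (drop (r * n) (hs[i := x])) =
    (if i div n = r then (take n (drop (r * n) hs))[i mod n := x] else take n (drop (r * n) hs))"
proof -
  have n: "n > 0" using n_pos by simp
  have i: "i = (i div n) * n + i mod n" "i mod n < n" using n by simp_all
  consider "i div n = r" | "i div n < r" | "r < i div n" by linarith
  then show ?thesis
  proof cases
    case 1
    then have "i - r * n = i mod n" "\<not> i < r * n" using i by (metis add_diff_cancel_left', metis not_add_less1)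
    then show ?thesis using 1 by (simp add: drop_update_swap take_update_swap)
  next
    case 2
    then have "(i div n + 1) * n \<le> r * n" by (intro mult_le_mono1) simp
    moreover have "(i div n + 1) * n = i div n * n + n" by (simp only: add_mult_distrib mult_1)
    ultimately have "i < r * n" using i by linarith
    then show ?thesis using 2 by simp
  next
    case 3
    then have "(r + 1) * n \<le> i div n * n" by (intro mult_le_mono1) simp
    moreover have "(r + 1) * n = r * n + n" by (simp only: add_mult_distrib mult_1)
    ultimately have "r * n + n \<le> i" using i(1) by linarith
    then show ?thesis using 3 by (simp add: drop_update_swap take_update_cancel)
  qed
qed

text \<open>Pulls a form on tuples of tensors back to tuples over \<open>base S\<close> cut into
  chunks of length \<open>n\<close>. The entry with index \<open>i\<close> occurs only in chunk
  \<open>i div n\<close>, whose pure tensor depends linearly on it.\<close>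

lemma multilinear_form_blocks:
  assumes "multilinear_form T m f"
  shows "multilinear_form S (n * m) (\<lambda>hs. f (map (\<lambda>r. pure_tensor S (take n (drop (r * n) hs))) [0..<m]))"
    (is "multilinear_form S _ ?f")
  unfolding multilinear_form_def
proof (intro allI impI)
  fix hs assume hs: "length hs = n * m \<and> set hs \<subseteq> base S"
  let ?c = "\<lambda>r. take n (drop (r * n) hs)"
  let ?F = "map (\<lambda>r. pure_tensor S (?c r)) [0..<m]"
  have c: "length (?c r) = n" "set (?c r) \<subseteq> base S" "set (?c r) \<subseteq> carrier (tpow S 1)" if "r < m" for r
  proof -
    have "(r + 1) * n \<le> m * n" using that by (intro mult_le_mono1) simp
    then show "length (?c r) = n" using hs by (simp add: algebra_simps)
    show "set (?c r) \<subseteq> base S" using hs by (meson order_trans set_drop_subset set_take_subset)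
    then show "set (?c r) \<subseteq> carrier (tpow S 1)" using base_carrier by blast
  qed
  have F: "length ?F = m" "set ?F \<subseteq> base T"
    using c tensors.pure[OF c(1,2)] by auto
  note ml = assms[unfolded multilinear_form_def, rule_format, of ?F, OF conjI[OF F]]
  have upd: "map (\<lambda>r. pure_tensor S (take n (drop (r * n) (hs[i := x])))) [0..<m] =
      ?F[i div n := pure_tensor S ((?c (i div n))[i mod n := x])]" if "i < n * m" for i x
  proof -
    have "i div n < m" using that by (intro less_mult_imp_div_less) (simp add: mult.commute)
    then show ?thesis
      by (intro nth_equalityI) (auto simp: take_drop_update[OF conjunct1[OF hs] that] nth_list_update)
  qed
  have in_t: "pure_tensor S ((?c r)[s := x]) \<in> tensors S n" if "r < m" "x \<in> base S" for r s x
    using c[OF that(1)] that(2) set_update_subset_insert[of "?c r" s x] by (intro tensors.pure) auto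
  show "?f hs \<in> carrier (scalars S) \<and>
      (\<forall>i < n * m. \<forall>x \<in> base S. \<forall>y \<in> base S.
         ?f (hs[i := x \<oplus>\<^bsub>tpow S 1\<^esub> y]) = ?f (hs[i := x]) \<oplus>\<^bsub>scalars S\<^esub> ?f (hs[i := y])) \<and>
      (\<forall>i < n * m. \<forall>x \<in> base S. \<forall>a \<in> carrier (scalars S).
         ?f (hs[i := a \<odot>\<^bsub>tpow S 1\<^esub> x]) = a \<otimes>\<^bsub>scalars S\<^esub> ?f (hs[i := x]))"
  proof (intro conjI allI impI ballI)
    show "?f hs \<in> carrier (scalars S)" using ml by simp
    fix i assume i: "i < n * m"
    have q: "i div n < m" using i by (intro less_mult_imp_div_less) (simp add: mult.commute)
    have r: "i mod n < n" using n_pos by simp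
    fix x assume x: "x \<in> base S"
    show "?f (hs[i := x \<oplus>\<^bsub>tpow S 1\<^esub> y]) = ?f (hs[i := x]) \<oplus>\<^bsub>scalars S\<^esub> ?f (hs[i := y])"
      if y: "y \<in> base S" for y
      unfolding upd[OF i]
      using ml q r in_t[OF q x] in_t[OF q y]
        pure_tensor_add[OF c(3)[OF q], of "i mod n" x y] base_carrier[OF x] base_carrier[OF y] c(1)[OF q]
      by simp
    show "?f (hs[i := a \<odot>\<^bsub>tpow S 1\<^esub> x]) = a \<otimes>\<^bsub>scalars S\<^esub> ?f (hs[i := x])"
      if a: "a \<in> carrier (scalars S)" for a
      unfolding upd[OF i]
      using ml q r in_t[OF q x] a
        pure_tensor_smult[OF c(3)[OF q], of "i mod n" a x] base_carrier[OF x] c(1)[OF q]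
      by simp
  qed
qed

text \<open>Freeness for \<open>S\<close> provides a linear form that has the right values on tuples
  of pure tensors. Since the entries range over all of \<open>tensors S n\<close>, the restriction
  to pure entries is then removed one slot at a time by multilinearity.\<close>

lemma tensors_free_power:
  assumes f: "multilinear_form T m f"
  shows "\<exists>g. linear_form_on_tensors T m g \<and>
    (\<forall>xs. length xs = m \<and> set xs \<subseteq> base T \<longrightarrow> g (pure_tensor T xs) = f xs)"
proof -
  obtain g where g: "linear_form_on_tensors S (n * m) g"
    and gf: "\<And>hs. length hs = n * m \<Longrightarrow> set hs \<subseteq> base S \<Longrightarrow>
      g (pure_tensor S hs) = f (map (\<lambda>r. pure_tensor S (take n (drop (r * n) hs))) [0..<m])"
    using tensors_free[OF multilinear_form_blocks[OF f]] by blast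
  have gT: "linear_form_on_tensors T m g"
    using g by (simp add: linear_form_on_tensors_def tensors_power)
  define pures where "pures = {pure_tensor S hs |hs. length hs = n \<and> set hs \<subseteq> base S}"
  \<comment> \<open>The first \<open>j\<close> entries are arbitrary and the remaining ones pure:
    \<open>j = 0\<close> comes from \<open>gf\<close>, and \<open>j = m\<close> is the
    claim.\<close>
  have "g (pure_tensor T xs) = f xs"
    if "j \<le> m" "length xs = m" "set xs \<subseteq> base T" "\<And>r. r < m \<Longrightarrow> j \<le> r \<Longrightarrow> xs ! r \<in> pures" for j xs
    using that
  proof (induction j arbitrary: xs)
    case 0
    have "\<exists>h. xs ! r = pure_tensor S h \<and> length h = n \<and> set h \<subseteq> base S" if "r < m" for r
      using 0(4)[OF that] by (auto simp: pures_def)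
    then obtain h where h: "\<And>r. r < m \<Longrightarrow> xs ! r = pure_tensor S (h r) \<and> length (h r) = n \<and> set (h r) \<subseteq> base S"
      by metis
    let ?hss = "map h [0..<m]"
    have xs: "xs = map (pure_tensor S) ?hss"
      using 0(2) h by (intro nth_equalityI) auto
    have hss1: "length ?hss = m" by simp
    have hss2: "length hs = n \<and> set hs \<subseteq> base S" if hs: "hs \<in> set ?hss" for hs
    proof -
      obtain r where "r < m" "hs = h r" using hs by auto
      then show "length hs = n \<and> set hs \<subseteq> base S" using h by simp
    qed
    have len: "length (concat ?hss) = n * m"
      using length_concat_uniform[of ?hss n] hss1 hss2 by auto
    have "g (pure_tensor T xs) = g (pure_tensor S (concat ?hss))"
      unfolding xs by (rule arg_cong[OF pure_tensor_concat[OF hss1 hss2]])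
    also have "\<dots> = f (map (\<lambda>r. pure_tensor S (take n (drop (r * n) (concat ?hss)))) [0..<m])"
      using hss2 by (intro gf len) fastforce
    also have "map (\<lambda>r. pure_tensor S (take n (drop (r * n) (concat ?hss)))) [0..<m] = xs"
      unfolding xs using hss2 take_drop_concat_uniform[of ?hss n] by (intro nth_equalityI) simp_all
    finally show ?case .
  next
    case (Suc j)
    have j: "j < m" using Suc.prems(1) by simp
    have xc: "set xs \<subseteq> carrier (tpow T 1)"
      using Suc.prems(3) P.base_carrier by blast
    have up: "set (xs[j := z]) \<subseteq> base T" if "z \<in> tensors S n" for z
      using Suc.prems(3) that set_update_subset_insert[of xs j z] by auto
    have mem: "pure_tensor T (xs[j := z]) \<in> tensors T m" if "z \<in> tensors S n" for z
      using up[OF that] Suc.prems(2) by (intro tensors.pure) auto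
    note ml = f[unfolded multilinear_form_def, rule_format, of xs, OF conjI[OF Suc.prems(2,3)]]
    \<comment> \<open>With \<open>z\<close> pure in slot \<open>j\<close> the outer induction
      hypothesis applies; both sides are linear in \<open>z\<close>.\<close>
    have "g (pure_tensor T (xs[j := z])) = f (xs[j := z])" if "z \<in> tensors S n" for z
      using that
    proof (induction rule: tensors.induct)
      case (pure hs)
      show ?case
      proof (rule Suc.IH)
        show "set (xs[j := pure_tensor S hs]) \<subseteq> base T" using tensors.pure[OF pure] by (rule up)
        fix r assume "r < m" "j \<le> r"
        then show "xs[j := pure_tensor S hs] ! r \<in> pures"
          using pure Suc.prems(2) Suc.prems(4)[of r] by (cases "r = j") (auto simp: pures_def)
      qed (use j Suc.prems(2) in auto)
    next
      case (add x y)
      have "pure_tensor T (xs[j := x \<oplus>\<^bsub>tpow S n\<^esub> y]) =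
          pure_tensor T (xs[j := x]) \<oplus>\<^bsub>tpow T m\<^esub> pure_tensor T (xs[j := y])"
        using P.pure_tensor_add[OF xc, of j x y] j Suc.prems(2) add(1,2) tensors_closed by simp
      moreover have "f (xs[j := x \<oplus>\<^bsub>tpow S n\<^esub> y]) = f (xs[j := x]) \<oplus>\<^bsub>scalars S\<^esub> f (xs[j := y])"
        using ml j add(1,2) by simp
      ultimately show ?case
        using gT mem[OF add(1)] mem[OF add(2)] add(3,4) unfolding linear_form_on_tensors_def by simp
    next
      case (smult a x)
      have "pure_tensor T (xs[j := a \<odot>\<^bsub>tpow S n\<^esub> x]) = a \<odot>\<^bsub>tpow T m\<^esub> pure_tensor T (xs[j := x])"
        using P.pure_tensor_smult[OF xc, of j a x] j Suc.prems(2) smult(1,2) tensors_closed by simp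
      moreover have "f (xs[j := a \<odot>\<^bsub>tpow S n\<^esub> x]) = a \<otimes>\<^bsub>scalars S\<^esub> f (xs[j := x])"
        using ml j smult(1,2) by simp
      ultimately show ?case
        using gT mem[OF smult(2)] smult(1,3) unfolding linear_form_on_tensors_def by simp
    qed
    moreover have "xs ! j \<in> tensors S n"
      using Suc.prems(2,3) j nth_mem[of j xs] by auto
    ultimately show ?case using list_update_id[of xs j] by metis
  qed
  from this[of m] have "g (pure_tensor T xs) = f xs" if "length xs = m" "set xs \<subseteq> base T" for xs
    using that by simp
  then show ?thesis using gT by blast
qed

lemma completed_tensor_powers_power: "completed_tensor_powers T"
  by (rule completed_tensor_powers.intro)
    (fact P.field P.algebras P.base P.leg_hom P.leg_id P.leg_leg P.leg_commute tensors_free_power |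
     simp add: char_zero)+

end



section \<open>Block comultiplication and counit on single factors\<close>

text \<open>The list of positions by which \<^const>\<open>tensor_power\<close> separates the components of the comultiplied
  block: \<open>K\<close> positions precede the block and \<open>Q\<close> positions follow it.\<close>

definition unshuffle :: "nat \<Rightarrow> nat \<Rightarrow> nat \<Rightarrow> nat list" where
  "unshuffle n K Q = [1..<K + 1] @ concat (map (\<lambda>s. [K + s, K + n + s]) [1..<n + 1]) @ [K + 2 * n + 1..<K + 2 * n + Q + 1]"

lemma
  shows length_concat_pairs: "length (concat (map (\<lambda>s. [f s, g s]) xs)) = 2 * length xs"
    and set_concat_pairs: "set (concat (map (\<lambda>s. [f s, g s]) xs)) = f ` set xs \<union> g ` set xs"
    and nth_concat_pairs: "s < length xs \<Longrightarrow> concat (map (\<lambda>s. [f s, g s]) xs) ! (s * 2) = f (xs ! s)"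
      "s < length xs \<Longrightarrow> concat (map (\<lambda>s. [f s, g s]) xs) ! (s * 2 + 1) = g (xs ! s)"
proof -
  show "length (concat (map (\<lambda>s. [f s, g s]) xs)) = 2 * length xs"
    by (induction xs) simp_all
  show "set (concat (map (\<lambda>s. [f s, g s]) xs)) = f ` set xs \<union> g ` set xs"
    by (induction xs) auto
  have l: "length ys = 2" if "ys \<in> set (map (\<lambda>s. [f s, g s]) xs)" for ys
    using that by auto
  assume s: "s < length xs"
  show "concat (map (\<lambda>s. [f s, g s]) xs) ! (s * 2) = f (xs ! s)"
    using nth_concat_uniform[of "map (\<lambda>s. [f s, g s]) xs" 2 s 0, OF l] s by simp
  show "concat (map (\<lambda>s. [f s, g s]) xs) ! (s * 2 + 1) = g (xs ! s)"
    using nth_concat_uniform[of "map (\<lambda>s. [f s, g s]) xs" 2 s 1, OF l] s by simp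
qed

lemma length_unshuffle: "length (unshuffle n K Q) = K + 2 * n + Q"
  unfolding unshuffle_def length_append length_concat_pairs by simp

lemma positions_unshuffle: "positions (K + 2 * n + Q) (unshuffle n K Q)"
proof -
  have im: "(\<lambda>s. K + s) ` {1..n} = {1 + K..n + K}" "(\<lambda>s. K + n + s) ` {1..n} = {1 + (K + n)..n + (K + n)}"
    by (rule image_add_atLeastAtMost)+
  have "set (unshuffle n K Q) =
      {1..K} \<union> (({1 + K..n + K} \<union> {1 + (K + n)..n + (K + n)}) \<union> {K + 2 * n + 1..K + 2 * n + Q})"
    unfolding unshuffle_def set_append set_concat_pairs set_upt atLeastLessThan_plus_one im ..
  also have "\<dots> = {1..K + 2 * n + Q}"
    (is "?A = ?B")
  proof (rule Set.set_eqI)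
    fix x
    consider "x \<le> K" | "K < x" "x \<le> K + n" | "K + n < x" "x \<le> K + 2 * n" | "K + 2 * n < x" by linarith
    then show "x \<in> ?A \<longleftrightarrow> x \<in> ?B" by cases simp_all
  qed
  finally have s: "set (unshuffle n K Q) = {1..K + 2 * n + Q}" .
  \<comment> \<open>Distinctness follows by counting: the list is as long as its set of entries is
    large.\<close>
  then show ?thesis
    unfolding positions_def using card_distinct[of "unshuffle n K Q"] by (simp only: length_unshuffle card_atLeastAtMost) simp
qed

lemma nth_unshuffle:
  shows "p < K \<Longrightarrow> unshuffle n K Q ! p = p + 1"
    and "s < n \<Longrightarrow> unshuffle n K Q ! (K + s * 2) = K + s + 1"
    and "s < n \<Longrightarrow> unshuffle n K Q ! (K + s * 2 + 1) = K + n + s + 1"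
    and "p < Q \<Longrightarrow> unshuffle n K Q ! (K + 2 * n + p) = K + 2 * n + p + 1"
proof -
  let ?X = "[1..<K + 1]" and ?M = "concat (map (\<lambda>s. [K + s, K + n + s]) [1..<n + 1])"
    and ?Z = "[K + 2 * n + 1..<K + 2 * n + Q + 1]"
  have X: "length ?X = K" and M: "length ?M = 2 * n" and L: "length (?X @ ?M) = K + 2 * n"
    unfolding length_append length_concat_pairs by simp_all
  show "unshuffle n K Q ! p = p + 1" if "p < K"
    unfolding unshuffle_def nth_append X using that by simp
  have mid: "unshuffle n K Q ! (K + q) = ?M ! q" if "q < 2 * n" for q
    unfolding unshuffle_def nth_append X M using that by simp
  show "unshuffle n K Q ! (K + s * 2) = K + s + 1" if "s < n"
    using mid[of "s * 2"] nth_concat_pairs(1)[of s "[1..<n + 1]" "\<lambda>s. K + s" "\<lambda>s. K + n + s"] that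
    by simp
  show "unshuffle n K Q ! (K + s * 2 + 1) = K + n + s + 1" if "s < n"
    using mid[of "s * 2 + 1"] nth_concat_pairs(2)[of s "[1..<n + 1]" "\<lambda>s. K + s" "\<lambda>s. K + n + s"] that
    by (simp add: add.assoc)
  have "unshuffle n K Q ! (K + 2 * n + p) = ?Z ! p" for p
    unfolding unshuffle_def append_assoc[symmetric] nth_append[of "?X @ ?M"] L by simp
  then show "unshuffle n K Q ! (K + 2 * n + p) = K + 2 * n + p + 1" if "p < Q"
    using that by simp
qed

context bialgebra_power
begin

text \<open>Writes the block boundaries in terms of \<open>(i - 1) * n\<close>, \<open>n\<close> and
  \<open>(M - i) * n\<close>, so that linear arithmetic can treat these products as atoms in the
  index computations below.\<close>

lemma block_arith:
  assumes "1 \<le> i" "i \<le> M"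
  shows "i * n = (i - 1) * n + n" "(i + 1) * n = (i - 1) * n + 2 * n"
    "(M + 1) * n = (i - 1) * n + 2 * n + (M - i) * n" "n * (M + 1) = (i - 1) * n + 2 * n + (M - i) * n"
    "n * M = (i - 1) * n + n + (M - i) * n"
proof -
  obtain a c where "i = a + 1" "M = a + 1 + c"
    using assms by (metis add.commute le_add_diff_inverse)
  then show "i * n = (i - 1) * n + n" "(i + 1) * n = (i - 1) * n + 2 * n"
    "(M + 1) * n = (i - 1) * n + 2 * n + (M - i) * n" "n * (M + 1) = (i - 1) * n + 2 * n + (M - i) * n"
    "n * M = (i - 1) * n + n + (M - i) * n"
    by (simp_all add: algebra_simps)
qed

lemma cop_power_eq:
  assumes "1 \<le> i" "i \<le> M"
  shows "cop T M i x = leg S (n * (M + 1)) (unshuffle n ((i - 1) * n) ((M - i) * n))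
    (fold (\<lambda>s y. cop S (n * M + (n - s)) ((i - 1) * n + s) y) (rev [1..<n + 1]) x)"
proof -
  have "[1..<(i - 1) * n + 1] @ concat (map (\<lambda>s. [(i - 1) * n + s, i * n + s]) [1..<n + 1]) @ [(i + 1) * n + 1..<(M + 1) * n + 1]
      = unshuffle n ((i - 1) * n) ((M - i) * n)"
    unfolding unshuffle_def block_arith[OF assms] ..
  then show ?thesis by (simp only: tensor_power_def tensor_system.simps)
qed

lemma cou_power_eq:
  "cou T M i x = fold (\<lambda>s y. cou S (n * M - (n - s)) ((i - 1) * n + s) y) (rev [1..<n + 1]) x"
  by (simp add: tensor_power_def)

lemma rev_upt_step: "t < n \<Longrightarrow> rev [n - Suc t + 1..<n + 1] = rev [n - t + 1..<n + 1] @ [n - t]"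
proof -
  assume t: "t < n"
  have "[n - t..<n + 1] = (n - t) # [Suc (n - t)..<n + 1]" using t by (intro upt_conv_Cons) simp
  moreover have "n - Suc t + 1 = n - t" using t by simp
  ultimately show ?thesis by (simp only: rev.simps Suc_eq_plus1)
qed

text \<open>
  After \<open>t\<close> steps the last \<open>t\<close> positions of the block have been comultiplied, so that the position
  \<open>k = i n - t + r\<close> of the block (with \<open>0 < r\<close>) has moved to the pair \<open>k + r - 1, k + r\<close>.
\<close>

lemma fold_cop:
  assumes i: "1 \<le> i" "i \<le> M" and "t \<le> n"
  shows "structure_map S (n * M) (n * M + t)
      (\<lambda>x. fold (\<lambda>s y. cop S (n * M + (n - s)) ((i - 1) * n + s) y) (rev [n - t + 1..<n + 1]) x) \<and>
    (\<forall>k b. 1 \<le> k \<longrightarrow> k \<le> n * M \<longrightarrow> b \<in> base S \<longrightarrow>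
      fold (\<lambda>s y. cop S (n * M + (n - s)) ((i - 1) * n + s) y) (rev [n - t + 1..<n + 1]) (leg S (n * M) [k] b) =
      (if k + t \<le> i * n then leg S (n * M + t) [k] b
       else if k \<le> i * n then leg S (n * M + t) [2 * k + t - i * n - 1, 2 * k + t - i * n] (comult S b)
       else leg S (n * M + t) [k + t] b))"
  using assms(3)
proof (induction t)
  case 0
  then show ?case by (auto intro: structure_map.ident)
next
  case (Suc t)
  let ?F = "\<lambda>s y. cop S (n * M + (n - s)) ((i - 1) * n + s) y"
  let ?D = "\<lambda>t x. fold ?F (rev [n - t + 1..<n + 1]) x"
  let ?p = "i * n - t" and ?N = "n * M + t"
  have t: "t < n" using Suc.prems by simp
  note ar = block_arith[OF i]
  have inM: "i * n \<le> n * M" unfolding ar by simp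
  have p: "1 \<le> ?p" "?p \<le> ?N" "(i - 1) * n + (n - t) = ?p" "t \<le> i * n"
    using t inM ar(1) by simp_all
  \<comment> \<open>The next place to be treated is \<open>s = n - t\<close>; by then
    \<open>t\<close> positions have been added, in agreement with \<open>n - s = t\<close>.\<close>
  have step: "?D (Suc t) x = cop S ?N ?p (?D t x)" for x
  proof -
    have nt: "n - (n - t) = t" using t by simp
    show ?thesis by (simp only: rev_upt_step[OF t] fold_append fold_simps comp_apply nt p(3))
  qed
  have sm: "structure_map S (n * M) ?N (?D t)"
    and gen: "\<And>k b. 1 \<le> k \<Longrightarrow> k \<le> n * M \<Longrightarrow> b \<in> base S \<Longrightarrow> ?D t (leg S (n * M) [k] b) =
      (if k + t \<le> i * n then leg S ?N [k] b
       else if k \<le> i * n then leg S ?N [2 * k + t - i * n - 1, 2 * k + t - i * n] (comult S b)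
       else leg S ?N [k + t] b)"
    using Suc by simp_all
  have N: "n * M + Suc t = ?N + 1" by simp
  show ?case
    unfolding step N
  proof (intro conjI allI impI)
    show "structure_map S (n * M) (?N + 1) (\<lambda>x. cop S ?N ?p (?D t x))"
      by (rule structure_map.cop[OF sm p(1,2)])
    fix k b assume k: "1 \<le> k" "k \<le> n * M" and b: "b \<in> base S"
    have c: "comult S b \<in> carrier (tpow S 2)" using comult_closed[OF base_carrier[OF b]] .
    \<comment> \<open>Positions to the left of the one now treated, that one, those of the block
      that are already doubled, and those behind the block.\<close>
    consider "k < ?p" | "k = ?p" | "?p < k" "k \<le> i * n" | "i * n < k" by linarith
    then show "cop S ?N ?p (?D t (leg S (n * M) [k] b)) =
      (if k + Suc t \<le> i * n then leg S (?N + 1) [k] b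
       else if k \<le> i * n then leg S (?N + 1) [2 * k + Suc t - i * n - 1, 2 * k + Suc t - i * n] (comult S b)
       else leg S (?N + 1) [k + Suc t] b)"
    proof cases
      case 1
      then have "k + Suc t \<le> i * n" "k + t \<le> i * n" "k \<le> ?N" using k by linarith+
      then show ?thesis using gen[OF k b] cop_factor[OF p(1,2) k(1) _ b] 1 by simp
    next
      case 2
      then have "\<not> k + Suc t \<le> i * n" "k + t \<le> i * n" "k \<le> ?N" "k \<le> i * n"
        "2 * k + Suc t - i * n - 1 = k" "2 * k + Suc t - i * n = k + 1"
        using k p(4) by linarith+
      then show ?thesis using gen[OF k b] cop_factor[OF p(1,2) k(1) _ b] 2 by simp
    next
      case 3
      \<comment> \<open>The first position of the pair that has replaced \<open>k\<close>. It lies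
        to the right of \<open>?p\<close>, so the new doubling moves the pair by one.\<close>
      define a where "a = 2 * k + t - i * n - 1"
      have e: "\<not> k + Suc t \<le> i * n" "\<not> k + t \<le> i * n" "2 * k + t - i * n = a + 1"
        "2 * k + Suc t - i * n - 1 = a + 1" "2 * k + Suc t - i * n = a + 1 + 1" "?p < a" "a + 1 \<le> ?N"
        using 3 k p(4) inM unfolding a_def by linarith+
      have "cop S ?N ?p (leg S ?N [a, a + 1] (comult S b)) = leg S (?N + 1) [a + 1, a + 1 + 1] (comult S b)"
        using cop_leg_notin[of ?N "[a, a + 1]" ?p "comult S b"] e p(1,2) c
        by (simp add: positions_def shift_up_def)
      then show ?thesis using gen[OF k b] 3 e by (simp add: a_def[symmetric])
    next
      case 4
      then have "\<not> k + Suc t \<le> i * n" "\<not> k + t \<le> i * n" "1 \<le> k + t" "k + t \<le> ?N" "\<not> k \<le> i * n" "?p < k + t"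
        using k by linarith+
      then show ?thesis using gen[OF k b] cop_factor[OF p(1,2) _ _ b, of "k + t"] by (simp add: Suc_eq_plus1 add.assoc)
    qed
  qed
qed

text \<open>Here nothing has to be tracked inside the block: a factor hit by the counit becomes a
  scalar without a position, and the factors behind the block move left by the number of steps
  made.\<close>

lemma fold_cou:
  assumes i: "1 \<le> i" "i \<le> M" and "t \<le> n"
  shows "structure_map S (n * M) (n * M - t)
      (\<lambda>x. fold (\<lambda>s y. cou S (n * M - (n - s)) ((i - 1) * n + s) y) (rev [n - t + 1..<n + 1]) x) \<and>
    (\<forall>k b. 1 \<le> k \<longrightarrow> k \<le> n * M \<longrightarrow> b \<in> base S \<longrightarrow>
      fold (\<lambda>s y. cou S (n * M - (n - s)) ((i - 1) * n + s) y) (rev [n - t + 1..<n + 1]) (leg S (n * M) [k] b) =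
      (if k + t \<le> i * n then leg S (n * M - t) [k] b
       else if k \<le> i * n then leg S (n * M - t) [] (counit S b)
       else leg S (n * M - t) [k - t] b))"
  using assms(3)
proof (induction t)
  case 0
  then show ?case by (auto intro: structure_map.ident)
next
  case (Suc t)
  let ?F = "\<lambda>s y. cou S (n * M - (n - s)) ((i - 1) * n + s) y"
  let ?D = "\<lambda>t x. fold ?F (rev [n - t + 1..<n + 1]) x"
  let ?p = "i * n - t" and ?N = "n * M - t"
  have t: "t < n" using Suc.prems by simp
  note ar = block_arith[OF i]
  have inM: "i * n \<le> n * M" unfolding ar by simp
  have p: "1 \<le> ?p" "?p \<le> ?N" "(i - 1) * n + (n - t) = ?p" "t \<le> i * n"
    using t inM ar(1) by simp_all
  have step: "?D (Suc t) x = cou S ?N ?p (?D t x)" for x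
  proof -
    have nt: "n - (n - t) = t" using t by simp
    show ?thesis by (simp only: rev_upt_step[OF t] fold_append fold_simps comp_apply nt p(3))
  qed
  have sm: "structure_map S (n * M) ?N (?D t)"
    and gen: "\<And>k b. 1 \<le> k \<Longrightarrow> k \<le> n * M \<Longrightarrow> b \<in> base S \<Longrightarrow> ?D t (leg S (n * M) [k] b) =
      (if k + t \<le> i * n then leg S ?N [k] b
       else if k \<le> i * n then leg S ?N [] (counit S b)
       else leg S ?N [k - t] b)"
    using Suc by simp_all
  have N: "n * M - Suc t = ?N - 1" by simp
  show ?case
    unfolding step N
  proof (intro conjI allI impI)
    show "structure_map S (n * M) (?N - 1) (\<lambda>x. cou S ?N ?p (?D t x))"
      by (rule structure_map.cou[OF sm p(1,2)])
    fix k b assume k: "1 \<le> k" "k \<le> n * M" and b: "b \<in> base S"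
    have c: "counit S b \<in> carrier (tpow S 0)" using counit_closed[OF base_carrier[OF b]] .
    consider "k < ?p" | "k = ?p" | "?p < k" "k \<le> i * n" | "i * n < k" by linarith
    then show "cou S ?N ?p (?D t (leg S (n * M) [k] b)) =
      (if k + Suc t \<le> i * n then leg S (?N - 1) [k] b
       else if k \<le> i * n then leg S (?N - 1) [] (counit S b)
       else leg S (?N - 1) [k - Suc t] b)"
    proof cases
      case 1
      then have "k + Suc t \<le> i * n" "k + t \<le> i * n" "k \<le> ?N" using k inM by linarith+
      then show ?thesis using gen[OF k b] cou_factor[OF p(1,2) k(1) _ b] 1 by simp
    next
      case 2
      then have "\<not> k + Suc t \<le> i * n" "k + t \<le> i * n" "k \<le> ?N" "k \<le> i * n"
        using k p by linarith+
      then show ?thesis using gen[OF k b] cou_factor[OF p(1,2) k(1) _ b] 2 by simp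
    next
      case 3
      then have e: "\<not> k + Suc t \<le> i * n" "\<not> k + t \<le> i * n" by linarith+
      have "cou S ?N ?p (leg S ?N [] (counit S b)) = leg S (?N - 1) [] (counit S b)"
        using cou_leg_notin[of ?N "[]" ?p "counit S b"] p(1,2) c by (simp add: positions_def)
      then show ?thesis using gen[OF k b] 3 e by simp
    next
      case 4
      then have "\<not> k + Suc t \<le> i * n" "\<not> k + t \<le> i * n" "1 \<le> k - t" "k - t \<le> ?N" "\<not> k \<le> i * n" "?p < k - t"
        "k - t - 1 = k - Suc t"
        using k p by linarith+
      then show ?thesis using gen[OF k b] cou_factor[OF p(1,2) _ _ b, of "k - t"] by simp
    qed
  qed
qed

lemma structure_map_cop_power:
  assumes i: "1 \<le> i" "i \<le> M"
  shows "structure_map S (n * M) (n * (M + 1)) (\<lambda>x. cop T M i x)"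
proof -
  have sm: "structure_map S (n * M) (n * M + n)
      (\<lambda>x. fold (\<lambda>s y. cop S (n * M + (n - s)) ((i - 1) * n + s) y) (rev [1..<n + 1]) x)"
    using fold_cop[OF i le_refl] by simp
  have u: "positions (n * (M + 1)) (unshuffle n ((i - 1) * n) ((M - i) * n))"
    unfolding block_arith(4)[OF i] by (rule positions_unshuffle)
  have "length (unshuffle n ((i - 1) * n) ((M - i) * n)) = n * M + n"
    unfolding length_unshuffle block_arith(5)[OF i] by simp
  then show ?thesis
    unfolding cop_power_eq[OF i] using structure_map_comp[OF sm structure_map_leg[OF u]] by simp
qed

text \<open>After the fold the components of a factor of block \<open>i\<close> are adjacent;
  \<open>unshuffle\<close> puts the first back in position \<open>k\<close> and the second one block
  further.\<close>

lemma cop_power_factor: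
  assumes i: "1 \<le> i" "i \<le> M" and k: "1 \<le> k" "k \<le> n * M" and b: "b \<in> base S"
  shows "cop T M i (leg S (n * M) [k] b) =
    (if k \<le> (i - 1) * n then leg S (n * (M + 1)) [k] b
     else if k \<le> i * n then leg S (n * (M + 1)) [k, k + n] (comult S b)
     else leg S (n * (M + 1)) [k + n] b)"
proof -
  let ?K = "(i - 1) * n" and ?Q = "(M - i) * n"
  let ?U = "unshuffle n ?K ?Q"
  note ar = block_arith[OF i]
  have U: "positions (n * (M + 1)) ?U" "length ?U = n * M + n"
    unfolding ar(4,5) length_unshuffle by (simp_all add: positions_unshuffle)
  note bc = base_carrier[OF b]
  have c: "comult S b \<in> carrier (tpow S 2)" using comult_closed[OF bc] .
  have lU: "leg S (n * (M + 1)) ?U (leg S (n * M + n) [q + 1] b) = leg S (n * (M + 1)) [?U ! q] b" if "q < n * M + n" for q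
    using leg_leg_factor[OF _ _ U(1) bc, of "q + 1"] that unfolding U(2) by simp
  have e: "cop T M i (leg S (n * M) [k] b) = leg S (n * (M + 1)) ?U
      (if k + n \<le> i * n then leg S (n * M + n) [k] b
       else if k \<le> i * n then leg S (n * M + n) [2 * k + n - i * n - 1, 2 * k + n - i * n] (comult S b)
       else leg S (n * M + n) [k + n] b)"
    unfolding cop_power_eq[OF i] using fold_cop[OF i le_refl] k b by simp
  consider "k \<le> ?K" | "?K < k" "k \<le> i * n" | "i * n < k" by linarith
  then show ?thesis
  proof cases
    case 1
    define p where "p = k - 1"
    have p: "k = p + 1" "p < ?K" "p < n * M + n" "p + 1 + n \<le> i * n"
      using 1 k ar(1,5) unfolding p_def by linarith+
    have "cop T M i (leg S (n * M) [k] b) = leg S (n * (M + 1)) [?U ! p] b"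
      using e lU[OF p(3)] p(4) unfolding p(1) by simp
    then show ?thesis unfolding nth_unshuffle(1)[OF p(2)] using 1 p(1) by simp
  next
    case 2
    define s where "s = k - ?K - 1"
    have s: "k = ?K + s + 1" "s < n" using 2 ar(1) unfolding s_def by linarith+
    \<comment> \<open>With \<open>s\<close> the place in the block counted from 0, this is the
      index, also from 0, of the first component in the interleaved order left by the fold.\<close>
    let ?q = "?K + s * 2"
    have r: "\<not> k + n \<le> i * n" "2 * k + n - i * n - 1 = ?q + 1" "2 * k + n - i * n = ?q + 2"
      "?q + 2 \<le> n * M + n" "?q + 2 - 1 = ?q + 1" "k + n = ?K + n + s + 1"
      using s ar(1,5) 2 by linarith+
    have "cop T M i (leg S (n * M) [k] b) =
        leg S (n * (M + 1)) ?U (leg S (n * M + n) [?q + 1, ?q + 2] (comult S b))"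
      unfolding e r(3) r(5) using r(1) 2 by simp
    also have "\<dots> = leg S (n * (M + 1)) (map (\<lambda>p. ?U ! (p - 1)) [?q + 1, ?q + 2]) (comult S b)"
    proof (rule leg_leg[OF _ U])
      show "positions (n * M + n) [?q + 1, ?q + 2]" unfolding positions_def using r(4) by simp
      show "comult S b \<in> carrier (tpow S (length [?q + 1, ?q + 2]))" using c by simp
    qed
    also have "map (\<lambda>p. ?U ! (p - 1)) [?q + 1, ?q + 2] = [k, k + n]"
      unfolding list.map r(5) add_diff_cancel_right' nth_unshuffle(2,3)[OF s(2)] r(6)
      by (simp only: s(1)[symmetric])
    finally show ?thesis using 2 by simp
  next
    case 3
    define p where "p = k - i * n - 1"
    have p: "k + n = ?K + 2 * n + p + 1" "p < ?Q" "?K + 2 * n + p < n * M + n"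
      "\<not> k + n \<le> i * n" "\<not> k \<le> i * n" "\<not> k \<le> ?K"
      using 3 k ar(1,5) unfolding p_def by linarith+
    have "cop T M i (leg S (n * M) [k] b) = leg S (n * (M + 1)) ?U (leg S (n * M + n) [k + n] b)"
      using e p(4,5) by simp
    also have "\<dots> = leg S (n * (M + 1)) [k + n] b"
      unfolding p(1) lU[OF p(3)] nth_unshuffle(4)[OF p(2)] ..
    finally show ?thesis using p(5,6) by simp
  qed
qed

lemma structure_map_cou_power:
  assumes i: "1 \<le> i" "i \<le> M"
  shows "structure_map S (n * M) (n * (M - 1)) (\<lambda>x. cou T M i x)"
proof -
  have "n * M - n = n * (M - 1)" by (simp add: diff_mult_distrib2)
  then show ?thesis
    unfolding cou_power_eq using fold_cou[OF i le_refl] by simp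
qed

lemma cou_power_factor:
  assumes i: "1 \<le> i" "i \<le> M" and k: "1 \<le> k" "k \<le> n * M" and b: "b \<in> base S"
  shows "cou T M i (leg S (n * M) [k] b) =
    (if k \<le> (i - 1) * n then leg S (n * (M - 1)) [k] b
     else if k \<le> i * n then leg S (n * (M - 1)) [] (counit S b)
     else leg S (n * (M - 1)) [k - n] b)"
proof -
  have n: "n * M - n = n * (M - 1)" by (simp add: diff_mult_distrib2)
  have "k + n \<le> i * n \<longleftrightarrow> k \<le> (i - 1) * n" using block_arith(1)[OF i] by linarith
  then show ?thesis
    unfolding cou_power_eq using fold_cou[OF i le_refl] k b n by simp
qed

text \<open>Makes \<open>extend\<close> for the tensor power a special case of \<open>extend\<close>
  for \<open>S\<close>.\<close>

lemma structure_map_power: "structure_map T m N f \<Longrightarrow> structure_map S (n * m) (n * N) f"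
proof (induction rule: structure_map.induct)
  case ident
  show ?case by (rule structure_map.ident)
next
  case (leg ps f N)
  then show ?case
    using structure_map_comp[OF leg(3) structure_map_leg[OF positions_blocks[OF leg(2)]]] by simp
next
  case (cop N f i)
  show ?case by (rule structure_map_comp[OF cop(4) structure_map_cop_power[OF cop(2,3)]])
next
  case (cou N f i)
  show ?case by (rule structure_map_comp[OF cou(4) structure_map_cou_power[OF cou(2,3)]])
qed

end



section \<open>Block maps on elements with one leg in each of two blocks\<close>

context bialgebra_power
begin

text \<open>Comultiplying a whole block of such an element affects only the single leg lying in that
  block. The factors of \<open>J_elem\<close> and \<open>R_diag\<close> have this form, so the
  comultiplication rules of an R-matrix of \<open>S\<close> apply to each of them.\<close>

lemma cop_power_leg2:
  assumes k: "1 \<le> k" "k \<le> n" "1 \<le> l" "l \<le> n" and x: "x \<in> carrier (tpow S 2)"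
  shows "cop T 2 1 (leg S (n * 2) [k, n + l] x) = leg S (n * 3) [k, n + k, 2 * n + l] (cop S 2 1 x)"
    and "cop T 2 2 (leg S (n * 2) [k, n + l] x) = leg S (n * 3) [k, n + l, 2 * n + l] (cop S 2 2 x)"
proof -
  have p2: "positions (n * 2) [k, n + l]" and p3: "positions (n * 3) [k, n + k, 2 * n + l]" "positions (n * 3) [k, n + l, 2 * n + l]"
    using k by (simp_all add: positions_def)
  have l2: "leg S (n * 2) [k, n + l] (leg S 2 [1] b) = leg S (n * 2) [k] b"
    "leg S (n * 2) [k, n + l] (leg S 2 [2] b) = leg S (n * 2) [n + l] b" if "b \<in> base S" for b
    using leg_leg_factor[OF _ _ p2 base_carrier[OF that], of 1] leg_leg_factor[OF _ _ p2 base_carrier[OF that], of 2]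
    by simp_all
  have l3: "leg S (n * 3) [i, j, q] (leg S 3 ps y) = leg S (n * 3) (map (\<lambda>p. [i, j, q] ! (p - 1)) ps) y"
    if "positions (n * 3) [i, j, q]" "positions 3 ps" "y \<in> carrier (tpow S (length ps))" for i j q ps y
    using leg_leg[OF that(2,1) _ that(3)] by simp
  have e: "n + l + n = 2 * n + l" by simp
  have k12: "r = 1 \<or> r = 2" if "1 \<le> r" "r \<le> 2" for r :: nat
    using that by linarith
  have sm: "structure_map S 2 3 (\<lambda>x. cop S 2 1 x)" "structure_map S 2 3 (\<lambda>x. cop S 2 2 x)"
    using structure_map_cop[of 1 2] structure_map_cop[of 2 2] by simp_all
  have smT: "structure_map S (n * 2) (n * 3) (\<lambda>x. cop T 2 1 x)" "structure_map S (n * 2) (n * 3) (\<lambda>x. cop T 2 2 x)"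
    using structure_map_cop_power[of 1 2] structure_map_cop_power[of 2 2] by simp_all
  have s2: "structure_map S 2 (n * 2) (\<lambda>x. leg S (n * 2) [k, n + l] x)"
    by (rule structure_map_leg[OF p2]) simp
  have s3: "structure_map S 3 (n * 3) (\<lambda>x. leg S (n * 3) [k, n + k, 2 * n + l] x)"
    "structure_map S 3 (n * 3) (\<lambda>x. leg S (n * 3) [k, n + l, 2 * n + l] x)"
    by (rule structure_map_leg[OF p3(1)], simp) (rule structure_map_leg[OF p3(2)], simp)
  show "cop T 2 1 (leg S (n * 2) [k, n + l] x) = leg S (n * 3) [k, n + k, 2 * n + l] (cop S 2 1 x)"
  proof (rule structure_map_eqI[OF structure_map_comp[OF s2 smT(1)] structure_map_comp[OF sm(1) s3(1)] _ x])
    fix r :: nat and b assume r: "1 \<le> r" "r \<le> 2" and b: "b \<in> base S"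
    show "cop T 2 1 (leg S (n * 2) [k, n + l] (leg S 2 [r] b)) =
        leg S (n * 3) [k, n + k, 2 * n + l] (cop S 2 1 (leg S 2 [r] b))"
      using k12[OF r]
    proof
      assume "r = 1"
      then show ?thesis
        using k b cop_power_factor[of 1 2 k b] l3[OF p3(1), of "[1, 2]" "comult S b"] comult_closed[OF base_carrier[OF b]]
        by (simp add: l2 cop_factor positions_def add.commute[of k n])
    next
      assume "r = 2"
      then show ?thesis
        using k b cop_power_factor[of 1 2 "n + l" b] l3[OF p3(1), of "[3]" b] base_carrier[OF b]
        by (simp add: l2 cop_factor e)
    qed
  qed
  show "cop T 2 2 (leg S (n * 2) [k, n + l] x) = leg S (n * 3) [k, n + l, 2 * n + l] (cop S 2 2 x)"
  proof (rule structure_map_eqI[OF structure_map_comp[OF s2 smT(2)] structure_map_comp[OF sm(2) s3(2)] _ x])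
    fix r :: nat and b assume r: "1 \<le> r" "r \<le> 2" and b: "b \<in> base S"
    show "cop T 2 2 (leg S (n * 2) [k, n + l] (leg S 2 [r] b)) =
        leg S (n * 3) [k, n + l, 2 * n + l] (cop S 2 2 (leg S 2 [r] b))"
      using k12[OF r]
    proof
      assume "r = 1"
      then show ?thesis
        using k b cop_power_factor[of 2 2 k b] l3[OF p3(2), of "[1]" b] base_carrier[OF b]
        by (simp add: l2 cop_factor)
    next
      assume "r = 2"
      then show ?thesis
        using k b cop_power_factor[of 2 2 "n + l" b] l3[OF p3(2), of "[2, 3]" "comult S b"] comult_closed[OF base_carrier[OF b]]
        by (simp add: l2 cop_factor positions_def e)
    qed
  qed
qed

lemma cou_power_leg2:
  assumes k: "1 \<le> k" "k \<le> n" "1 \<le> l" "l \<le> n" and x: "x \<in> carrier (tpow S 2)"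
  shows "cou T 2 1 (leg S (n * 2) [k, n + l] x) = leg S n [l] (cou S 2 1 x)"
    and "cou T 2 2 (leg S (n * 2) [k, n + l] x) = leg S n [k] (cou S 2 2 x)"
proof -
  have p2: "positions (n * 2) [k, n + l]"
    using k by (simp add: positions_def)
  have l2: "leg S (n * 2) [k, n + l] (leg S 2 [1] b) = leg S (n * 2) [k] b"
    "leg S (n * 2) [k, n + l] (leg S 2 [2] b) = leg S (n * 2) [n + l] b" if "b \<in> base S" for b
    using leg_leg_factor[OF _ _ p2 base_carrier[OF that], of 1] leg_leg_factor[OF _ _ p2 base_carrier[OF that], of 2]
    by simp_all
  have l1: "leg S n [q] (leg S 1 ps y) = leg S n (map (\<lambda>p. [q] ! (p - 1)) ps) y"
    if "1 \<le> q" "q \<le> n" "positions 1 ps" "y \<in> carrier (tpow S (length ps))" for q ps y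
    using leg_leg[OF that(3) _ _ that(4), of n "[q]"] that(1,2) by simp
  have k12: "r = 1 \<or> r = 2" if "1 \<le> r" "r \<le> 2" for r :: nat
    using that by linarith
  have sm: "structure_map S 2 1 (\<lambda>x. cou S 2 1 x)" "structure_map S 2 1 (\<lambda>x. cou S 2 2 x)"
    using structure_map_cou[of 1 2] structure_map_cou[of 2 2] by simp_all
  have smT: "structure_map S (n * 2) n (\<lambda>x. cou T 2 1 x)" "structure_map S (n * 2) n (\<lambda>x. cou T 2 2 x)"
    using structure_map_cou_power[of 1 2] structure_map_cou_power[of 2 2] by simp_all
  have s2: "structure_map S 2 (n * 2) (\<lambda>x. leg S (n * 2) [k, n + l] x)"
    by (rule structure_map_leg[OF p2]) simp
  have s1: "structure_map S 1 n (\<lambda>x. leg S n [k] x)" "structure_map S 1 n (\<lambda>x. leg S n [l] x)"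
    by (rule structure_map_leg; use k in simp)+
  show "cou T 2 1 (leg S (n * 2) [k, n + l] x) = leg S n [l] (cou S 2 1 x)"
  proof (rule structure_map_eqI[OF structure_map_comp[OF s2 smT(1)] structure_map_comp[OF sm(1) s1(2)] _ x])
    fix r :: nat and b assume r: "1 \<le> r" "r \<le> 2" and b: "b \<in> base S"
    show "cou T 2 1 (leg S (n * 2) [k, n + l] (leg S 2 [r] b)) = leg S n [l] (cou S 2 1 (leg S 2 [r] b))"
      using k12[OF r]
    proof
      assume "r = 1"
      then show ?thesis
        using k b cou_power_factor[of 1 2 k b] l1[OF k(3,4), of "[]" "counit S b"] counit_closed[OF base_carrier[OF b]]
        by (simp add: l2 cou_factor positions_def)
    next
      assume "r = 2"
      then show ?thesis
        using k b cou_power_factor[of 1 2 "n + l" b] base_carrier[OF b]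
        by (simp add: l2 cou_factor)
    qed
  qed
  show "cou T 2 2 (leg S (n * 2) [k, n + l] x) = leg S n [k] (cou S 2 2 x)"
  proof (rule structure_map_eqI[OF structure_map_comp[OF s2 smT(2)] structure_map_comp[OF sm(2) s1(1)] _ x])
    fix r :: nat and b assume r: "1 \<le> r" "r \<le> 2" and b: "b \<in> base S"
    show "cou T 2 2 (leg S (n * 2) [k, n + l] (leg S 2 [r] b)) = leg S n [k] (cou S 2 2 (leg S 2 [r] b))"
      using k12[OF r]
    proof
      assume "r = 1"
      then show ?thesis
        using k b cou_power_factor[of 2 2 k b] base_carrier[OF b]
        by (simp add: l2 cou_factor)
    next
      assume "r = 2"
      then show ?thesis
        using k b cou_power_factor[of 2 2 "n + l" b] l1[OF k(1,2), of "[]" "counit S b"] counit_closed[OF base_carrier[OF b]]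
        by (simp add: l2 cou_factor positions_def)
    qed
  qed
qed

lemma comult_power_factor:
  "\<lbrakk>1 \<le> k; k \<le> n; b \<in> base S\<rbrakk> \<Longrightarrow> comult T (leg S n [k] b) = leg S (n * 2) [k, n + k] (comult S b)"
  using cop_power_factor[of 1 1 k b] by (simp add: add.commute)

lemma counit_power_factor:
  "\<lbrakk>1 \<le> k; k \<le> n; b \<in> base S\<rbrakk> \<Longrightarrow> counit T (leg S n [k] b) = leg S 0 [] (counit S b)"
  using cou_power_factor[of 1 1 k b] by simp

end



section \<open>The bialgebra axioms for a tensor power\<close>

context bialgebra_power
begin

lemma length_pair: "length [x, y] = 2"
  by simp

lemma leg_power_leg2:
  assumes pq: "positions N [p, q]" and k: "1 \<le> k" "k \<le> n" "1 \<le> l" "l \<le> n" and x: "x \<in> carrier (tpow S 2)"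
  shows "leg S (n * N) (concat (map (block n) [p, q])) (leg S (n * 2) [k, n + l] x) =
    leg S (n * N) [(p - 1) * n + k, (q - 1) * n + l] x"
proof -
  let ?B = "concat (map (block n) [p, q])"
  have B: "positions (n * N) ?B" "length ?B = n * 2"
    using positions_blocks[OF pq] length_blocks[OF pq] by simp_all
  have "?B ! (0 * n + (k - 1)) = ([p, q] ! 0 - 1) * n + (k - 1) + 1"
    by (rule nth_blocks[OF pq]) (use k in auto)
  moreover have "0 * n + (k - 1) = k - 1" "([p, q] ! 0 - 1) * n + (k - 1) + 1 = (p - 1) * n + k"
    using k by simp_all
  ultimately have B1: "?B ! (k - 1) = (p - 1) * n + k" by (simp only:)
  have "?B ! (1 * n + (l - 1)) = ([p, q] ! 1 - 1) * n + (l - 1) + 1"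
    by (rule nth_blocks[OF pq]) (use k in auto)
  moreover have "1 * n + (l - 1) = n + l - 1" "([p, q] ! 1 - 1) * n + (l - 1) + 1 = (q - 1) * n + l"
    using k by simp_all
  ultimately have B2: "?B ! (n + l - 1) = (q - 1) * n + l" by (simp only:)
  have "map (\<lambda>i. ?B ! (i - 1)) [k, n + l] = [(p - 1) * n + k, (q - 1) * n + l]"
    using B1 B2 by simp
  moreover have "positions (n * 2) [k, n + l]" using k by (simp add: positions_def)
  ultimately show ?thesis
    using leg_leg[OF _ B(1,2), of "[k, n + l]" x] x by (metis length_pair)
qed

text \<open>An element of \<open>base T\<close> is itself a tensor with \<open>n\<close> factors.
  Each axiom is therefore compared on single factors from \<open>base S\<close>, where the block
  maps are known explicitly and the axioms of \<open>S\<close> apply.\<close>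

lemma topological_bialgebra_power: "topological_bialgebra T"
proof (rule topological_bialgebra.intro[OF completed_tensor_powers_power topological_bialgebra_axioms.intro])
  fix i N :: nat assume i: "1 \<le> i" "i \<le> N"
  show "cop T N i \<in> alg_hom (scalars T) (tpow T N) (tpow T (N + 1))"
    using structure_map_hom[OF structure_map_cop_power[OF i]] by simp
  show "cou T N i \<in> alg_hom (scalars T) (tpow T N) (tpow T (N - 1))"
    using structure_map_hom[OF structure_map_cou_power[OF i]] by simp
  fix j b assume j: "1 \<le> j" "j \<le> N" and b: "b \<in> base T"
  have bc: "b \<in> carrier (tpow S n)" using b tensors_closed by simp
  have pb: "positions (n * M) (block n r)" if "1 \<le> r" "r \<le> M" for r M
    using positions_blocks[of M "[r]"] that by simp
  have sb: "structure_map S n (n * M) (\<lambda>x. leg S (n * M) (block n r) x)" if "1 \<le> r" "r \<le> M" for r M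
    by (rule structure_map_leg[OF pb[OF that]]) (use that in simp)
  \<comment> \<open>Translates the comparison of blocks into the comparison of positions that
    distinguishes the cases of \<open>cop_power_factor\<close> and
    \<open>cou_power_factor\<close>.\<close>
  have idx: "j < i \<Longrightarrow> (j - 1) * n + s \<le> (i - 1) * n"
    "j = i \<Longrightarrow> \<not> (j - 1) * n + s \<le> (i - 1) * n \<and> (j - 1) * n + s \<le> i * n"
    "j > i \<Longrightarrow> \<not> (j - 1) * n + s \<le> (i - 1) * n \<and> \<not> (j - 1) * n + s \<le> i * n" if "1 \<le> s" "s \<le> n" for s
  proof -
    have jn: "j * n = (j - 1) * n + n" and in': "i * n = (i - 1) * n + n"
      using block_arith(1)[OF i] block_arith(1)[OF j] by simp_all
    show "(j - 1) * n + s \<le> (i - 1) * n" if "j < i"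
    proof -
      have "j * n \<le> (i - 1) * n" using that by (intro mult_le_mono1) simp
      then show ?thesis using \<open>s \<le> n\<close> jn by linarith
    qed
    show "\<not> (j - 1) * n + s \<le> (i - 1) * n \<and> (j - 1) * n + s \<le> i * n" if "j = i"
      unfolding that using \<open>1 \<le> s\<close> \<open>s \<le> n\<close> in' by linarith
    show "\<not> (j - 1) * n + s \<le> (i - 1) * n \<and> \<not> (j - 1) * n + s \<le> i * n" if "j > i"
    proof -
      have "i * n \<le> (j - 1) * n" using that by (intro mult_le_mono1) simp
      then show ?thesis using \<open>1 \<le> s\<close> in' by linarith
    qed
  qed
  have copL: "structure_map S n (n * (N + 1)) (\<lambda>x. cop T N i (leg S (n * N) (block n j) x))"
    by (rule structure_map_comp[OF sb[OF j] structure_map_cop_power[OF i]])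
  have couL: "structure_map S n (n * (N - 1)) (\<lambda>x. cou T N i (leg S (n * N) (block n j) x))"
    by (rule structure_map_comp[OF sb[OF j] structure_map_cou_power[OF i]])
  have lj: "leg S (n * N) (block n j) (leg S n [s] c) = leg S (n * N) [(j - 1) * n + s] c"
    if "1 \<le> s" "s \<le> n" "c \<in> base S" for s c
    by (rule leg_block_factor[OF j that(1,2) base_carrier[OF that(3)]])
  note le = block_index_le[OF j]
  have "cop T N i (leg S (n * N) (block n j) b) =
      (if j < i then leg S (n * (N + 1)) (block n j) b
       else if j = i then leg S (n * (N + 1)) (concat (map (block n) [i, i + 1])) (comult T b)
       else leg S (n * (N + 1)) (block n (j + 1)) b)"
  proof -
    consider "j < i" | "j = i" | "i < j" by linarith
    then show ?thesis
    proof cases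
      case 1
      have "cop T N i (leg S (n * N) (block n j) b) = leg S (n * (N + 1)) (block n j) b"
      proof (rule structure_map_eqI[OF copL sb _ bc])
        fix s c assume s: "1 \<le> s" "s \<le> n" and c: "c \<in> base S"
        show "cop T N i (leg S (n * N) (block n j) (leg S n [s] c)) = leg S (n * (N + 1)) (block n j) (leg S n [s] c)"
          using leg_block_factor[of j "N + 1" s c] cop_power_factor[OF i le(1,2)[OF s] c] idx(1)[OF s 1] j s c
          by (simp add: lj base_carrier)
      qed (use j in simp_all)
      then show ?thesis using 1 by simp
    next
      case 3
      have "cop T N i (leg S (n * N) (block n j) b) = leg S (n * (N + 1)) (block n (j + 1)) b"
      proof (rule structure_map_eqI[OF copL sb _ bc])
        fix s c assume s: "1 \<le> s" "s \<le> n" and c: "c \<in> base S"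
        have e: "(j - 1) * n + s + n = (j + 1 - 1) * n + s" using block_arith(1)[OF j] by simp
        have "cop T N i (leg S (n * N) (block n j) (leg S n [s] c)) = leg S (n * (N + 1)) [(j - 1) * n + s + n] c"
          unfolding lj[OF s c] using cop_power_factor[OF i le(1,2)[OF s] c] idx(3)[OF s 3] by simp
        also have "\<dots> = leg S (n * (N + 1)) (block n (j + 1)) (leg S n [s] c)"
          unfolding e by (rule leg_block_factor[symmetric, OF _ _ s base_carrier[OF c]]) (use j in simp_all)
        finally show "cop T N i (leg S (n * N) (block n j) (leg S n [s] c)) = leg S (n * (N + 1)) (block n (j + 1)) (leg S n [s] c)" .
      qed (use j in simp_all)
      then show ?thesis using 3 by simp
    next
      case 2
      have pos: "positions (N + 1) [i, i + 1]" using i by (simp add: positions_def)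
      have "cop T N i (leg S (n * N) (block n j) b) = leg S (n * (N + 1)) (concat (map (block n) [i, i + 1])) (comult T b)"
      proof (rule structure_map_eqI[OF copL structure_map_comp[OF _ structure_map_leg[OF positions_blocks[OF pos]]] _ bc])
        show "structure_map S n (n * 2) (\<lambda>x. comult T x)" using structure_map_cop_power[of 1 1] by simp
        show "length (concat (map (block n) [i, i + 1])) = n * 2" using length_blocks[OF pos] by simp
        fix s c assume s: "1 \<le> s" "s \<le> n" and c: "c \<in> base S"
        have "leg S (n * (N + 1)) (concat (map (block n) [i, i + 1])) (comult T (leg S n [s] c)) =
            leg S (n * (N + 1)) [(i - 1) * n + s, (i + 1 - 1) * n + s] (comult S c)"
          unfolding comult_power_factor[OF s c]
          by (rule leg_power_leg2[OF pos s s comult_closed[OF base_carrier[OF c]]])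
        also have "(i + 1 - 1) * n + s = (j - 1) * n + s + n" using block_arith(1)[OF i] 2 by simp
        also have "leg S (n * (N + 1)) [(i - 1) * n + s, (j - 1) * n + s + n] (comult S c) =
            cop T N i (leg S (n * N) (block n j) (leg S n [s] c))"
          unfolding lj[OF s c] using cop_power_factor[OF i le(1,2)[OF s] c] idx(2)[OF s 2] 2 by simp
        finally show "cop T N i (leg S (n * N) (block n j) (leg S n [s] c)) =
            leg S (n * (N + 1)) (concat (map (block n) [i, i + 1])) (comult T (leg S n [s] c))" ..
      qed
      then show ?thesis using 2 by simp
    qed
  qed
  then show "cop T N i (leg T N [j] b) = (if j < i then leg T (N + 1) [j] b
      else if j = i then leg T (N + 1) [i, i + 1] (comult T b) else leg T (N + 1) [j + 1] b)"
    by simp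
  have "cou T N i (leg S (n * N) (block n j) b) =
      (if j < i then leg S (n * (N - 1)) (block n j) b
       else if j = i then leg S (n * (N - 1)) [] (counit T b)
       else leg S (n * (N - 1)) (block n (j - 1)) b)"
  proof -
    consider "j < i" | "j = i" | "i < j" by linarith
    then show ?thesis
    proof cases
      case 1
      have "cou T N i (leg S (n * N) (block n j) b) = leg S (n * (N - 1)) (block n j) b"
      proof (rule structure_map_eqI[OF couL sb _ bc])
        fix s c assume s: "1 \<le> s" "s \<le> n" and c: "c \<in> base S"
        show "cou T N i (leg S (n * N) (block n j) (leg S n [s] c)) = leg S (n * (N - 1)) (block n j) (leg S n [s] c)"
          using leg_block_factor[of j "N - 1" s c] cou_power_factor[OF i le(1,2)[OF s] c] idx(1)[OF s] 1 i j s c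
          by (simp add: lj base_carrier)
      qed (use i j 1 in simp_all)
      then show ?thesis using 1 by simp
    next
      case 3
      have j1: "1 \<le> j - 1" "j - 1 \<le> N - 1" using 3 i j by simp_all
      have "cou T N i (leg S (n * N) (block n j) b) = leg S (n * (N - 1)) (block n (j - 1)) b"
      proof (rule structure_map_eqI[OF couL sb _ bc])
        fix s c assume s: "1 \<le> s" "s \<le> n" and c: "c \<in> base S"
        have e: "(j - 1) * n + s - n = (j - 1 - 1) * n + s" using block_arith(1)[OF j1] by linarith
        have "cou T N i (leg S (n * N) (block n j) (leg S n [s] c)) = leg S (n * (N - 1)) [(j - 1) * n + s - n] c"
          unfolding lj[OF s c] using cou_power_factor[OF i le(1,2)[OF s] c] idx(3)[OF s 3] by simp
        also have "\<dots> = leg S (n * (N - 1)) (block n (j - 1)) (leg S n [s] c)"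
          unfolding e by (rule leg_block_factor[symmetric, OF j1 s base_carrier[OF c]])
        finally show "cou T N i (leg S (n * N) (block n j) (leg S n [s] c)) = leg S (n * (N - 1)) (block n (j - 1)) (leg S n [s] c)" .
      qed (use j1 in simp_all)
      then show ?thesis using 3 by simp
    next
      case 2
      have "cou T N i (leg S (n * N) (block n j) b) = leg S (n * (N - 1)) [] (counit T b)"
      proof (rule structure_map_eqI[OF couL structure_map_comp[OF _ structure_map_leg] _ bc])
        show "structure_map S n 0 (\<lambda>x. counit T x)" using structure_map_cou_power[of 1 1] by simp
        fix s c assume s: "1 \<le> s" "s \<le> n" and c: "c \<in> base S"
        have "leg S (n * (N - 1)) [] (leg S 0 [] (counit S c)) = leg S (n * (N - 1)) [] (counit S c)"
          using leg_leg[of 0 "[]" "n * (N - 1)" "[]" "counit S c"] counit_closed[OF base_carrier[OF c]]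
          by (simp add: positions_def)
        then show "cou T N i (leg S (n * N) (block n j) (leg S n [s] c)) =
            leg S (n * (N - 1)) [] (counit T (leg S n [s] c))"
          unfolding lj[OF s c] counit_power_factor[OF s c]
          using cou_power_factor[OF i le(1,2)[OF s] c] idx(2)[OF s 2] by simp
      qed (simp_all add: positions_def)
      then show ?thesis using 2 by simp
    qed
  qed
  then show "cou T N i (leg T N [j] b) = (if j < i then leg T (N - 1) [j] b
      else if j = i then leg T (N - 1) [] (counit T b) else leg T (N - 1) [j - 1] b)"
    by simp
next
  fix b assume "b \<in> base T"
  then have b: "b \<in> tensors S n" by simp
  note bc = tensors_closed[OF b]
  have sm: "structure_map S n (n * 2) (\<lambda>x. comult T x)" "structure_map S n 0 (\<lambda>x. counit T x)"
    using structure_map_cop_power[of 1 1] structure_map_cou_power[of 1 1] by simp_all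
  have sm2: "structure_map S (n * 2) (n * 3) (\<lambda>x. cop T 2 1 x)" "structure_map S (n * 2) (n * 3) (\<lambda>x. cop T 2 2 x)"
    "structure_map S (n * 2) n (\<lambda>x. cou T 2 1 x)" "structure_map S (n * 2) n (\<lambda>x. cou T 2 2 x)"
    using structure_map_cop_power[of 1 2] structure_map_cop_power[of 2 2]
      structure_map_cou_power[of 1 2] structure_map_cou_power[of 2 2] by simp_all
  have "counit T b \<in> tensors S 0"
  proof (rule alg_hom_tensors[OF structure_map_hom[OF sm(2)] b])
    fix k c assume "1 \<le> k" "k \<le> n" "c \<in> base S"
    then show "counit T (leg S n [k] c) \<in> tensors S 0"
      using leg_tensors[of 0 "[]" "counit S c"] counit_scalar by (simp add: counit_power_factor positions_def)
  qed
  then show "counit T b \<in> tensors T 0" by (simp add: tensors_power)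
  show "cop T 2 1 (comult T b) = cop T 2 2 (comult T b)"
    by (rule structure_map_eqI[OF structure_map_comp[OF sm(1) sm2(1)] structure_map_comp[OF sm(1) sm2(2)] _ bc])
      (simp add: comult_power_factor cop_power_leg2 comult_closed base_carrier coassoc)
  show "cou T 2 1 (comult T b) = b"
    by (rule structure_map_eqI[OF structure_map_comp[OF sm(1) sm2(3)] structure_map.ident _ bc])
      (simp add: comult_power_factor cou_power_leg2 comult_closed base_carrier counit_left)
  show "cou T 2 2 (comult T b) = b"
    by (rule structure_map_eqI[OF structure_map_comp[OF sm(1) sm2(4)] structure_map.ident _ bc])
      (simp add: comult_power_factor cou_power_leg2 comult_closed base_carrier counit_right)
next
  fix m N f g u y
  assume "structure_map T m N f" "structure_map T m N g" "u \<in> carrier (tpow T N)"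
    and "\<And>x. x \<in> tensors T m \<Longrightarrow> f x \<otimes>\<^bsub>tpow T N\<^esub> u = u \<otimes>\<^bsub>tpow T N\<^esub> g x"
    and "y \<in> carrier (tpow T m)"
  then show "f y \<otimes>\<^bsub>tpow T N\<^esub> u = u \<otimes>\<^bsub>tpow T N\<^esub> g y"
    using extend[OF structure_map_power structure_map_power, of m N f g u y]
    by (simp add: tensors_power)
qed

end



section \<open>Ordered products\<close>

primrec fwd_prod :: "('a, 'm) monoid_scheme \<Rightarrow> (nat \<Rightarrow> 'a) \<Rightarrow> nat \<Rightarrow> 'a" where
  "fwd_prod G f 0 = \<one>\<^bsub>G\<^esub>"
| "fwd_prod G f (Suc m) = fwd_prod G f m \<otimes>\<^bsub>G\<^esub> f m"

primrec rev_prod :: "('a, 'm) monoid_scheme \<Rightarrow> (nat \<Rightarrow> 'a) \<Rightarrow> nat \<Rightarrow> 'a" where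
  "rev_prod G f 0 = \<one>\<^bsub>G\<^esub>"
| "rev_prod G f (Suc m) = f m \<otimes>\<^bsub>G\<^esub> rev_prod G f m"

text \<open>The shape of \<open>J_elem\<close> with indices from 0: increasing rows
  \<open>j\<close>, and decreasing \<open>i < j\<close> within a row. Row 0 is empty, and a new row
  is appended on the right.\<close>

primrec tri_prod :: "('a, 'm) monoid_scheme \<Rightarrow> (nat \<Rightarrow> nat \<Rightarrow> 'a) \<Rightarrow> nat \<Rightarrow> 'a" where
  "tri_prod G F 0 = \<one>\<^bsub>G\<^esub>"
| "tri_prod G F (Suc m) = tri_prod G F m \<otimes>\<^bsub>G\<^esub> rev_prod G (F m) m"

lemma fwd_prod_cong: "(\<And>i. i < m \<Longrightarrow> f i = g i) \<Longrightarrow> fwd_prod G f m = fwd_prod G g m"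
  by (induction m) simp_all

lemma rev_prod_cong: "(\<And>i. i < m \<Longrightarrow> f i = g i) \<Longrightarrow> rev_prod G f m = rev_prod G g m"
  by (induction m) simp_all

lemma tri_prod_cong:
  "(\<And>i j. i < j \<Longrightarrow> j < m \<Longrightarrow> F j i = G' j i) \<Longrightarrow> tri_prod G F m = tri_prod G G' m"
proof (induction m)
  case (Suc m)
  have "rev_prod G (F m) m = rev_prod G (G' m) m"
    by (rule rev_prod_cong) (use Suc.prems in simp)
  then show ?case using Suc by simp
qed simp

lemma list_prod_rev_upt: "list_prod G (map f (rev [1..<m + 1])) = rev_prod G (\<lambda>i. f (i + 1)) m"
proof (induction m)
  case (Suc m)
  have "[1..<Suc m + 1] = [1..<m + 1] @ [m + 1]" by (simp add: upt_Suc)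
  then show ?case using Suc by simp
qed simp

context monoid
begin

lemma list_prod_upt:
  assumes "\<And>i. i < m \<Longrightarrow> f (i + 1) \<in> carrier G"
  shows "list_prod G (map f [1..<m + 1]) = fwd_prod G (\<lambda>i. f (i + 1)) m"
  using assms
proof (induction m)
  case (Suc m)
  have "[1..<Suc m + 1] = [1..<m + 1] @ [m + 1]" by (simp add: upt_Suc)
  moreover have "set (map f [1..<m + 1]) \<subseteq> carrier G"
  proof
    fix x assume "x \<in> set (map f [1..<m + 1])"
    then obtain i where "x = f i" "1 \<le> i" "i \<le> m" by auto
    then show "x \<in> carrier G" using Suc.prems[of "i - 1"] by simp
  qed
  ultimately show ?case using Suc by (simp add: list_prod_append)
qed simp

lemma fwd_prod_closed: "(\<And>i. i < m \<Longrightarrow> f i \<in> carrier G) \<Longrightarrow> fwd_prod G f m \<in> carrier G"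
  by (induction m) simp_all

lemma fwd_prod_Units: "(\<And>i. i < m \<Longrightarrow> f i \<in> Units G) \<Longrightarrow> fwd_prod G f m \<in> Units G"
  by (induction m) simp_all

lemma rev_prod_closed: "(\<And>i. i < m \<Longrightarrow> f i \<in> carrier G) \<Longrightarrow> rev_prod G f m \<in> carrier G"
  by (induction m) simp_all

lemma rev_prod_Units: "(\<And>i. i < m \<Longrightarrow> f i \<in> Units G) \<Longrightarrow> rev_prod G f m \<in> Units G"
  by (induction m) simp_all

lemma tri_prod_closed: "(\<And>i j. i < j \<Longrightarrow> j < m \<Longrightarrow> F j i \<in> carrier G) \<Longrightarrow> tri_prod G F m \<in> carrier G"
  by (induction m) (simp_all add: rev_prod_closed)

lemma tri_prod_Units: "(\<And>i j. i < j \<Longrightarrow> j < m \<Longrightarrow> F j i \<in> Units G) \<Longrightarrow> tri_prod G F m \<in> Units G"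
  by (induction m) (simp_all add: rev_prod_Units)

lemma rev_prod_one: "rev_prod G (\<lambda>i. \<one>) m = \<one>"
  by (induction m) simp_all

lemma tri_prod_one: "tri_prod G (\<lambda>j i. \<one>) m = \<one>"
  by (induction m) (simp_all add: rev_prod_one)

lemma commute_mult:
  assumes "a \<otimes> b = b \<otimes> a" "a \<otimes> c = c \<otimes> a" "a \<in> carrier G" "b \<in> carrier G" "c \<in> carrier G"
  shows "a \<otimes> (b \<otimes> c) = b \<otimes> c \<otimes> a"
  using assms by (metis m_assoc)

lemma rev_prod_commute:
  assumes "c \<in> carrier G" "\<And>i. i < m \<Longrightarrow> f i \<in> carrier G" "\<And>i. i < m \<Longrightarrow> c \<otimes> f i = f i \<otimes> c"
  shows "c \<otimes> rev_prod G f m = rev_prod G f m \<otimes> c"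
  using assms(2,3)
proof (induction m)
  case (Suc m)
  then show ?case
    using assms(1) by (auto intro!: commute_mult rev_prod_closed)
qed (simp add: assms(1))

lemma tri_prod_commute:
  assumes "c \<in> carrier G" "\<And>i j. i < j \<Longrightarrow> j < m \<Longrightarrow> F j i \<in> carrier G"
    "\<And>i j. i < j \<Longrightarrow> j < m \<Longrightarrow> c \<otimes> F j i = F j i \<otimes> c"
  shows "c \<otimes> tri_prod G F m = tri_prod G F m \<otimes> c"
  using assms(2,3)
proof (induction m)
  case (Suc m)
  have "c \<otimes> rev_prod G (F m) m = rev_prod G (F m) m \<otimes> c"
    using Suc.prems by (intro rev_prod_commute assms(1)) auto
  then show ?case
    using Suc assms(1) by (auto intro!: commute_mult rev_prod_closed tri_prod_closed)
qed (simp add: assms(1))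

lemma swap_middle:
  assumes "b \<otimes> c = c \<otimes> b" "a \<in> carrier G" "b \<in> carrier G" "c \<in> carrier G" "d \<in> carrier G"
  shows "a \<otimes> b \<otimes> (c \<otimes> d) = a \<otimes> c \<otimes> (b \<otimes> d)"
proof -
  have "a \<otimes> b \<otimes> (c \<otimes> d) = a \<otimes> (b \<otimes> c) \<otimes> d" using assms(2-) by (simp add: m_assoc)
  also have "\<dots> = a \<otimes> c \<otimes> (b \<otimes> d)" unfolding assms(1) using assms(2-) by (simp add: m_assoc)
  finally show ?thesis .
qed

text \<open>Factors with the same index keep their order, so only factors with different indices
  need to commute.\<close>

lemma rev_prod_mult:
  assumes "\<And>i. i < m \<Longrightarrow> y i \<in> carrier G" "\<And>i. i < m \<Longrightarrow> z i \<in> carrier G"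
    and "\<And>i k. i < m \<Longrightarrow> k < m \<Longrightarrow> i \<noteq> k \<Longrightarrow> z i \<otimes> y k = y k \<otimes> z i"
  shows "rev_prod G (\<lambda>i. y i \<otimes> z i) m = rev_prod G y m \<otimes> rev_prod G z m"
  using assms
proof (induction m)
  case (Suc m)
  have "z m \<otimes> rev_prod G y m = rev_prod G y m \<otimes> z m"
    using Suc.prems by (intro rev_prod_commute) auto
  then show ?case
    using Suc by (simp add: swap_middle rev_prod_closed)
qed simp

lemma fwd_prod_commute:
  assumes "c \<in> carrier G" "\<And>i. i < m \<Longrightarrow> f i \<in> carrier G" "\<And>i. i < m \<Longrightarrow> c \<otimes> f i = f i \<otimes> c"
  shows "c \<otimes> fwd_prod G f m = fwd_prod G f m \<otimes> c"
  using assms(2,3)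
proof (induction m)
  case (Suc m)
  then show ?case
    using assms(1) by (auto intro!: commute_mult fwd_prod_closed)
qed (simp add: assms(1))

lemma fwd_prod_mult:
  assumes "\<And>i. i < m \<Longrightarrow> y i \<in> carrier G" "\<And>i. i < m \<Longrightarrow> z i \<in> carrier G"
    and "\<And>i k. i < m \<Longrightarrow> k < m \<Longrightarrow> i \<noteq> k \<Longrightarrow> y i \<otimes> z k = z k \<otimes> y i"
  shows "fwd_prod G (\<lambda>i. y i \<otimes> z i) m = fwd_prod G y m \<otimes> fwd_prod G z m"
  using assms
proof (induction m)
  case (Suc m)
  have "y m \<otimes> fwd_prod G z m = fwd_prod G z m \<otimes> y m"
    using Suc.prems by (intro fwd_prod_commute) auto
  then have "fwd_prod G y m \<otimes> fwd_prod G z m \<otimes> (y m \<otimes> z m) = fwd_prod G y m \<otimes> y m \<otimes> (fwd_prod G z m \<otimes> z m)"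
    using Suc.prems by (intro swap_middle) (auto intro: fwd_prod_closed)
  then show ?case using Suc by simp
qed simp

lemma intertwine_mult:
  assumes "a \<otimes> p = p \<otimes> c" "c \<otimes> q = q \<otimes> d"
    "a \<in> carrier G" "c \<in> carrier G" "d \<in> carrier G" "p \<in> carrier G" "q \<in> carrier G"
  shows "a \<otimes> (p \<otimes> q) = p \<otimes> q \<otimes> d"
  using assms by (metis m_assoc)

text \<open>The element \<open>a\<close> passes unchanged up to index \<open>k\<close>, becomes
  \<open>b\<close> there, and \<open>b\<close> passes the remaining factors.\<close>

lemma fwd_prod_intertwine:
  assumes "\<And>i. i < m \<Longrightarrow> f i \<in> carrier G" "a \<in> carrier G" "b \<in> carrier G" "k < m"
    and "\<And>i. i < m \<Longrightarrow> i \<noteq> k \<Longrightarrow> a \<otimes> f i = f i \<otimes> a" "\<And>i. i < m \<Longrightarrow> i \<noteq> k \<Longrightarrow> b \<otimes> f i = f i \<otimes> b"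
    and "a \<otimes> f k = f k \<otimes> b"
  shows "a \<otimes> fwd_prod G f m = fwd_prod G f m \<otimes> b"
proof -
  \<comment> \<open>Stated for every initial segment, with the element that emerges depending on
    whether \<open>k\<close> has been passed.\<close>
  have "a \<otimes> fwd_prod G f l = fwd_prod G f l \<otimes> (if k < l then b else a)" if "l \<le> m" for l
    using that
  proof (induction l)
    case (Suc l)
    let ?c = "if k < l then b else a" and ?d = "if k < Suc l then b else a"
    have l: "l < m" and c: "?c \<in> carrier G" "?d \<in> carrier G" "f l \<in> carrier G" "fwd_prod G f l \<in> carrier G"
      using Suc.prems assms(1-3) by (auto intro: fwd_prod_closed)
    have "?c \<otimes> f l = f l \<otimes> ?d"
      using assms(5-7) l by (cases "l = k") auto
    then show ?case
      using Suc c assms(2) unfolding fwd_prod.simps by (intro intertwine_mult[of _ _ ?c]) simp_all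
  qed (simp add: assms(2))
  from this[of m] show ?thesis using assms(4) by simp
qed

lemma list_prod_tri:
  assumes "\<And>i j. i < j \<Longrightarrow> j < m \<Longrightarrow> f (j + 1) (i + 1) \<in> carrier G"
  shows "list_prod G (concat (map (\<lambda>j. map (f j) (rev [1..<j])) [2..<m + 1])) =
    tri_prod G (\<lambda>j i. f (j + 1) (i + 1)) m"
  using assms
proof (induction m)
  case (Suc m)
  have row: "set (map (f (j + 1)) (rev [1..<j + 1])) \<subseteq> carrier G" if "j < Suc m" for j
  proof
    fix x assume "x \<in> set (map (f (j + 1)) (rev [1..<j + 1]))"
    then obtain i where "x = f (j + 1) i" "1 \<le> i" "i \<le> j" by auto
    then show "x \<in> carrier G" using Suc.prems[of "i - 1" j] that by simp
  qed
  show ?case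
  \<comment> \<open>The list of rows starts at 2: the row with number 1 is empty, and it is row 0 of
    \<open>tri_prod\<close>.\<close>
  proof (cases "m = 0")
    case True
    then have "[2..<Suc m + 1] = []" by simp
    then show ?thesis unfolding True tri_prod.simps rev_prod.simps by simp
  next
    case False
    then have "[2..<Suc m + 1] = [2..<m + 1] @ [m + 1]" by (simp add: upt_Suc)
    moreover have "set (concat (map (\<lambda>j. map (f j) (rev [1..<j])) [2..<m + 1])) \<subseteq> carrier G"
    proof
      fix x assume "x \<in> set (concat (map (\<lambda>j. map (f j) (rev [1..<j])) [2..<m + 1]))"
      then obtain j where j: "j \<in> set [2..<m + 1]" "x \<in> f j ` set (rev [1..<j])"
        unfolding set_concat set_map by (elim UnionE imageE, hypsubst, unfold set_map) (rule that)
      then have "j - 1 < Suc m" "j - 1 + 1 = j" by auto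
      then show "x \<in> carrier G" using row[of "j - 1"] j(2) by auto
    qed
    ultimately show ?thesis
      using Suc row[of m] list_prod_rev_upt[of G "f (m + 1)" m] by (simp add: list_prod_append)
  qed
qed simp

end

lemma fwd_prod_hom:
  assumes h: "h \<in> alg_hom K A B" and A: "monoid A" and "\<And>i. i < m \<Longrightarrow> f i \<in> carrier A"
  shows "h (fwd_prod A f m) = fwd_prod B (\<lambda>i. h (f i)) m"
  using assms(3)
  by (induction m) (simp_all add: alg_hom_one[OF h] alg_hom_mult[OF h] monoid.fwd_prod_closed[OF A])

lemma rev_prod_hom:
  assumes h: "h \<in> alg_hom K A B" and A: "monoid A" and "\<And>i. i < m \<Longrightarrow> f i \<in> carrier A"
  shows "h (rev_prod A f m) = rev_prod B (\<lambda>i. h (f i)) m"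
  using assms(3)
  by (induction m) (simp_all add: alg_hom_one[OF h] alg_hom_mult[OF h] monoid.rev_prod_closed[OF A])

lemma tri_prod_hom:
  assumes h: "h \<in> alg_hom K A B" and A: "monoid A" and "\<And>i j. i < j \<Longrightarrow> j < m \<Longrightarrow> F j i \<in> carrier A"
  shows "h (tri_prod A F m) = tri_prod B (\<lambda>j i. h (F j i)) m"
  using assms(3)
  by (induction m) (simp_all add: alg_hom_one[OF h] alg_hom_mult[OF h] rev_prod_hom[OF h A]
      monoid.rev_prod_closed[OF A] monoid.tri_prod_closed[OF A])

section \<open>The cocycle identity for triangular products\<close>

text \<open>
  The indices \<open>(j, i)\<close> with \<open>i < j\<close> stand for factors in the positions \<open>(a\<^sub>j, b\<^sub>i)\<close>, \<open>(a\<^sub>j, c\<^sub>i)\<close> and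
  \<open>(b\<^sub>j, c\<^sub>i)\<close> of three blocks \<open>a\<close>, \<open>b\<close>, \<open>c\<close>. Factors commute unless they share a position, and
  the last assumption is the Yang--Baxter equation in the positions \<open>a\<^sub>j, b\<^sub>k, c\<^sub>i\<close>.
\<close>

locale yang_baxter_triangles = monoid G for G (structure) +
  fixes x y z :: "nat \<Rightarrow> nat \<Rightarrow> 'a" and n :: nat
  assumes closed: "\<And>i j. i < j \<Longrightarrow> j < n \<Longrightarrow> x j i \<in> carrier G" "\<And>i j. i < j \<Longrightarrow> j < n \<Longrightarrow> y j i \<in> carrier G"
      "\<And>i j. i < j \<Longrightarrow> j < n \<Longrightarrow> z j i \<in> carrier G"
    and yz: "\<And>i j k l. \<lbrakk>i < j; j < n; k < l; l < n; i \<noteq> k\<rbrakk> \<Longrightarrow> z l k \<otimes> y j i = y j i \<otimes> z l k"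
    and xz: "\<And>i j k l. \<lbrakk>i < j; j < n; k < l; l < n; i \<noteq> l\<rbrakk> \<Longrightarrow> z l k \<otimes> x j i = x j i \<otimes> z l k"
    and xy: "\<And>i j k l. \<lbrakk>i < j; j < n; k < l; l < n; j \<noteq> l\<rbrakk> \<Longrightarrow> y l k \<otimes> x j i = x j i \<otimes> y l k"
    and YB: "\<And>i j k. \<lbrakk>i < k; k < j; j < n\<rbrakk> \<Longrightarrow> x j k \<otimes> (y j i \<otimes> z k i) = z k i \<otimes> y j i \<otimes> x j k"
begin

text \<open>The Yang-Baxter equation moves only a pair \<open>z k i\<close>, \<open>y j i\<close>
  past \<open>x j k\<close>. The two rows are interleaved into such pairs, which is possible because
  factors with different positions in block \<open>c\<close> commute.\<close>

lemma row_YB: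
  assumes "m \<le> k" "k < j" "j < n"
  shows "rev_prod G (z k) m \<otimes> rev_prod G (y j) m \<otimes> x j k = x j k \<otimes> (rev_prod G (y j) m \<otimes> rev_prod G (z k) m)"
proof -
  have "rev_prod G (\<lambda>i. z k i \<otimes> y j i) l \<otimes> x j k = x j k \<otimes> rev_prod G (\<lambda>i. y j i \<otimes> z k i) l" if "l \<le> m" for l
    using that
  proof (induction l)
    case (Suc l)
    have l: "l < k" "l < j" using Suc.prems assms by simp_all
    have c: "x j k \<in> carrier G" "z k l \<in> carrier G" "y j l \<in> carrier G"
      "rev_prod G (\<lambda>i. z k i \<otimes> y j i) l \<in> carrier G" "rev_prod G (\<lambda>i. y j i \<otimes> z k i) l \<in> carrier G"
      using l assms by (auto intro!: closed rev_prod_closed m_closed)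
    have "z k l \<otimes> y j l \<otimes> rev_prod G (\<lambda>i. z k i \<otimes> y j i) l \<otimes> x j k =
        z k l \<otimes> y j l \<otimes> (rev_prod G (\<lambda>i. z k i \<otimes> y j i) l \<otimes> x j k)"
      using c by (simp add: m_assoc)
    also have "\<dots> = z k l \<otimes> y j l \<otimes> x j k \<otimes> rev_prod G (\<lambda>i. y j i \<otimes> z k i) l"
      using Suc c by (simp add: m_assoc)
    also have "\<dots> = x j k \<otimes> (y j l \<otimes> z k l \<otimes> rev_prod G (\<lambda>i. y j i \<otimes> z k i) l)"
      unfolding YB[OF l(1) assms(2,3), symmetric] using c by (simp add: m_assoc)
    finally show ?case by simp
  qed (use assms closed in simp)
  from this[of m] show ?thesis
    using assms closed yz by (simp add: rev_prod_mult)
qed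

text \<open>Row \<open>m\<close> of the \<open>z\<close> triangle meets just one factor of row
  \<open>j\<close> of \<open>x\<close>, namely \<open>x j m\<close>, which shares the position in
  block \<open>b\<close>. It is carried past that factor by \<open>row_YB\<close>, together with the
  row of \<open>y\<close>; the remaining exchanges involve no common position.\<close>

lemma triangle_past_row:
  assumes "m \<le> j" "j < n"
  shows "tri_prod G z m \<otimes> (rev_prod G (y j) m \<otimes> rev_prod G (x j) m) =
    rev_prod G (\<lambda>i. y j i \<otimes> x j i) m \<otimes> tri_prod G z m"
  using assms(1)
proof (induction m)
  case (Suc m)
  have m: "m < j" using Suc.prems by simp
  let ?Z = "tri_prod G z m" and ?R = "rev_prod G (z m) m" and ?Y = "rev_prod G (y j) m" and ?X = "rev_prod G (x j) m"
  let ?W = "rev_prod G (\<lambda>i. y j i \<otimes> x j i) m"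
  have c: "?Z \<in> carrier G" "?R \<in> carrier G" "?Y \<in> carrier G" "?X \<in> carrier G" "?W \<in> carrier G"
    "y j m \<in> carrier G" "x j m \<in> carrier G"
    using m assms(2) by (auto intro!: closed rev_prod_closed tri_prod_closed m_closed)
  have y1: "y j m \<otimes> ?R = ?R \<otimes> y j m" and y2: "y j m \<otimes> ?Z = ?Z \<otimes> y j m"
    and x1: "x j m \<otimes> ?Z = ?Z \<otimes> x j m"
    using m assms(2) yz xz by (auto intro!: rev_prod_commute tri_prod_commute closed)
  have r1: "?R \<otimes> ?X = ?X \<otimes> ?R"
  proof (rule rev_prod_commute[OF c(2)])
    fix i assume i: "i < m"
    then show "x j i \<in> carrier G" using m assms(2) by (intro closed) simp_all
    then have "x j i \<otimes> ?R = ?R \<otimes> x j i"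
      using i m assms(2) xz by (intro rev_prod_commute closed) auto
    then show "?R \<otimes> x j i = x j i \<otimes> ?R" by simp
  qed
  have "?Z \<otimes> ?R \<otimes> (y j m \<otimes> ?Y \<otimes> (x j m \<otimes> ?X)) = ?Z \<otimes> (?R \<otimes> y j m) \<otimes> ?Y \<otimes> x j m \<otimes> ?X"
    using c by (simp add: m_assoc)
  also have "\<dots> = (?Z \<otimes> y j m) \<otimes> (?R \<otimes> ?Y \<otimes> x j m) \<otimes> ?X"
    unfolding y1[symmetric] using c by (simp add: m_assoc)
  also have "\<dots> = y j m \<otimes> (?Z \<otimes> x j m) \<otimes> ?Y \<otimes> (?R \<otimes> ?X)"
    unfolding y2[symmetric] row_YB[OF order_refl m assms(2)] using c by (simp add: m_assoc)
  also have "\<dots> = y j m \<otimes> x j m \<otimes> (?Z \<otimes> (?Y \<otimes> ?X)) \<otimes> ?R"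
    unfolding x1[symmetric] r1 using c by (simp add: m_assoc)
  also have "?Z \<otimes> (?Y \<otimes> ?X) = ?W \<otimes> ?Z"
    using Suc by simp
  finally show ?case using c by (simp add: m_assoc)
qed simp

text \<open>Row \<open>m\<close> of \<open>y\<close> and \<open>z\<close> shares no position with
  the earlier rows of \<open>x\<close>, and row \<open>m\<close> of \<open>z\<close> none with row
  \<open>m\<close> of \<open>x\<close>. Moving them apart leaves the smaller identity followed by
  the old \<open>z\<close> triangle in front of the new rows of \<open>y\<close> and
  \<open>x\<close>, which is \<open>triangle_past_row\<close>.\<close>

lemma triangle_cocycle:
  "m \<le> n \<Longrightarrow> tri_prod G (\<lambda>j i. y j i \<otimes> z j i) m \<otimes> tri_prod G x m =
    tri_prod G (\<lambda>j i. y j i \<otimes> x j i) m \<otimes> tri_prod G z m"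
proof (induction m)
  case (Suc m)
  have m: "m < n" using Suc.prems by simp
  let ?P = "tri_prod G (\<lambda>j i. y j i \<otimes> z j i) m" and ?X = "tri_prod G x m" and ?Z = "tri_prod G z m"
    and ?W = "tri_prod G (\<lambda>j i. y j i \<otimes> x j i) m"
  let ?y = "rev_prod G (y m) m" and ?z = "rev_prod G (z m) m" and ?x = "rev_prod G (x m) m"
    and ?w = "rev_prod G (\<lambda>i. y m i \<otimes> x m i) m"
  have c: "?P \<in> carrier G" "?X \<in> carrier G" "?Z \<in> carrier G" "?W \<in> carrier G" "?y \<in> carrier G"
    "?z \<in> carrier G" "?x \<in> carrier G" "?w \<in> carrier G"
    using m by (auto intro!: closed rev_prod_closed tri_prod_closed m_closed)
  have yz': "rev_prod G (\<lambda>i. y m i \<otimes> z m i) m = ?y \<otimes> ?z"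
    using m yz closed by (intro rev_prod_mult) auto
  have zx: "?z \<otimes> ?x = ?x \<otimes> ?z"
  proof (rule rev_prod_commute[OF c(6)])
    fix i assume i: "i < m"
    then show "x m i \<in> carrier G" using m by (intro closed)
    then have "x m i \<otimes> ?z = ?z \<otimes> x m i"
      using i m xz by (intro rev_prod_commute closed) auto
    then show "?z \<otimes> x m i = x m i \<otimes> ?z" by simp
  qed
  have zX: "?z \<otimes> ?X = ?X \<otimes> ?z" and yX: "?y \<otimes> ?X = ?X \<otimes> ?y"
  proof -
    have "x j i \<otimes> ?z = ?z \<otimes> x j i" "x j i \<otimes> ?y = ?y \<otimes> x j i" if "i < j" "j < m" for i j
      using that m xz xy by (auto intro!: rev_prod_commute closed)
    then show "?z \<otimes> ?X = ?X \<otimes> ?z" "?y \<otimes> ?X = ?X \<otimes> ?y"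
      using m c by (auto intro!: tri_prod_commute closed)
  qed
  have "?P \<otimes> (?y \<otimes> ?z) \<otimes> (?X \<otimes> ?x) = ?P \<otimes> ?y \<otimes> (?z \<otimes> ?X) \<otimes> ?x"
    using c by (simp add: m_assoc)
  also have "\<dots> = ?P \<otimes> (?y \<otimes> ?X) \<otimes> (?z \<otimes> ?x)"
    unfolding zX using c by (simp add: m_assoc)
  also have "\<dots> = (?P \<otimes> ?X) \<otimes> ?y \<otimes> ?x \<otimes> ?z"
    unfolding yX zx using c by (simp add: m_assoc)
  also have "?P \<otimes> ?X = ?W \<otimes> ?Z"
    using Suc by simp
  also have "?W \<otimes> ?Z \<otimes> ?y \<otimes> ?x \<otimes> ?z = ?W \<otimes> (?Z \<otimes> (?y \<otimes> ?x)) \<otimes> ?z"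
    using c by (simp add: m_assoc)
  also have "\<dots> = ?W \<otimes> ?w \<otimes> (?Z \<otimes> ?z)"
    unfolding triangle_past_row[OF order_refl m] using c by (simp add: m_assoc)
  finally show ?case by (simp add: yz')
qed simp

end



section \<open>The twists of a tensor power\<close>

text \<open>
  Since the signs come from a linear order, the middle sign of a Yang--Baxter equation is one of the
  other two, which is what \<open>R_matrix_Yang_Baxter\<close> requires.
\<close>

lemma R_sign_sgn_diff_cases:
  "R_sign S R (sgn (int a - int c)) = R_sign S R (sgn (int a - int b)) \<or>
   R_sign S R (sgn (int a - int c)) = R_sign S R (sgn (int b - int c))"
  by (auto simp: R_sign_def sgn_if)

context bialgebra_power
begin

sublocale PB: topological_bialgebra T
  by (rule topological_bialgebra_power)

lemma leg_power_leg3: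
  assumes "positions (n * 3) [a, b, c]" "positions 3 [p, q]" "x \<in> carrier (tpow S 2)"
  shows "leg S (n * 3) [a, b, c] (leg S 3 [p, q] x) = leg S (n * 3) [[a, b, c] ! (p - 1), [a, b, c] ! (q - 1)] x"
  using leg_leg[OF assms(2,1)] assms(3) by simp

lemma leg2_commute:
  assumes "positions N [p, q, r, s]" "x \<in> carrier (tpow S 2)" "y \<in> carrier (tpow S 2)"
  shows "leg S N [p, q] x \<otimes>\<^bsub>tpow S N\<^esub> leg S N [r, s] y = leg S N [r, s] y \<otimes>\<^bsub>tpow S N\<^esub> leg S N [p, q] x"
  using leg_commute[of N "[p, q]" "[r, s]" x y] assms by simp

lemma cop_power_R_matrix:
  assumes k: "1 \<le> k" "k \<le> n" "1 \<le> l" "l \<le> n" and Q: "R_matrix S Q"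
  shows "cop T 2 1 (leg S (n * 2) [k, n + l] Q) =
      leg S (n * 3) [k, 2 * n + l] Q \<otimes>\<^bsub>tpow S (n * 3)\<^esub> leg S (n * 3) [n + k, 2 * n + l] Q"
    and "cop T 2 2 (leg S (n * 2) [k, n + l] Q) =
      leg S (n * 3) [k, 2 * n + l] Q \<otimes>\<^bsub>tpow S (n * 3)\<^esub> leg S (n * 3) [k, n + l] Q"
proof -
  note Qc = R_matrix_closed[OF Q]
  have p: "positions (n * 3) [k, n + k, 2 * n + l]" "positions (n * 3) [k, n + l, 2 * n + l]"
    using k by (auto simp: positions_def)
  show "cop T 2 1 (leg S (n * 2) [k, n + l] Q) =
      leg S (n * 3) [k, 2 * n + l] Q \<otimes>\<^bsub>tpow S (n * 3)\<^esub> leg S (n * 3) [n + k, 2 * n + l] Q"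
    unfolding cop_power_leg2[OF k Qc] R_matrix_cop1[OF Q]
    using Qc leg_mult[OF p(1), of 3] leg_power_leg3[OF p(1)] by (simp add: positions_def)
  show "cop T 2 2 (leg S (n * 2) [k, n + l] Q) =
      leg S (n * 3) [k, 2 * n + l] Q \<otimes>\<^bsub>tpow S (n * 3)\<^esub> leg S (n * 3) [k, n + l] Q"
    unfolding cop_power_leg2[OF k Qc] R_matrix_cop2[OF Q]
    using Qc leg_mult[OF p(2), of 3] leg_power_leg3[OF p(2)] by (simp add: positions_def)
qed

lemma leg_power_3:
  assumes k: "1 \<le> k" "k \<le> n" "1 \<le> l" "l \<le> n" and x: "x \<in> carrier (tpow S 2)"
  shows "leg T 3 [1, 2] (leg S (n * 2) [k, n + l] x) = leg S (n * 3) [k, n + l] x"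
    and "leg T 3 [1, 3] (leg S (n * 2) [k, n + l] x) = leg S (n * 3) [k, 2 * n + l] x"
    and "leg T 3 [2, 3] (leg S (n * 2) [k, n + l] x) = leg S (n * 3) [n + k, 2 * n + l] x"
  using leg_power_leg2[OF _ k x, of 3 1 2] leg_power_leg2[OF _ k x, of 3 1 3] leg_power_leg2[OF _ k x, of 3 2 3]
  by (simp_all add: positions_def)

lemma leg_power_3_hom:
  assumes "positions 3 [p, q]"
  shows "leg T 3 [p, q] \<in> alg_hom (scalars S) (tpow S (n * 2)) (tpow S (n * 3))"
  using P.leg_hom[OF assms] by simp

lemma cop_power_hom:
  "cop T 2 1 \<in> alg_hom (scalars S) (tpow S (n * 2)) (tpow S (n * 3))"
  "cop T 2 2 \<in> alg_hom (scalars S) (tpow S (n * 2)) (tpow S (n * 3))"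
  using PB.cop2_hom by simp_all

lemma cou_power_hom:
  "cou T 2 1 \<in> alg_hom (scalars S) (tpow S (n * 2)) (tpow S n)"
  "cou T 2 2 \<in> alg_hom (scalars S) (tpow S (n * 2)) (tpow S n)"
  using PB.cou_hom[of 1 2] PB.cou_hom[of 2 2] by simp_all

section \<open>The twist and the diagonal R-matrix built from a fixed R-matrix\<close>

context
  fixes R :: 'a and w :: "nat \<Rightarrow> nat"
  assumes R: "R_matrix S R"
begin

abbreviation sign_R :: "nat \<Rightarrow> nat \<Rightarrow> 'a" where
  "sign_R j i \<equiv> R_sign S R (sgn (int (w (j + 1)) - int (w (i + 1))))"

lemma sign_R: "R_matrix S (sign_R j i)" "sign_R j i \<in> carrier (tpow S 2)" "sign_R j i \<in> Units (tpow S 2)"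
  using R_matrix_R_sign[OF R] R_matrix_closed R_matrix_Units by blast+

lemma leg_sign_R_closed:
  "positions N [p, q] \<Longrightarrow> leg S N [p, q] (sign_R j i) \<in> carrier (tpow S N)"
  "positions N [p, q] \<Longrightarrow> leg S N [p, q] (sign_R j i) \<in> Units (tpow S N)"
  using leg_closed[OF _ _ sign_R(2)] leg_Units[OF _ _ sign_R(3)] by simp_all

lemma J_elem_tri:
  "J_elem S R n w = tri_prod (tpow S (n * 2)) (\<lambda>j i. leg S (n * 2) [j + 1, n + (i + 1)] (sign_R j i)) n"
  unfolding J_elem_def mult.commute[of 2 n]
  by (rule A.list_prod_tri) (auto intro!: leg_sign_R_closed simp: positions_def)

lemma J_elem_Units: "J_elem S R n w \<in> Units (tpow S (n * 2))"
  unfolding J_elem_tri by (intro A.tri_prod_Units leg_sign_R_closed) (auto simp: positions_def)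

text \<open>All maps in the cocycle and counit conditions are algebra homomorphisms, so they can be
  evaluated factor by factor without changing the triangular order.\<close>

lemma hom_J_elem:
  assumes "h \<in> alg_hom (scalars S) (tpow S (n * 2)) (tpow S N)"
    and "\<And>i j. i < j \<Longrightarrow> j < n \<Longrightarrow> h (leg S (n * 2) [j + 1, n + (i + 1)] (sign_R j i)) = F j i"
  shows "h (J_elem S R n w) = tri_prod (tpow S N) F n"
proof -
  have "h (J_elem S R n w) = tri_prod (tpow S N) (\<lambda>j i. h (leg S (n * 2) [j + 1, n + (i + 1)] (sign_R j i))) n"
    unfolding J_elem_tri
    by (rule tri_prod_hom[OF assms(1) A.monoid_axioms])
      (intro leg_sign_R_closed, auto simp: positions_def)
  also have "\<dots> = tri_prod (tpow S N) F n"
    by (rule tri_prod_cong) (rule assms(2))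
  finally show ?thesis .
qed

text \<open>Each factor has one leg in each block, so a block counit reduces to the counit of an
  R-matrix of \<open>S\<close>, which is 1.\<close>

lemma counit_J_elem: "cou T 2 1 (J_elem S R n w) = \<one>\<^bsub>tpow S n\<^esub>" "cou T 2 2 (J_elem S R n w) = \<one>\<^bsub>tpow S n\<^esub>"
proof -
  have one: "cou T 2 1 (leg S (n * 2) [j + 1, n + (i + 1)] (sign_R j i)) = \<one>\<^bsub>tpow S n\<^esub>"
    "cou T 2 2 (leg S (n * 2) [j + 1, n + (i + 1)] (sign_R j i)) = \<one>\<^bsub>tpow S n\<^esub>" if "i < j" "j < n" for i j
    using that cou_power_leg2[of "j + 1" "i + 1" "sign_R j i"] sign_R R_matrix_counit[OF sign_R(1)]
    by (simp_all add: leg_one)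
  show "cou T 2 1 (J_elem S R n w) = \<one>\<^bsub>tpow S n\<^esub>" "cou T 2 2 (J_elem S R n w) = \<one>\<^bsub>tpow S n\<^esub>"
    using hom_J_elem[OF cou_power_hom(1), of "\<lambda>j i. \<one>\<^bsub>tpow S n\<^esub>"] one
      hom_J_elem[OF cou_power_hom(2), of "\<lambda>j i. \<one>\<^bsub>tpow S n\<^esub>"]
    by (simp_all add: A.tri_prod_one)
qed

lemma yang_baxter_triangles_sign_R:
  "yang_baxter_triangles (tpow S (n * 3))
    (\<lambda>j i. leg S (n * 3) [j + 1, n + (i + 1)] (sign_R j i))
    (\<lambda>j i. leg S (n * 3) [j + 1, 2 * n + (i + 1)] (sign_R j i))
    (\<lambda>j i. leg S (n * 3) [n + (j + 1), 2 * n + (i + 1)] (sign_R j i)) n"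
proof (rule yang_baxter_triangles.intro[OF A.monoid_axioms yang_baxter_triangles_axioms.intro])
  show "leg S (n * 3) [j + 1, n + (i + 1)] (sign_R j i) \<in> carrier (tpow S (n * 3))"
    "leg S (n * 3) [j + 1, 2 * n + (i + 1)] (sign_R j i) \<in> carrier (tpow S (n * 3))"
    "leg S (n * 3) [n + (j + 1), 2 * n + (i + 1)] (sign_R j i) \<in> carrier (tpow S (n * 3))"
    if "i < j" "j < n" for i j
    by (rule leg_sign_R_closed; use that in \<open>simp add: positions_def\<close>)+
  show "leg S (n * 3) [n + (l + 1), 2 * n + (k + 1)] (sign_R l k) \<otimes>\<^bsub>tpow S (n * 3)\<^esub> leg S (n * 3) [j + 1, 2 * n + (i + 1)] (sign_R j i) =
      leg S (n * 3) [j + 1, 2 * n + (i + 1)] (sign_R j i) \<otimes>\<^bsub>tpow S (n * 3)\<^esub> leg S (n * 3) [n + (l + 1), 2 * n + (k + 1)] (sign_R l k)"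
    if "i < j" "j < n" "k < l" "l < n" "i \<noteq> k" for i j k l
    by (rule leg2_commute[OF _ sign_R(2) sign_R(2)]) (use that in \<open>simp add: positions_def\<close>)
  show "leg S (n * 3) [n + (l + 1), 2 * n + (k + 1)] (sign_R l k) \<otimes>\<^bsub>tpow S (n * 3)\<^esub> leg S (n * 3) [j + 1, n + (i + 1)] (sign_R j i) =
      leg S (n * 3) [j + 1, n + (i + 1)] (sign_R j i) \<otimes>\<^bsub>tpow S (n * 3)\<^esub> leg S (n * 3) [n + (l + 1), 2 * n + (k + 1)] (sign_R l k)"
    if "i < j" "j < n" "k < l" "l < n" "i \<noteq> l" for i j k l
    by (rule leg2_commute[OF _ sign_R(2) sign_R(2)]) (use that in \<open>simp add: positions_def\<close>)
  show "leg S (n * 3) [l + 1, 2 * n + (k + 1)] (sign_R l k) \<otimes>\<^bsub>tpow S (n * 3)\<^esub> leg S (n * 3) [j + 1, n + (i + 1)] (sign_R j i) =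
      leg S (n * 3) [j + 1, n + (i + 1)] (sign_R j i) \<otimes>\<^bsub>tpow S (n * 3)\<^esub> leg S (n * 3) [l + 1, 2 * n + (k + 1)] (sign_R l k)"
    if "i < j" "j < n" "k < l" "l < n" "j \<noteq> l" for i j k l
    by (rule leg2_commute[OF _ sign_R(2) sign_R(2)]) (use that in \<open>simp add: positions_def\<close>)
  fix i j k assume ij: "i < k" "k < j" "j < n"
  have p: "positions (n * 3) [j + 1, n + (k + 1), 2 * n + (i + 1)]"
    using ij by (simp add: positions_def)
  let ?h = "leg S (n * 3) [j + 1, n + (k + 1), 2 * n + (i + 1)]"
  let ?P = "sign_R j k" and ?Q = "sign_R j i" and ?R = "sign_R k i"
  have c: "leg S 3 [a, b] (sign_R q r) \<in> carrier (tpow S 3)" if "positions 3 [a, b]" for a b q r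
    by (rule leg_sign_R_closed[OF that])
  have cs: "?Q = ?P \<or> ?Q = ?R" by (rule R_sign_sgn_diff_cases)
  have "leg S 3 [1, 2] ?P \<otimes>\<^sub>3 (leg S 3 [1, 3] ?Q \<otimes>\<^sub>3 leg S 3 [2, 3] ?R) =
      leg S 3 [2, 3] ?R \<otimes>\<^sub>3 leg S 3 [1, 3] ?Q \<otimes>\<^sub>3 leg S 3 [1, 2] ?P"
    using cs
  proof
    assume Q: "?Q = ?R"
    show ?thesis unfolding Q by (rule R_matrix_Yang_Baxter(1)[OF sign_R(1) sign_R(1)])
  next
    \<comment> \<open>Here the second form of the Yang-Baxter equation is used from right to
      left.\<close>
    assume Q: "?Q = ?P"
    show ?thesis
      unfolding Q using R_matrix_Yang_Baxter(2)[OF sign_R(1)[of j k] sign_R(1)[of k i]]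
      by (simp add: A.m_assoc c positions_def)
  qed
  then have "?h (leg S 3 [1, 2] ?P \<otimes>\<^sub>3 (leg S 3 [1, 3] ?Q \<otimes>\<^sub>3 leg S 3 [2, 3] ?R)) =
      ?h (leg S 3 [2, 3] ?R \<otimes>\<^sub>3 leg S 3 [1, 3] ?Q \<otimes>\<^sub>3 leg S 3 [1, 2] ?P)" by simp
  moreover have "?h (leg S 3 [1, 2] (sign_R q r)) = leg S (n * 3) [j + 1, n + (k + 1)] (sign_R q r)"
    "?h (leg S 3 [1, 3] (sign_R q r)) = leg S (n * 3) [j + 1, 2 * n + (i + 1)] (sign_R q r)"
    "?h (leg S 3 [2, 3] (sign_R q r)) = leg S (n * 3) [n + (k + 1), 2 * n + (i + 1)] (sign_R q r)" for q r
    using leg_power_leg3[OF p _ sign_R(2)] by (simp_all add: positions_def)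
  ultimately show "leg S (n * 3) [j + 1, n + (k + 1)] ?P \<otimes>\<^bsub>tpow S (n * 3)\<^esub>
      (leg S (n * 3) [j + 1, 2 * n + (i + 1)] ?Q \<otimes>\<^bsub>tpow S (n * 3)\<^esub> leg S (n * 3) [n + (k + 1), 2 * n + (i + 1)] ?R) =
      leg S (n * 3) [n + (k + 1), 2 * n + (i + 1)] ?R \<otimes>\<^bsub>tpow S (n * 3)\<^esub>
      leg S (n * 3) [j + 1, 2 * n + (i + 1)] ?Q \<otimes>\<^bsub>tpow S (n * 3)\<^esub> leg S (n * 3) [j + 1, n + (k + 1)] ?P"
    using leg_mult[OF p, of 3] c by (simp add: positions_def)
qed

lemma J_elem_cocycle:
  "cop T 2 1 (J_elem S R n w) \<otimes>\<^bsub>tpow S (n * 3)\<^esub> leg T 3 [1, 2] (J_elem S R n w) =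
   cop T 2 2 (J_elem S R n w) \<otimes>\<^bsub>tpow S (n * 3)\<^esub> leg T 3 [2, 3] (J_elem S R n w)"
proof -
  let ?x = "\<lambda>j i. leg S (n * 3) [j + 1, n + (i + 1)] (sign_R j i)"
  let ?y = "\<lambda>j i. leg S (n * 3) [j + 1, 2 * n + (i + 1)] (sign_R j i)"
  let ?z = "\<lambda>j i. leg S (n * 3) [n + (j + 1), 2 * n + (i + 1)] (sign_R j i)"
  have "cop T 2 1 (J_elem S R n w) = tri_prod (tpow S (n * 3)) (\<lambda>j i. ?y j i \<otimes>\<^bsub>tpow S (n * 3)\<^esub> ?z j i) n"
    by (rule hom_J_elem[OF cop_power_hom(1)], rule cop_power_R_matrix[OF _ _ _ _ sign_R(1)]) simp_all
  moreover have "cop T 2 2 (J_elem S R n w) = tri_prod (tpow S (n * 3)) (\<lambda>j i. ?y j i \<otimes>\<^bsub>tpow S (n * 3)\<^esub> ?x j i) n"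
    by (rule hom_J_elem[OF cop_power_hom(2)], rule cop_power_R_matrix[OF _ _ _ _ sign_R(1)]) simp_all
  moreover have "leg T 3 [1, 2] (J_elem S R n w) = tri_prod (tpow S (n * 3)) ?x n"
    by (rule hom_J_elem[OF leg_power_3_hom], simp add: positions_def, rule leg_power_3[OF _ _ _ _ sign_R(2)]) simp_all
  moreover have "leg T 3 [2, 3] (J_elem S R n w) = tri_prod (tpow S (n * 3)) ?z n"
    by (rule hom_J_elem[OF leg_power_3_hom], simp add: positions_def, rule leg_power_3[OF _ _ _ _ sign_R(2)]) simp_all
  ultimately show ?thesis
    using yang_baxter_triangles.triangle_cocycle[OF yang_baxter_triangles_sign_R order_refl] by simp
qed

text \<open>The factors occupy pairwise disjoint pairs of positions and interact only with the
  components of the same index, so every condition splits into the corresponding condition for one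
  R-matrix of \<open>S\<close>. The signs may therefore be chosen independently.\<close>

lemma R_matrix_R_diag: "R_matrix T (R_diag S R n d)"
proof -
  let ?P = "\<lambda>i. R_sign S R (d (i + 1))"
  let ?F = "\<lambda>i. leg S (n * 2) [i + 1, n + (i + 1)] (?P i)"
  have PR: "R_matrix S (?P i)" for i by (rule R_matrix_R_sign[OF R])
  note Pc = R_matrix_closed[OF PR] and Pu = R_matrix_Units[OF PR]
  have pos: "positions (n * 2) [i + 1, n + (i + 1)]" if "i < n" for i
    using that by (simp add: positions_def)
  have Fc: "?F i \<in> carrier (tpow S (n * 2))" and Fu: "?F i \<in> Units (tpow S (n * 2))" if "i < n" for i
    using leg_closed[OF pos[OF that] _ Pc] leg_Units[OF pos[OF that] _ Pu] by simp_all
  have D: "R_diag S R n d = fwd_prod (tpow S (n * 2)) ?F n"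
    unfolding R_diag_def mult.commute[of 2 n] by (rule A.list_prod_upt) (rule Fc)
  have hom: "h (R_diag S R n d) = fwd_prod (tpow S N) G n"
    if "h \<in> alg_hom (scalars S) (tpow S (n * 2)) (tpow S N)" "\<And>i. i < n \<Longrightarrow> h (?F i) = G i" for h N G
  proof -
    have "h (fwd_prod (tpow S (n * 2)) ?F n) = fwd_prod (tpow S N) (\<lambda>i. h (?F i)) n"
      by (rule fwd_prod_hom[OF that(1) A.monoid_axioms]) (rule Fc)
    also have "\<dots> = fwd_prod (tpow S N) G n"
      by (rule fwd_prod_cong) (rule that(2))
    finally show ?thesis unfolding D .
  qed
  let ?y = "\<lambda>i. leg S (n * 3) [i + 1, 2 * n + (i + 1)] (?P i)"
  let ?z = "\<lambda>i. leg S (n * 3) [n + (i + 1), 2 * n + (i + 1)] (?P i)"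
  let ?x = "\<lambda>i. leg S (n * 3) [i + 1, n + (i + 1)] (?P i)"
  have c3: "leg S (n * 3) [p, q] (?P i) \<in> carrier (tpow S (n * 3))" if "positions (n * 3) [p, q]" for p q i
    using leg_closed[OF that _ Pc] by simp
  have x: "leg T 3 [1, 2] (R_diag S R n d) = fwd_prod (tpow S (n * 3)) ?x n"
    and y: "leg T 3 [1, 3] (R_diag S R n d) = fwd_prod (tpow S (n * 3)) ?y n"
    and z: "leg T 3 [2, 3] (R_diag S R n d) = fwd_prod (tpow S (n * 3)) ?z n"
    by (rule hom[OF leg_power_3_hom], simp add: positions_def, rule leg_power_3[OF _ _ _ _ Pc]; simp)+
  show ?thesis
  proof (rule PB.R_matrixI)
    show "R_diag S R n d \<in> Units (tpow T 2)"
      using A.fwd_prod_Units[of n ?F "n * 2"] Fu by (simp add: D)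
    have "cop T 2 1 (R_diag S R n d) = fwd_prod (tpow S (n * 3)) (\<lambda>i. ?y i \<otimes>\<^bsub>tpow S (n * 3)\<^esub> ?z i) n"
      by (rule hom[OF cop_power_hom(1)], rule cop_power_R_matrix[OF _ _ _ _ PR]) simp_all
    also have "\<dots> = fwd_prod (tpow S (n * 3)) ?y n \<otimes>\<^bsub>tpow S (n * 3)\<^esub> fwd_prod (tpow S (n * 3)) ?z n"
    proof (rule A.fwd_prod_mult)
      show "?y i \<otimes>\<^bsub>tpow S (n * 3)\<^esub> ?z k = ?z k \<otimes>\<^bsub>tpow S (n * 3)\<^esub> ?y i" if "i < n" "k < n" "i \<noteq> k" for i k
        by (rule leg2_commute[OF _ Pc Pc]) (use that in \<open>simp add: positions_def\<close>)
    qed (rule c3, simp add: positions_def)+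
    finally show "cop T 2 1 (R_diag S R n d) =
        leg T 3 [1, 3] (R_diag S R n d) \<otimes>\<^bsub>tpow T 3\<^esub> leg T 3 [2, 3] (R_diag S R n d)"
      unfolding y z by simp
    have "cop T 2 2 (R_diag S R n d) = fwd_prod (tpow S (n * 3)) (\<lambda>i. ?y i \<otimes>\<^bsub>tpow S (n * 3)\<^esub> ?x i) n"
      by (rule hom[OF cop_power_hom(2)], rule cop_power_R_matrix[OF _ _ _ _ PR]) simp_all
    also have "\<dots> = fwd_prod (tpow S (n * 3)) ?y n \<otimes>\<^bsub>tpow S (n * 3)\<^esub> fwd_prod (tpow S (n * 3)) ?x n"
    proof (rule A.fwd_prod_mult)
      show "?y i \<otimes>\<^bsub>tpow S (n * 3)\<^esub> ?x k = ?x k \<otimes>\<^bsub>tpow S (n * 3)\<^esub> ?y i" if "i < n" "k < n" "i \<noteq> k" for i k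
        by (rule leg2_commute[OF _ Pc Pc]) (use that in \<open>simp add: positions_def\<close>)
    qed (rule c3, simp add: positions_def)+
    finally show "cop T 2 2 (R_diag S R n d) =
        leg T 3 [1, 3] (R_diag S R n d) \<otimes>\<^bsub>tpow T 3\<^esub> leg T 3 [1, 2] (R_diag S R n d)"
      unfolding y x by simp
    fix b assume "b \<in> base T"
    then have b: "b \<in> tensors S n" by simp
    have h1: "(\<lambda>x. comult T x) \<in> alg_hom (scalars S) (tpow S n) (tpow S (n * 2))"
      using PB.cop_hom[of 1 1] by simp
    have p21: "positions 2 [2, 1]" by (simp add: positions_def)
    have h2: "leg T 2 [2, 1] \<in> alg_hom (scalars S) (tpow S (n * 2)) (tpow S (n * 2))"
      using P.leg_hom[OF p21] by simp
    have "leg T 2 [2, 1] (comult T b) \<otimes>\<^bsub>tpow S (n * 2)\<^esub> R_diag S R n d = R_diag S R n d \<otimes>\<^bsub>tpow S (n * 2)\<^esub> comult T b"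
    proof (rule intertwine_on_tensors[OF alg_hom_comp[OF h1 h2] h1 _ _ b])
      show "R_diag S R n d \<in> carrier (tpow S (n * 2))"
        unfolding D by (intro A.fwd_prod_closed Fc)
      fix k c assume k: "1 \<le> k" "k \<le> n" and c: "c \<in> base S"
      define l where "l = k - 1"
      have l: "l < n" "k = l + 1" using k by (simp_all add: l_def)
      have cc: "comult S c \<in> carrier (tpow S 2)" "leg S 2 [2, 1] (comult S c) \<in> carrier (tpow S 2)"
        using comult_closed[OF base_carrier[OF c]] by (auto simp: positions_def)
      have lk: "leg S (n * 2) [l + 1, n + (l + 1)] (leg S 2 [2, 1] (comult S c)) = leg S (n * 2) [n + (l + 1), l + 1] (comult S c)"
        using leg_leg[OF p21 pos[OF l(1)]] cc(1) by simp
      have "leg T 2 [2, 1] (comult T (leg S n [k] c)) = leg S (n * 2) [l + 1, n + (l + 1)] (leg S 2 [2, 1] (comult S c))"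
        unfolding comult_power_factor[OF k c] lk
        using leg_power_leg2[OF p21 k k cc(1)] l(2) by simp
      moreover have "comult T (leg S n [k] c) = leg S (n * 2) [l + 1, n + (l + 1)] (comult S c)"
        using comult_power_factor[OF k c] unfolding l(2) .
      moreover have "leg S (n * 2) [l + 1, n + (l + 1)] (leg S 2 [2, 1] (comult S c)) \<otimes>\<^bsub>tpow S (n * 2)\<^esub> R_diag S R n d =
          R_diag S R n d \<otimes>\<^bsub>tpow S (n * 2)\<^esub> leg S (n * 2) [l + 1, n + (l + 1)] (comult S c)"
        unfolding D
      \<comment> \<open>Every factor except the one with index \<open>l\<close> sits in other
        positions; that one turns the flipped coproduct of \<open>c\<close> into the
        coproduct.\<close>
      proof (rule A.fwd_prod_intertwine[OF Fc _ _ l(1)])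
        show "leg S (n * 2) [l + 1, n + (l + 1)] (leg S 2 [2, 1] (comult S c)) \<in> carrier (tpow S (n * 2))"
          "leg S (n * 2) [l + 1, n + (l + 1)] (comult S c) \<in> carrier (tpow S (n * 2))"
          using leg_closed[OF pos[OF l(1)] _ cc(2)] leg_closed[OF pos[OF l(1)] _ cc(1)] by simp_all
        show "leg S (n * 2) [l + 1, n + (l + 1)] (leg S 2 [2, 1] (comult S c)) \<otimes>\<^bsub>tpow S (n * 2)\<^esub> ?F i =
            ?F i \<otimes>\<^bsub>tpow S (n * 2)\<^esub> leg S (n * 2) [l + 1, n + (l + 1)] (leg S 2 [2, 1] (comult S c))"
          "leg S (n * 2) [l + 1, n + (l + 1)] (comult S c) \<otimes>\<^bsub>tpow S (n * 2)\<^esub> ?F i =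
            ?F i \<otimes>\<^bsub>tpow S (n * 2)\<^esub> leg S (n * 2) [l + 1, n + (l + 1)] (comult S c)"
          if "i < n" "i \<noteq> l" for i
          by (rule leg2_commute[OF _ _ Pc]; use that l cc in \<open>simp add: positions_def\<close>)+
        have "leg S (n * 2) [l + 1, n + (l + 1)] (leg S 2 [2, 1] (comult S c) \<otimes>\<^sub>2 ?P l) =
            leg S (n * 2) [l + 1, n + (l + 1)] (?P l \<otimes>\<^sub>2 comult S c)"
          by (simp only: R_matrix_comult[OF PR c])
        then show "leg S (n * 2) [l + 1, n + (l + 1)] (leg S 2 [2, 1] (comult S c)) \<otimes>\<^bsub>tpow S (n * 2)\<^esub> ?F l =
            ?F l \<otimes>\<^bsub>tpow S (n * 2)\<^esub> leg S (n * 2) [l + 1, n + (l + 1)] (comult S c)"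
          using leg_mult[OF pos[OF l(1)], of 2] cc Pc by simp
      qed
      ultimately show "leg T 2 [2, 1] (comult T (leg S n [k] c)) \<otimes>\<^bsub>tpow S (n * 2)\<^esub> R_diag S R n d =
          R_diag S R n d \<otimes>\<^bsub>tpow S (n * 2)\<^esub> comult T (leg S n [k] c)"
        by (simp only:)
    qed
    then show "leg T 2 [2, 1] (comult T b) \<otimes>\<^bsub>tpow T 2\<^esub> R_diag S R n d = R_diag S R n d \<otimes>\<^bsub>tpow T 2\<^esub> comult T b"
      by simp
  qed
qed

end

lemma op_flip_power: "op_flip S n x = leg T 2 [2, 1] x"
  by (simp add: op_flip_def block_def mult.commute)

end

theorem theorem1p7:
  fixes S :: "('k, 'a) tensor_system" and R :: 'a and n :: nat and w :: "nat \<Rightarrow> nat"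
  assumes "topological_bialgebra S"
    and "R_matrix S R"
    and "n \<ge> 1"
    and "w permutes {1..n}"
  shows "drinfeld_twist (tensor_power n S) (J_elem S R n w)
    \<and> topological_bialgebra (twist (tensor_power n S) (J_elem S R n w))
    \<and> (\<forall>h \<in> tensors S n. comult (twist (tensor_power n S) (J_elem S R n w)) h =
          inv\<^bsub>tpow S (2 * n)\<^esub> (J_elem S R n w) \<otimes>\<^bsub>tpow S (2 * n)\<^esub>
          comult (tensor_power n S) h \<otimes>\<^bsub>tpow S (2 * n)\<^esub> J_elem S R n w)
    \<and> (\<forall>d :: nat \<Rightarrow> int. (\<forall>i \<in> {1..n}. d i \<in> {1, -1}) \<longrightarrow>
          R_matrix (twist (tensor_power n S) (J_elem S R n w))
            (inv\<^bsub>tpow S (2 * n)\<^esub> (op_flip S n (J_elem S R n w)) \<otimes>\<^bsub>tpow S (2 * n)\<^esub>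
             R_diag S R n d \<otimes>\<^bsub>tpow S (2 * n)\<^esub> J_elem S R n w))"
proof -
  interpret bialgebra_power S n
    by (rule bialgebra_power.intro[OF assms(1)]) (rule bialgebra_power_axioms.intro[OF assms(3)])
  let ?J = "J_elem S R n w"
  have J: "?J \<in> Units (tpow T 2)"
    using J_elem_Units[OF assms(2)] by simp
  then have Jc: "?J \<in> carrier (tpow T 2)" by (rule P.A.Units_closed)
  have cocycle: "cop T 2 1 ?J \<otimes>\<^bsub>tpow T 3\<^esub> leg T 3 [1, 2] ?J = cop T 2 2 ?J \<otimes>\<^bsub>tpow T 3\<^esub> leg T 3 [2, 3] ?J"
    using J_elem_cocycle[OF assms(2), of w] by simp
  have eps: "cou T 2 1 ?J = \<one>\<^bsub>tpow T 1\<^esub>" "cou T 2 2 ?J = \<one>\<^bsub>tpow T 1\<^esub>"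
    using counit_J_elem[OF assms(2), of w] by simp_all
  have bialg: "topological_bialgebra (twist T ?J)"
    by (rule PB.topological_bialgebra_twist[OF J cocycle eps])
  show ?thesis
  proof (intro conjI allI impI ballI)
    show "drinfeld_twist T ?J"
      unfolding drinfeld_twist_def using J bialg cocycle by blast
    show "topological_bialgebra (twist T ?J)" by (rule bialg)
    show "comult (twist T ?J) h = inv\<^bsub>tpow S (2 * n)\<^esub> ?J \<otimes>\<^bsub>tpow S (2 * n)\<^esub> comult T h \<otimes>\<^bsub>tpow S (2 * n)\<^esub> ?J" for h
      using PB.comult_twist[OF Jc, of h] by (simp add: mult.commute[of 2 n])
    show "R_matrix (twist T ?J) (inv\<^bsub>tpow S (2 * n)\<^esub> (op_flip S n ?J) \<otimes>\<^bsub>tpow S (2 * n)\<^esub>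
        R_diag S R n d \<otimes>\<^bsub>tpow S (2 * n)\<^esub> ?J)" for d
      using PB.R_matrix_twist[OF J cocycle eps R_matrix_R_diag[OF assms(2), of d]]
      unfolding op_flip_power mult.commute[of 2 n] tensor_power_simps(3) .
  qed
qed

end
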